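(* Let $H$ be a vertex bialgebra and let $V$ be an $H$-module nonlocal vertex algebra. Set $V\,\sharp\,H=V\otimes H$ as a vector space. For $u,v\in V$, $h,k\in H$, define $$Y^{\sharp}(u\otimes h,x)(v\otimes k)=\sum Y(u,x)Y(h_{(1)},x)v\otimes Y(h_{(2)},x)k,$$ where $\Delta(h)=\sum h_{(1)}\otimes h_{(2)}$. Then $V\,\sharp\,H$ (with vertex operator map $Y^\sharp$ and vacuum vector $\mathbf{1}\otimes\mathbf{1}$) is a nonlocal vertex algebra with $V$ (identified with $V\otimes\mathbb{C}\mathbf{1}$) and $H$ (identified with $\mathbb{C}\mathbf{1}\otimes H$) as subalgebras, and the following relation holds for $h\in H$, $u\in V$: $$Y^{\sharp}(h,x_1)Y^{\sharp}(u,x_2)=\sum Y^{\sharp}(Y(h_{(1)},x_1-x_2)u,x_2)\,Y^{\sharp}(h_{(2)},x_1).$$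
   Context: All vector spaces are over $\mathbb{C}$; $(x_1\pm x_2)^n$ is expanded in nonnegative powers of the second variable. A nonlocal vertex algebra is a vector space $V$ with a linear map $Y(\cdot,x):V\to\mathrm{Hom}(V,V((x)))$, $v\mapsto Y(v,x)=\sum_{n\in\mathbb{Z}}v_nx^{-n-1}$, and a vacuum vector $\mathbf{1}\in V$ such that $Y(\mathbf{1},x)=1$; $Y(v,x)\mathbf{1}\in V[[x]]$ with $\lim_{x\to0}Y(v,x)\mathbf{1}=v$; and for all $u,v,w\in V$ there is a nonnegative integer $l$ with $(x_0+x_2)^lY(u,x_0+x_2)Y(v,x_2)w=(x_0+x_2)^lY(Y(u,x_0)v,x_2)w$. A module for $V$ is a vector space $W$ with a linear map $Y_W:V\to\mathrm{Hom}(W,W((x)))$ such that $Y_W(\mathbf{1},x)=1_W$ and for all $u,v\in V$, $w\in W$ there is $l\ge0$ with $(x_0+x_2)^lY_W(u,x_0+x_2)Y_W(v,x_2)w=(x_0+x_2)^lY_W(Y(u,x_0)v,x_2)w$. A homomorphism $\psi$ of nonlocal vertex algebras is a linear map with $\psi(\mathbf{1})=\mathbf{1}$ and $\psi(Y(u,x)v)=Y(\psi(u),x)\psi(v)$. The tensor product of nonlocal vertex algebras has vacuum $\mathbf{1}\otimes\mathbf{1}$ and $Y(u\otimes a,x)=Y(u,x)\otimes Y(a,x)$; $\mathbb{C}$ is a nonlocal vertex algebra with $Y(a,x)b=ab$. A vertex bialgebra is a nonlocal vertex algebra $H$ with a (coassociative, counital) coalgebra structure $(H,\Delta,\varepsilon)$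 such that $\Delta:H\to H\otimes H$ and $\varepsilon:H\to\mathbb{C}$ are homomorphisms of nonlocal vertex algebras. Sigma notation: $\Delta(h)=\sum h_{(1)}\otimes h_{(2)}$. An $H$-module nonlocal vertex algebra is a nonlocal vertex algebra $V$ with an $H$-module structure, written $Y(h,x)$ for $h\in H$ ($H$ viewed as a nonlocal vertex algebra), such that for $h\in H$, $u,v\in V$: $Y(h,x)v\in V\otimes\mathbb{C}((x))$; $Y(h,x)\mathbf{1}_V=\varepsilon(h)\mathbf{1}_V$; and $Y(h,x_1)Y(u,x_2)v=\sum Y(Y(h_{(1)},x_1-x_2)u,x_2)Y(h_{(2)},x_1)v$. *)

theory Defs
  imports
    Complex_Main
    "HOL-Library.Poly_Mapping"
    "HOL-Computational_Algebra.Formal_Laurent_Series"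
begin

section \<open>Complex vector spaces\<close>

class complex_vector = ab_group_add +
  fixes scaleC :: "complex \<Rightarrow> 'a \<Rightarrow> 'a"  (infixr \<open>*\<^sub>C\<close> 75)
  assumes scaleC_add_right: "c *\<^sub>C (x + y) = c *\<^sub>C x + c *\<^sub>C y"
    and scaleC_add_left: "(c + d) *\<^sub>C x = c *\<^sub>C x + d *\<^sub>C x"
    and scaleC_scaleC: "c *\<^sub>C d *\<^sub>C x = (c * d) *\<^sub>C x"
    and scaleC_one: "1 *\<^sub>C x = x"

global_interpretation cvec: vector_space "scaleC :: complex \<Rightarrow> 'a \<Rightarrow> 'a::complex_vector"
  by unfold_locales (auto simp: scaleC_add_right scaleC_add_left scaleC_scaleC scaleC_one)

abbreviation clinear :: "('a::complex_vector \<Rightarrow> 'b::complex_vector) \<Rightarrow> bool"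
  where "clinear \<equiv> Vector_Spaces.linear (*\<^sub>C) (*\<^sub>C)"

definition cbilinear :: "('a::complex_vector \<Rightarrow> 'b::complex_vector \<Rightarrow> 'c::complex_vector) \<Rightarrow> bool"
  where "cbilinear f \<longleftrightarrow> (\<forall>a. clinear (f a)) \<and> (\<forall>b. clinear (\<lambda>a. f a b))"

instantiation complex :: complex_vector
begin
definition scaleC_complex :: "complex \<Rightarrow> complex \<Rightarrow> complex"
  where "scaleC_complex c x = c * x"
instance
  by standard (simp_all add: scaleC_complex_def algebra_simps)
end

instantiation poly_mapping :: (type, complex_vector) complex_vector
begin
lift_definition scaleC_poly_mapping :: "complex \<Rightarrow> ('a \<Rightarrow>\<^sub>0 'b) \<Rightarrow> ('a \<Rightarrow>\<^sub>0 'b)"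
  is "\<lambda>c f k. c *\<^sub>C f k"
  by (rule finite_subset) (auto simp: cvec.scale_zero_right)
instance
  by standard (transfer; simp add: fun_eq_iff scaleC_add_right scaleC_add_left scaleC_scaleC scaleC_one)+
end

lemma clinearI:
  assumes "\<And>x y. f (x + y) = f x + f y" "\<And>c x. f (c *\<^sub>C x) = c *\<^sub>C f x"
  shows "clinear f"
  using assms
  by (simp add: Vector_Spaces.linear_def module_hom_def module_hom_axioms_def
      cvec.vector_space_axioms cvec.module_axioms)

lemma clinear_add: "clinear f \<Longrightarrow> f (x + y) = f x + f y"
  and clinear_scale: "clinear f \<Longrightarrow> f (c *\<^sub>C x) = c *\<^sub>C f x"
  by (auto simp: Vector_Spaces.linear_def module_hom_def module_hom_axioms_def)

lemma clinear_0: "clinear f \<Longrightarrow> f 0 = 0"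
  using clinear_scale[of f 0 0] by simp

lemma clinear_diff: "clinear f \<Longrightarrow> f (x - y) = f x - f y"
  using clinear_add[of f "x - y" y] by simp

lemma cbilinearI:
  assumes "\<And>a b b'. f a (b + b') = f a b + f a b'" "\<And>a b c. f a (c *\<^sub>C b) = c *\<^sub>C f a b"
    and "\<And>a a' b. f (a + a') b = f a b + f a' b" "\<And>a b c. f (c *\<^sub>C a) b = c *\<^sub>C f a b"
  shows "cbilinear f"
  using assms by (auto simp: cbilinear_def intro!: clinearI)

lemma cbilinearD:
  assumes "cbilinear f"
  shows "f a (b + b') = f a b + f a b'" "f a (c *\<^sub>C b) = c *\<^sub>C f a b"
    and "f (a + a') b = f a b + f a' b" "f (c *\<^sub>C a) b = c *\<^sub>C f a b"
    and "f 0 b = 0" "f a 0 = 0"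
proof -
  have l: "clinear (f a)" and r: "clinear (\<lambda>a. f a b)" for a b
    using assms by (simp_all add: cbilinear_def)
  show "f a (b + b') = f a b + f a b'" "f a (c *\<^sub>C b) = c *\<^sub>C f a b" "f a 0 = 0"
    by (rule clinear_add[OF l] clinear_scale[OF l] clinear_0[OF l])+
  show "f (a + a') b = f a b + f a' b" "f (c *\<^sub>C a) b = c *\<^sub>C f a b" "f 0 b = 0"
    by (rule clinear_add[OF r] clinear_scale[OF r] clinear_0[OF r])+
qed


section \<open>The algebraic tensor product\<close>

text \<open>
  The tensor product is the free vector space on the set of pairs modulo the subspace
  generated by the bilinearity relations.
\<close>

definition tensor_relations ::
    "(('a::complex_vector \<times> 'b::complex_vector) \<Rightarrow>\<^sub>0 complex) set"
  where "tensor_relations =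
    (let e = (\<lambda>a b. Poly_Mapping.single (a, b) (1::complex)) in
      {e (a + a') b - e a b - e a' b | a a' b. True} \<union>
      {e a (b + b') - e a b - e a b' | a b b'. True} \<union>
      {e (c *\<^sub>C a) b - c *\<^sub>C e a b | c a b. True} \<union>
      {e a (c *\<^sub>C b) - c *\<^sub>C e a b | c a b. True})"

definition tensor_eq ::
    "(('a::complex_vector \<times> 'b::complex_vector) \<Rightarrow>\<^sub>0 complex) \<Rightarrow> (('a \<times> 'b) \<Rightarrow>\<^sub>0 complex) \<Rightarrow> bool"
  where "tensor_eq r s \<longleftrightarrow> r - s \<in> cvec.span tensor_relations"

lemma equivp_tensor_eq: "equivp tensor_eq"
proof (rule equivpI)
  show "reflp tensor_eq"
    by (auto intro!: reflpI simp: tensor_eq_def cvec.span_zero)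
  show "symp tensor_eq"
    unfolding symp_def tensor_eq_def using cvec.span_neg by fastforce
  show "transp tensor_eq"
    unfolding transp_def tensor_eq_def using cvec.span_add by fastforce
qed

quotient_type (overloaded) ('a, 'b) tensor =
  "('a::complex_vector \<times> 'b::complex_vector) \<Rightarrow>\<^sub>0 complex" / tensor_eq
  by (rule equivp_tensor_eq)

instantiation tensor :: (complex_vector, complex_vector) complex_vector
begin

lift_definition zero_tensor :: "('a, 'b) tensor" is 0 .

lift_definition plus_tensor :: "('a, 'b) tensor \<Rightarrow> ('a, 'b) tensor \<Rightarrow> ('a, 'b) tensor" is "(+)"
  unfolding tensor_eq_def add_diff_add by (rule cvec.span_add)

lift_definition minus_tensor :: "('a, 'b) tensor \<Rightarrow> ('a, 'b) tensor \<Rightarrow> ('a, 'b) tensor" is "(-)"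
proof -
  fix r r' s s' :: "('a \<times> 'b) \<Rightarrow>\<^sub>0 complex"
  assume "tensor_eq r r'" "tensor_eq s s'"
  then have "(r - r') - (s - s') \<in> cvec.span tensor_relations"
    unfolding tensor_eq_def by (rule cvec.span_diff)
  also have "(r - r') - (s - s') = (r - s) - (r' - s')"
    by simp
  finally show "tensor_eq (r - s) (r' - s')"
    by (simp only: tensor_eq_def)
qed

lift_definition uminus_tensor :: "('a, 'b) tensor \<Rightarrow> ('a, 'b) tensor" is uminus
  unfolding tensor_eq_def minus_diff_minus by (rule cvec.span_neg)

lift_definition scaleC_tensor :: "complex \<Rightarrow> ('a, 'b) tensor \<Rightarrow> ('a, 'b) tensor" is scaleC
  unfolding tensor_eq_def cvec.scale_right_diff_distrib[symmetric] by (rule cvec.span_scale)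

instance
  by standard
    (transfer; simp add: tensor_eq_def cvec.span_zero algebra_simps
       scaleC_add_right scaleC_add_left scaleC_scaleC scaleC_one)+

end

lift_definition tensor :: "'a::complex_vector \<Rightarrow> 'b::complex_vector \<Rightarrow> ('a, 'b) tensor"
    (infixl \<open>\<otimes>\<close> 70)
  is "\<lambda>a b. Poly_Mapping.single (a, b) 1" .

lemma cbilinear_tensor: "cbilinear (\<otimes>)"
proof -
  have rel: "abs_tensor r = abs_tensor s" if "r - s \<in> tensor_relations"
    for r s :: "('a \<times> 'b) \<Rightarrow>\<^sub>0 complex"
    using that by (simp add: tensor.abs_eq_iff tensor_eq_def cvec.span_base)
  show ?thesis
    unfolding cbilinear_def
    by (intro conjI allI clinearI;
        simp add: tensor.abs_eq plus_tensor.abs_eq scaleC_tensor.abs_eq; rule rel;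
        simp add: tensor_relations_def Let_def diff_diff_eq[symmetric]; blast)
qed

text \<open>
  For bilinear \<open>f\<close>, \<open>tensor_lift f\<close> is the linear map sending \<open>a \<otimes> b\<close> to \<open>f a b\<close>;
  the value then does not depend on the representative.  In particular
  \<open>tensor_lift f (\<Delta> h)\<close> is what Sigma notation writes as the sum of
  \<open>f h\<^sub>1 h\<^sub>2\<close> over \<open>\<Delta> h = \<Sum> h\<^sub>1 \<otimes> h\<^sub>2\<close>.
\<close>

definition tensor_lift ::
    "('a::complex_vector \<Rightarrow> 'b::complex_vector \<Rightarrow> 'c::complex_vector) \<Rightarrow> ('a, 'b) tensor \<Rightarrow> 'c"
  where "tensor_lift f t =
    (let r = rep_tensor t in
      \<Sum>p\<in>Poly_Mapping.keys r. Poly_Mapping.lookup r p *\<^sub>C f (fst p) (snd p))"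

lemma tensor_lift_add_fun:
  "tensor_lift (\<lambda>a b. f a b + g a b) t = tensor_lift f t + tensor_lift g t"
  by (simp add: tensor_lift_def Let_def scaleC_add_right sum.distrib)

lemma tensor_lift_scale_fun:
  "tensor_lift (\<lambda>a b. c *\<^sub>C f a b) t = c *\<^sub>C tensor_lift f t"
  by (simp add: tensor_lift_def Let_def cvec.scale_sum_right scaleC_scaleC mult.commute)

lemma
  assumes f: "cbilinear f"
  shows clinear_tensor_lift: "clinear (tensor_lift f)"
    and tensor_lift_tensor: "tensor_lift f (a \<otimes> b) = f a b"
proof -
  define L where "L r = (\<Sum>p\<in>Poly_Mapping.keys r.
     Poly_Mapping.lookup r p *\<^sub>C f (fst p) (snd p))" for r
  have L_superset: "L r = (\<Sum>p\<in>S. Poly_Mapping.lookup r p *\<^sub>C f (fst p) (snd p))"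
    if "finite S" "Poly_Mapping.keys r \<subseteq> S" for r S
    unfolding L_def using that by (intro sum.mono_neutral_left) (auto simp: in_keys_iff)
  have L_add: "L (r + s) = L r + L s" for r s
  proof -
    let ?S = "Poly_Mapping.keys r \<union> Poly_Mapping.keys s"
    have "Poly_Mapping.keys (r + s) \<subseteq> ?S" by (rule Poly_Mapping.keys_add)
    then show ?thesis
      by (simp add: L_superset[of ?S] lookup_add scaleC_add_left sum.distrib)
  qed
  have L_scale: "L (c *\<^sub>C r) = c *\<^sub>C L r" for c r
  proof -
    have "Poly_Mapping.keys (c *\<^sub>C r) \<subseteq> Poly_Mapping.keys r"
      by (auto simp: in_keys_iff scaleC_poly_mapping.rep_eq)
    then show ?thesis
      by (simp add: L_superset[of "Poly_Mapping.keys r"] cvec.scale_sum_right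
          scaleC_poly_mapping.rep_eq scaleC_scaleC scaleC_complex_def)
  qed
  have L: "clinear L" by (rule clinearI) (simp_all add: L_add L_scale)
  have L_single: "L (Poly_Mapping.single (a, b) 1) = f a b" for a b
    by (simp add: L_def scaleC_one)
  have lin1: "clinear (\<lambda>a. f a b)" and lin2: "clinear (f a)" for a b
    using f by (auto simp: cbilinear_def)
  have L_rel: "L r = 0" if "r \<in> tensor_relations" for r
    using that
    by (auto simp: tensor_relations_def Let_def clinear_diff[OF L] clinear_scale[OF L] L_single
        clinear_add[OF lin1] clinear_add[OF lin2] clinear_scale[OF lin1] clinear_scale[OF lin2])
  have L_span: "L r = 0" if "r \<in> cvec.span tensor_relations" for r
    using that
    by (induction rule: cvec.span_induct_alt) (auto simp: clinear_0[OF L] L_add L_scale L_rel)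
  have L_eq: "L r = L s" if "tensor_eq r s" for r s
    using L_span[of "r - s"] that by (simp add: tensor_eq_def clinear_diff[OF L])
  have lift_abs: "tensor_lift f (abs_tensor r) = L r" for r
  proof -
    have "tensor_eq (rep_tensor (abs_tensor r)) r"
      by (rule Quotient3_rep_abs[OF Quotient3_tensor]) (simp add: equivp_reflp[OF equivp_tensor_eq])
    then show ?thesis using L_eq by (simp add: tensor_lift_def L_def Let_def)
  qed
  show "tensor_lift f (a \<otimes> b) = f a b"
    by (simp add: tensor.abs_eq lift_abs L_single)
  show "clinear (tensor_lift f)"
  proof (rule clinearI)
    fix s t :: "('a, 'b) tensor" and c
    obtain p q where "s = abs_tensor p" "t = abs_tensor q"
      by (metis Quotient3_abs_rep[OF Quotient3_tensor])
    then show "tensor_lift f (s + t) = tensor_lift f s + tensor_lift f t"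
      by (simp add: plus_tensor.abs_eq lift_abs L_add)
  next
    fix t :: "('a, 'b) tensor" and c
    obtain q where "t = abs_tensor q"
      by (metis Quotient3_abs_rep[OF Quotient3_tensor])
    then show "tensor_lift f (c *\<^sub>C t) = c *\<^sub>C tensor_lift f t"
      by (simp add: scaleC_tensor.abs_eq lift_abs L_scale)
  qed
qed

definition tensor_map ::
    "('a::complex_vector \<Rightarrow> 'c::complex_vector) \<Rightarrow> ('b::complex_vector \<Rightarrow> 'd::complex_vector) \<Rightarrow>
     ('a, 'b) tensor \<Rightarrow> ('c, 'd) tensor"
  where "tensor_map f g = tensor_lift (\<lambda>a b. f a \<otimes> g b)"

definition tensor_assoc ::
    "(('a::complex_vector, 'b::complex_vector) tensor, 'c::complex_vector) tensor \<Rightarrow>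
     ('a, ('b, 'c) tensor) tensor"
  where "tensor_assoc = tensor_lift (\<lambda>t c. tensor_lift (\<lambda>a b. a \<otimes> (b \<otimes> c)) t)"


section \<open>Formal series\<close>

notation fls_nth (infixl \<open>$$\<close> 75)

text \<open>
  \<open>'a fls\<close> is the space of Laurent series \<open>A((x))\<close>; \<open>f $$ n\<close> is the coefficient of \<open>x^n\<close>.
\<close>

instantiation fls :: (complex_vector) complex_vector
begin
lift_definition scaleC_fls :: "complex \<Rightarrow> 'a fls \<Rightarrow> 'a fls" is "\<lambda>c f n. c *\<^sub>C f n"
  by (erule MOST_mono) simp
instance
  by standard
    (rule fls_eqI; simp add: scaleC_fls.rep_eq scaleC_add_right scaleC_add_left scaleC_scaleC scaleC_one)+
end

definition fls_map :: "('a::zero \<Rightarrow> 'b::zero) \<Rightarrow> 'a fls \<Rightarrow> 'b fls"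
  where "fls_map \<psi> f = Abs_fls (\<lambda>n. \<psi> (f $$ n))"

lemma fls_map_nth: "\<psi> 0 = 0 \<Longrightarrow> fls_map \<psi> f $$ n = \<psi> (f $$ n)"
  unfolding fls_map_def by (rule nth_Abs_fls, rule MOST_mono[OF MOST_fls_neg_nth_eq_0[of f]]) simp

definition fls_tensor ::
    "'a::complex_vector fls \<Rightarrow> 'b::complex_vector fls \<Rightarrow> ('a, 'b) tensor fls"
  where "fls_tensor f g =
    Abs_fls (\<lambda>n. \<Sum>i\<in>{fls_subdegree f..n - fls_subdegree g}. (f $$ i) \<otimes> (g $$ (n - i)))"

lemma fls_tensor_nth:
  "fls_tensor f g $$ n =
    (\<Sum>i\<in>{fls_subdegree f..n - fls_subdegree g}. (f $$ i) \<otimes> (g $$ (n - i)))"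
  unfolding fls_tensor_def
  by (rule nth_Abs_fls_lower_bound[of "fls_subdegree f + fls_subdegree g"]) simp

lemma fls_tensor_nth_superset:
  assumes "finite S" "{fls_subdegree f..n - fls_subdegree g} \<subseteq> S"
  shows "fls_tensor f g $$ n = (\<Sum>i\<in>S. (f $$ i) \<otimes> (g $$ (n - i)))"
  unfolding fls_tensor_nth
proof (rule sum.mono_neutral_left[OF assms], safe)
  fix i assume "i \<notin> {fls_subdegree f..n - fls_subdegree g}"
  then have "f $$ i = 0 \<or> g $$ (n - i) = 0"
    by (auto simp: not_le fls_eq0_below_subdegree)
  moreover have "(0::'a) \<otimes> b = 0" "a \<otimes> (0::'b) = 0" for a b
    by (simp_all add: cbilinearD[OF cbilinear_tensor])
  ultimately show "(f $$ i) \<otimes> (g $$ (n - i)) = 0" by auto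
qed

lemma cbilinear_fls_tensor: "cbilinear fls_tensor"
proof -
  note add1 = cbilinearD(3)[OF cbilinear_tensor] and add2 = cbilinearD(1)[OF cbilinear_tensor]
    and sc1 = cbilinearD(4)[OF cbilinear_tensor] and sc2 = cbilinearD(2)[OF cbilinear_tensor]
  have nth: "fls_tensor f g $$ n = (\<Sum>i\<in>{K..n - L}. (f $$ i) \<otimes> (g $$ (n - i)))"
    if "K \<le> fls_subdegree f" "L \<le> fls_subdegree g" for f :: "'a fls" and g :: "'b fls" and K L n
    using that by (intro fls_tensor_nth_superset) auto
  have "fls_tensor f (g + h) = fls_tensor f g + fls_tensor f h" for f :: "'a fls" and g h :: "'b fls"
  proof (rule fls_eqI)
    fix n
    define L where "L = min (fls_subdegree (g + h)) (min (fls_subdegree g) (fls_subdegree h))"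
    have "L \<le> fls_subdegree (g + h)" "L \<le> fls_subdegree g" "L \<le> fls_subdegree h"
      by (auto simp: L_def)
    then show "fls_tensor f (g + h) $$ n = (fls_tensor f g + fls_tensor f h) $$ n"
      by (simp add: nth[of "fls_subdegree f" f L] add2 sum.distrib)
  qed
  moreover have "fls_tensor (g + h) f = fls_tensor g f + fls_tensor h f"
    for f :: "'b fls" and g h :: "'a fls"
  proof (rule fls_eqI)
    fix n
    define L where "L = min (fls_subdegree (g + h)) (min (fls_subdegree g) (fls_subdegree h))"
    have "L \<le> fls_subdegree (g + h)" "L \<le> fls_subdegree g" "L \<le> fls_subdegree h"
      by (auto simp: L_def)
    then show "fls_tensor (g + h) f $$ n = (fls_tensor g f + fls_tensor h f) $$ n"
      by (simp add: nth[of L _ "fls_subdegree f" f] add1 sum.distrib)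
  qed
  moreover have "fls_tensor f (c *\<^sub>C g) = c *\<^sub>C fls_tensor f g" for f :: "'a fls" and g :: "'b fls" and c
  proof (rule fls_eqI)
    fix n
    define L where "L = min (fls_subdegree (c *\<^sub>C g)) (fls_subdegree g)"
    have "L \<le> fls_subdegree (c *\<^sub>C g)" "L \<le> fls_subdegree g" by (auto simp: L_def)
    then show "fls_tensor f (c *\<^sub>C g) $$ n = (c *\<^sub>C fls_tensor f g) $$ n"
      by (simp add: nth[of "fls_subdegree f" f L] sc2 scaleC_fls.rep_eq cvec.scale_sum_right)
  qed
  moreover have "fls_tensor (c *\<^sub>C g) f = c *\<^sub>C fls_tensor g f" for f :: "'b fls" and g :: "'a fls" and c
  proof (rule fls_eqI)
    fix n
    define L where "L = min (fls_subdegree (c *\<^sub>C g)) (fls_subdegree g)"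
    have "L \<le> fls_subdegree (c *\<^sub>C g)" "L \<le> fls_subdegree g" by (auto simp: L_def)
    then show "fls_tensor (c *\<^sub>C g) f $$ n = (c *\<^sub>C fls_tensor g f) $$ n"
      by (simp add: nth[of L _ "fls_subdegree f" f] sc1 scaleC_fls.rep_eq cvec.scale_sum_right)
  qed
  ultimately show ?thesis unfolding cbilinear_def by (auto intro!: clinearI)
qed

definition fls_vec :: "'a::complex_vector \<Rightarrow> complex fls \<Rightarrow> 'a fls"
  where "fls_vec v f = Abs_fls (\<lambda>n. (f $$ n) *\<^sub>C v)"

lemma fls_vec_nth: "fls_vec v f $$ n = (f $$ n) *\<^sub>C v"
  unfolding fls_vec_def by (rule nth_Abs_fls, rule MOST_mono[OF MOST_fls_neg_nth_eq_0[of f]]) simp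

definition tensor_laurent :: "'a::complex_vector fls set"  \<comment> \<open>\<open>A \<otimes> \<complex>((x))\<close> inside \<open>A((x))\<close>\<close>
  where "tensor_laurent = cvec.span {fls_vec v f | v f. True}"

text \<open>
  The extension of a linear map \<open>\<phi> : A \<rightarrow> B((x))\<close> to a \<open>\<complex>((x))\<close>-linear map on \<open>A \<otimes> \<complex>((x))\<close>.
  It gives a meaning to \<open>Y(u,x)Y(h,x)v\<close>, where both operators have the same variable.
\<close>

definition fls_extend ::
    "('a::complex_vector \<Rightarrow> 'b::complex_vector fls) \<Rightarrow> 'a fls \<Rightarrow> 'b fls"
  where "fls_extend \<phi> f = Abs_fls (\<lambda>n. Sum_any (\<lambda>m. \<phi> (f $$ m) $$ (n - m)))"

lemma tensor_laurent_bounded: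
  assumes "f \<in> tensor_laurent" and \<phi>: "clinear \<phi>"
  shows "\<exists>K. \<forall>m n. n < K \<longrightarrow> \<phi> (f $$ m) $$ n = 0"
  using assms(1) unfolding tensor_laurent_def
proof (induction rule: cvec.span_induct_alt)
  case base
  show ?case by (simp add: clinear_0[OF \<phi>])
next
  case (step c x y)
  then obtain v g where x: "x = fls_vec v g" by auto
  obtain K where "\<forall>m n. n < K \<longrightarrow> \<phi> (y $$ m) $$ n = 0" using step by blast
  then show ?case
    by (intro exI[of _ "min K (fls_subdegree (\<phi> v))"])
      (auto simp: x fls_vec_nth clinear_add[OF \<phi>] clinear_scale[OF \<phi>] scaleC_fls.rep_eq
        fls_eq0_below_subdegree)
qed

lemma fls_extend_finite:
  assumes "f \<in> tensor_laurent" and \<phi>: "clinear \<phi>"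
  shows "finite {m. \<phi> (f $$ m) $$ (n - m) \<noteq> 0}"
proof -
  obtain K where K: "\<forall>m n. n < K \<longrightarrow> \<phi> (f $$ m) $$ n = 0"
    using tensor_laurent_bounded[OF assms] by blast
  have "{m. \<phi> (f $$ m) $$ (n - m) \<noteq> 0} \<subseteq> {fls_subdegree f..n - K}"
  proof
    fix m assume "m \<in> {m. \<phi> (f $$ m) $$ (n - m) \<noteq> 0}"
    then have *: "\<phi> (f $$ m) $$ (n - m) \<noteq> 0" by simp
    then have "f $$ m \<noteq> 0" using clinear_0[OF \<phi>] by auto
    then have "fls_subdegree f \<le> m" by (rule fls_subdegree_leI)
    moreover have "\<not> n - m < K" using K * by blast
    ultimately show "m \<in> {fls_subdegree f..n - K}" by simp
  qed
  then show ?thesis by (rule finite_subset) simp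
qed

lemma fls_extend_nth:
  assumes "f \<in> tensor_laurent" and \<phi>: "clinear \<phi>"
  shows "fls_extend \<phi> f $$ n = Sum_any (\<lambda>m. \<phi> (f $$ m) $$ (n - m))"
proof -
  obtain K where K: "\<forall>m n. n < K \<longrightarrow> \<phi> (f $$ m) $$ n = 0"
    using tensor_laurent_bounded[OF assms] by blast
  have "\<phi> (f $$ m) $$ (n - m) = 0" if "n < K + fls_subdegree f" for m n
  proof (cases "m < fls_subdegree f")
    case True
    then show ?thesis by (simp add: fls_eq0_below_subdegree clinear_0[OF \<phi>])
  next
    case False
    then show ?thesis using K that by simp
  qed
  then show ?thesis
    unfolding fls_extend_def
    by (intro nth_Abs_fls_lower_bound[of "K + fls_subdegree f"]) simp
qed

lemma Sum_any_scaleC: "Sum_any (\<lambda>m. c *\<^sub>C g m) = c *\<^sub>C Sum_any g"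
  by (cases "c = 0") (simp_all add: Sum_any.expand_set cvec.scale_sum_right)

lemma fls_extend_add:
  assumes "f \<in> tensor_laurent" "g \<in> tensor_laurent" "clinear \<phi>"
  shows "fls_extend \<phi> (f + g) = fls_extend \<phi> f + fls_extend \<phi> g"
proof (rule fls_eqI)
  fix n
  have "f + g \<in> tensor_laurent" using assms(1,2) by (simp add: tensor_laurent_def cvec.span_add)
  then show "fls_extend \<phi> (f + g) $$ n = (fls_extend \<phi> f + fls_extend \<phi> g) $$ n"
    using assms by (simp add: fls_extend_nth clinear_add Sum_any.distrib fls_extend_finite)
qed

lemma fls_extend_scale:
  assumes "f \<in> tensor_laurent" "clinear \<phi>"
  shows "fls_extend \<phi> (c *\<^sub>C f) = c *\<^sub>C fls_extend \<phi> f"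
proof (rule fls_eqI)
  fix n
  have "c *\<^sub>C f \<in> tensor_laurent" using assms(1) by (simp add: tensor_laurent_def cvec.span_scale)
  then show "fls_extend \<phi> (c *\<^sub>C f) $$ n = (c *\<^sub>C fls_extend \<phi> f) $$ n"
    using assms
    by (simp add: fls_extend_nth clinear_scale scaleC_fls.rep_eq Sum_any_scaleC)
qed

lemma fls_extend_add_fun:
  assumes "f \<in> tensor_laurent" "clinear \<phi>" "clinear \<psi>"
  shows "fls_extend (\<lambda>a. \<phi> a + \<psi> a) f = fls_extend \<phi> f + fls_extend \<psi> f"
proof (rule fls_eqI)
  fix n
  have "clinear (\<lambda>a. \<phi> a + \<psi> a)"
    by (rule clinearI) (simp_all add: clinear_add[OF assms(2)] clinear_add[OF assms(3)]
        clinear_scale[OF assms(2)] clinear_scale[OF assms(3)] scaleC_add_right)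
  then show "fls_extend (\<lambda>a. \<phi> a + \<psi> a) f $$ n = (fls_extend \<phi> f + fls_extend \<psi> f) $$ n"
    using assms by (simp add: fls_extend_nth Sum_any.distrib fls_extend_finite)
qed

lemma fls_extend_scale_fun:
  assumes "f \<in> tensor_laurent" "clinear \<phi>"
  shows "fls_extend (\<lambda>a. c *\<^sub>C \<phi> a) f = c *\<^sub>C fls_extend \<phi> f"
proof (rule fls_eqI)
  fix n
  have "clinear (\<lambda>a. c *\<^sub>C \<phi> a)"
    by (rule clinearI) (simp_all add: clinear_add[OF assms(2)] clinear_scale[OF assms(2)]
        scaleC_add_right scaleC_scaleC mult.commute)
  then show "fls_extend (\<lambda>a. c *\<^sub>C \<phi> a) f $$ n = (c *\<^sub>C fls_extend \<phi> f) $$ n"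
    using assms by (simp add: fls_extend_nth scaleC_fls.rep_eq Sum_any_scaleC)
qed

text \<open>
  A series in several variables, infinite in all directions, is given by its family of
  coefficients: \<open>F a b\<close> is the coefficient of the product of the \<open>a\<close>-th power of the first
  and the \<open>b\<close>-th power of the second variable.
\<close>

text \<open>\<open>Y\<^sub>1(u,x\<^sub>1) Y\<^sub>2(v,x\<^sub>2) w\<close> in the variables \<open>x\<^sub>1, x\<^sub>2\<close>\<close>

definition vo_product ::
    "('a \<Rightarrow> 'c \<Rightarrow> 'd::zero fls) \<Rightarrow> 'a \<Rightarrow> ('b \<Rightarrow> 'w \<Rightarrow> 'c::zero fls) \<Rightarrow> 'b \<Rightarrow> 'w \<Rightarrow> (int \<Rightarrow> int \<Rightarrow> 'd)"
  where "vo_product Y\<^sub>1 u Y\<^sub>2 v w = (\<lambda>a b. Y\<^sub>1 u (Y\<^sub>2 v w $$ b) $$ a)"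

text \<open>\<open>Y\<^sub>W(Y(u,x\<^sub>0)v,x\<^sub>2) w\<close> in the variables \<open>x\<^sub>0, x\<^sub>2\<close>\<close>

definition vo_iterate ::
    "('c::zero \<Rightarrow> 'w \<Rightarrow> 'd::zero fls) \<Rightarrow> ('a \<Rightarrow> 'b \<Rightarrow> 'c fls) \<Rightarrow> 'a \<Rightarrow> 'b \<Rightarrow> 'w \<Rightarrow> (int \<Rightarrow> int \<Rightarrow> 'd)"
  where "vo_iterate Y\<^sub>W Y u v w = (\<lambda>a b. Y\<^sub>W (Y u v $$ a) w $$ b)"

text \<open>
  \<open>F(x\<^sub>0 + x\<^sub>2, x\<^sub>2)\<close> for \<open>F(x\<^sub>1, x\<^sub>2)\<close> in \<open>A((x\<^sub>1))((x\<^sub>2))\<close>, with \<open>(x\<^sub>0 + x\<^sub>2)^n\<close> expanded in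
  nonnegative powers of \<open>x\<^sub>2\<close>.  The sum is finite because \<open>F\<close> is bounded below in \<open>x\<^sub>2\<close>.
\<close>

definition subst_add :: "(int \<Rightarrow> int \<Rightarrow> 'a::complex_vector) \<Rightarrow> (int \<Rightarrow> int \<Rightarrow> 'a)"
  where "subst_add F = (\<lambda>a b. Sum_any (\<lambda>j::nat.
     ((of_int (a + int j) :: complex) gchoose j) *\<^sub>C F (a + int j) (b - int j)))"

lemma subst_add_finite:
  assumes "\<And>a b. b < K \<Longrightarrow> F a b = 0"
  shows "finite {j::nat. c j *\<^sub>C F (a + int j) (b - int j) \<noteq> 0}"
proof (rule finite_subset)
  have "b - int j \<ge> K" if "c j *\<^sub>C F (a + int j) (b - int j) \<noteq> 0" for j
    using that assms by (cases "b - int j < K") auto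
  then show "{j. c j *\<^sub>C F (a + int j) (b - int j) \<noteq> 0} \<subseteq> {..nat (b - K)}"
    by fastforce
qed simp

text \<open>\<open>(x\<^sub>0 + x\<^sub>2)^l F(x\<^sub>0, x\<^sub>2)\<close>\<close>

definition mult_add_power :: "nat \<Rightarrow> (int \<Rightarrow> int \<Rightarrow> 'a::complex_vector) \<Rightarrow> (int \<Rightarrow> int \<Rightarrow> 'a)"
  where "mult_add_power l F = (\<lambda>a b. \<Sum>j\<le>l.
     (of_nat (l choose j) :: complex) *\<^sub>C F (a - int (l - j)) (b - int j))"

text \<open>
  \<open>G(x\<^sub>1 - x\<^sub>2, x\<^sub>1, x\<^sub>2)\<close> in the variables \<open>x\<^sub>1, x\<^sub>2\<close>, for \<open>G(x\<^sub>0, x\<^sub>1, x\<^sub>2)\<close>, with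
  \<open>(x\<^sub>1 - x\<^sub>2)^m\<close> expanded in nonnegative powers of \<open>x\<^sub>2\<close>: the monomial
  \<open>x\<^sub>0^m x\<^sub>1^(a-m+j) x\<^sub>2^(b-j)\<close> contributes \<open>(-1)^j (m choose j)\<close> to \<open>x\<^sub>1^a x\<^sub>2^b\<close>.
  The sum is finite if \<open>G\<close> is bounded below in each variable separately.
\<close>

definition subst_diff ::
    "(int \<Rightarrow> int \<Rightarrow> int \<Rightarrow> 'a::complex_vector) \<Rightarrow> (int \<Rightarrow> int \<Rightarrow> 'a)"
  where "subst_diff G = (\<lambda>a b. Sum_any (\<lambda>(m::int, j::nat).
     ((-1) ^ j * ((of_int m :: complex) gchoose j)) *\<^sub>C G m (a - m + int j) (b - int j)))"

lemma subst_diff_finite: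
  assumes "\<And>m a b. m < N \<or> a < M \<or> b < K \<Longrightarrow> G m a b = 0"
  shows "finite {(m::int, j::nat). c m j *\<^sub>C G m (a - m + int j) (b - int j) \<noteq> 0}"
proof (rule finite_subset)
  have "N \<le> m \<and> M \<le> a - m + int j \<and> K \<le> b - int j"
    if "c m j *\<^sub>C G m (a - m + int j) (b - int j) \<noteq> 0" for m j
  proof (rule ccontr)
    assume "\<not> ?thesis"
    then have "G m (a - m + int j) (b - int j) = 0" by (intro assms) linarith
    with that show False by simp
  qed
  then show "{(m, j). c m j *\<^sub>C G m (a - m + int j) (b - int j) \<noteq> 0}
      \<subseteq> {N..a - M + (b - K)} \<times> {..nat (b - K)}"
    by fastforce
qed simp


section \<open>Nonlocal vertex algebras and their modules\<close>

text \<open>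
  \<open>Y v w\<close> is the series \<open>Y(v,x)w\<close> in \<open>V((x))\<close>; its coefficient \<open>Y v w $$ (- n - 1)\<close> is \<open>v\<^sub>n w\<close>.
\<close>

definition weakly_associative ::
    "('v::complex_vector \<Rightarrow> 'v \<Rightarrow> 'v fls) \<Rightarrow> ('v \<Rightarrow> 'w::complex_vector \<Rightarrow> 'w fls) \<Rightarrow> bool"
  where "weakly_associative Y Y\<^sub>W \<longleftrightarrow> (\<forall>u v w. \<exists>l.
     mult_add_power l (subst_add (vo_product Y\<^sub>W u Y\<^sub>W v w)) =
     mult_add_power l (vo_iterate Y\<^sub>W Y u v w))"

locale nonlocal_vertex_algebra =
  fixes Y :: "'v::complex_vector \<Rightarrow> 'v \<Rightarrow> 'v fls" and vac :: 'v
  assumes bilinear: "cbilinear Y"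
    and vacuum: "Y vac v = fls_const v"
    and creation_regular: "n < 0 \<Longrightarrow> Y v vac $$ n = 0"
    and creation_limit: "Y v vac $$ 0 = v"
    and weak_associativity: "weakly_associative Y Y"

locale nonlocal_vertex_algebra_module = nonlocal_vertex_algebra Y vac
  for Y :: "'v::complex_vector \<Rightarrow> 'v \<Rightarrow> 'v fls" and vac :: 'v +
  fixes Y\<^sub>W :: "'v \<Rightarrow> 'w::complex_vector \<Rightarrow> 'w fls"
  assumes module_bilinear: "cbilinear Y\<^sub>W"
    and module_vacuum: "Y\<^sub>W vac w = fls_const w"
    and module_weak_associativity: "weakly_associative Y Y\<^sub>W"

definition nva_hom ::
    "('v::complex_vector \<Rightarrow> 'v \<Rightarrow> 'v fls) \<Rightarrow> 'v \<Rightarrow>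
     ('w::complex_vector \<Rightarrow> 'w \<Rightarrow> 'w fls) \<Rightarrow> 'w \<Rightarrow> ('v \<Rightarrow> 'w) \<Rightarrow> bool"
  where "nva_hom Y vac Y' vac' \<psi> \<longleftrightarrow>
    clinear \<psi> \<and> \<psi> vac = vac' \<and> (\<forall>u v. fls_map \<psi> (Y u v) = Y' (\<psi> u) (\<psi> v))"

definition nva_subalgebra ::
    "('v::complex_vector \<Rightarrow> 'v \<Rightarrow> 'v fls) \<Rightarrow> 'v \<Rightarrow> 'v set \<Rightarrow> bool"
  where "nva_subalgebra Y vac U \<longleftrightarrow>
    cvec.subspace U \<and> vac \<in> U \<and> (\<forall>u\<in>U. \<forall>v\<in>U. \<forall>n. Y u v $$ n \<in> U)"

definition tensor_Y ::
    "('v::complex_vector \<Rightarrow> 'v \<Rightarrow> 'v fls) \<Rightarrow> ('w::complex_vector \<Rightarrow> 'w \<Rightarrow> 'w fls) \<Rightarrow>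
     ('v, 'w) tensor \<Rightarrow> ('v, 'w) tensor \<Rightarrow> ('v, 'w) tensor fls"
  where "tensor_Y Y Y' s t =
    tensor_lift (\<lambda>u a. tensor_lift (\<lambda>v b. fls_tensor (Y u v) (Y' a b)) t) s"

definition complex_Y :: "complex \<Rightarrow> complex \<Rightarrow> complex fls"
  where "complex_Y a b = fls_const (a * b)"


section \<open>Vertex bialgebras and module nonlocal vertex algebras\<close>

locale coalgebra =
  fixes \<Delta> :: "'h::complex_vector \<Rightarrow> ('h, 'h) tensor" and \<epsilon> :: "'h \<Rightarrow> complex"
  assumes comult_linear: "clinear \<Delta>"
    and counit_linear: "clinear \<epsilon>"
    and coassoc: "tensor_assoc (tensor_map \<Delta> id (\<Delta> h)) = tensor_map id \<Delta> (\<Delta> h)"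
    and counit_left: "tensor_lift (\<lambda>a b. \<epsilon> a *\<^sub>C b) (\<Delta> h) = h"
    and counit_right: "tensor_lift (\<lambda>a b. \<epsilon> b *\<^sub>C a) (\<Delta> h) = h"

locale vertex_bialgebra = nonlocal_vertex_algebra Y vac + coalgebra \<Delta> \<epsilon>
  for Y :: "'h::complex_vector \<Rightarrow> 'h \<Rightarrow> 'h fls" and vac :: 'h
    and \<Delta> :: "'h \<Rightarrow> ('h, 'h) tensor" and \<epsilon> :: "'h \<Rightarrow> complex" +
  assumes comult_hom: "nva_hom Y vac (tensor_Y Y Y) (vac \<otimes> vac) \<Delta>"
    and counit_hom: "nva_hom Y vac complex_Y 1 \<epsilon>"

text \<open>
  The coefficients of \<open>Y\<^sub>V(Y\<^sub>M(h\<^sub>1, x\<^sub>1 - x\<^sub>2)u, x\<^sub>2) Y\<^sub>N(h\<^sub>2, x\<^sub>1)w\<close>, where \<open>Y\<^sub>M(h\<^sub>1, x\<^sub>0)u\<close> is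
  mapped into the source of \<open>Y\<^sub>V\<close> by \<open>\<iota>\<close>.
\<close>

definition twisted_product ::
    "('v::complex_vector \<Rightarrow> 'w::complex_vector \<Rightarrow> 'w fls) \<Rightarrow> ('u::complex_vector \<Rightarrow> 'v) \<Rightarrow>
     ('h \<Rightarrow> 'u \<Rightarrow> 'u fls) \<Rightarrow> 'h \<Rightarrow> 'u \<Rightarrow> ('k \<Rightarrow> 'w \<Rightarrow> 'w fls) \<Rightarrow> 'k \<Rightarrow> 'w \<Rightarrow> (int \<Rightarrow> int \<Rightarrow> 'w)"
  where "twisted_product Y\<^sub>V \<iota> Y\<^sub>M h\<^sub>1 u Y\<^sub>N h\<^sub>2 w =
    subst_diff (\<lambda>m a b. Y\<^sub>V (\<iota> (Y\<^sub>M h\<^sub>1 u $$ m)) (Y\<^sub>N h\<^sub>2 w $$ a) $$ b)"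

locale module_nonlocal_vertex_algebra =
  H: vertex_bialgebra Y\<^sub>H vac\<^sub>H \<Delta> \<epsilon> +
  V: nonlocal_vertex_algebra Y\<^sub>V vac\<^sub>V +
  M: nonlocal_vertex_algebra_module Y\<^sub>H vac\<^sub>H Y\<^sub>M
  for Y\<^sub>H :: "'h::complex_vector \<Rightarrow> 'h \<Rightarrow> 'h fls" and vac\<^sub>H :: 'h
    and \<Delta> :: "'h \<Rightarrow> ('h, 'h) tensor" and \<epsilon> :: "'h \<Rightarrow> complex"
    and Y\<^sub>V :: "'v::complex_vector \<Rightarrow> 'v \<Rightarrow> 'v fls" and vac\<^sub>V :: 'v
    and Y\<^sub>M :: "'h \<Rightarrow> 'v \<Rightarrow> 'v fls" +
  assumes action_tensor_laurent: "Y\<^sub>M h v \<in> tensor_laurent"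
    and action_vacuum: "Y\<^sub>M h vac\<^sub>V = fls_const (\<epsilon> h *\<^sub>C vac\<^sub>V)"
    and action_product: "vo_product Y\<^sub>M h Y\<^sub>V u v a b =
      tensor_lift (\<lambda>h\<^sub>1 h\<^sub>2. twisted_product Y\<^sub>V id Y\<^sub>M h\<^sub>1 u Y\<^sub>M h\<^sub>2 v a b) (\<Delta> h)"

text \<open>
  The sums in the last axiom and in the smash product below are finite, by membership in
  \<open>V \<otimes> \<complex>((x))\<close>.
\<close>

lemma (in module_nonlocal_vertex_algebra) twisted_product_bounded:
  "\<exists>N M K. \<forall>m a b. m < N \<or> a < M \<or> b < K \<longrightarrow>
     Y\<^sub>V (Y\<^sub>M h\<^sub>1 u $$ m) (Y\<^sub>M h\<^sub>2 v $$ a) $$ b = 0"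
proof -
  note bl = cbilinearD[OF V.bilinear]
  have lin: "clinear (Y\<^sub>V u)" "clinear (\<lambda>u. Y\<^sub>V u v)" for u v
    using V.bilinear by (auto simp: cbilinear_def)
  have "\<exists>K. \<forall>m a b. b < K \<longrightarrow> Y\<^sub>V (f $$ m) (Y\<^sub>M h\<^sub>2 v $$ a) $$ b = 0" if "f \<in> tensor_laurent" for f
    using that unfolding tensor_laurent_def
  proof (induction rule: cvec.span_induct_alt)
    case base
    show ?case by (simp add: bl)
  next
    case (step c x y)
    then obtain w g where x: "x = fls_vec w g" by auto
    obtain K where "\<forall>m a b. b < K \<longrightarrow> Y\<^sub>V (y $$ m) (Y\<^sub>M h\<^sub>2 v $$ a) $$ b = 0" using step by blast
    moreover obtain L where "\<forall>a b. b < L \<longrightarrow> Y\<^sub>V w (Y\<^sub>M h\<^sub>2 v $$ a) $$ b = 0"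
      using tensor_laurent_bounded[OF action_tensor_laurent lin(1)] by blast
    ultimately show ?case
      by (intro exI[of _ "min K L"]) (auto simp: x fls_vec_nth bl scaleC_fls.rep_eq)
  qed
  then obtain K where "\<forall>m a b. b < K \<longrightarrow> Y\<^sub>V (Y\<^sub>M h\<^sub>1 u $$ m) (Y\<^sub>M h\<^sub>2 v $$ a) $$ b = 0"
    using action_tensor_laurent by blast
  then show ?thesis
    by (intro exI[of _ "fls_subdegree (Y\<^sub>M h\<^sub>1 u)"] exI[of _ "fls_subdegree (Y\<^sub>M h\<^sub>2 v)"] exI[of _ K])
      (auto simp: fls_eq0_below_subdegree bl)
qed


section \<open>The smash product\<close>

definition smash_Y ::
    "('h::complex_vector \<Rightarrow> 'h \<Rightarrow> 'h fls) \<Rightarrow> ('h \<Rightarrow> ('h, 'h) tensor) \<Rightarrow>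
     ('v::complex_vector \<Rightarrow> 'v \<Rightarrow> 'v fls) \<Rightarrow> ('h \<Rightarrow> 'v \<Rightarrow> 'v fls) \<Rightarrow>
     ('v, 'h) tensor \<Rightarrow> ('v, 'h) tensor \<Rightarrow> ('v, 'h) tensor fls"
  where "smash_Y Y\<^sub>H \<Delta> Y\<^sub>V Y\<^sub>M s t =
    tensor_lift (\<lambda>u h. tensor_lift (\<lambda>v k.
      tensor_lift (\<lambda>h\<^sub>1 h\<^sub>2. fls_tensor (fls_extend (Y\<^sub>V u) (Y\<^sub>M h\<^sub>1 v)) (Y\<^sub>H h\<^sub>2 k)) (\<Delta> h)) t) s"

context module_nonlocal_vertex_algebra
begin

abbreviation (input) smash_term where
  "smash_term u v k h\<^sub>1 h\<^sub>2 \<equiv> fls_tensor (fls_extend (Y\<^sub>V u) (Y\<^sub>M h\<^sub>1 v)) (Y\<^sub>H h\<^sub>2 k)"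

lemma smash_Y_tensor:
  "smash_Y Y\<^sub>H \<Delta> Y\<^sub>V Y\<^sub>M (u \<otimes> h) (v \<otimes> k) =
    tensor_lift (\<lambda>h\<^sub>1 h\<^sub>2. fls_tensor (fls_extend (Y\<^sub>V u) (Y\<^sub>M h\<^sub>1 v)) (Y\<^sub>H h\<^sub>2 k)) (\<Delta> h)"
proof -
  note bl = cbilinearD[OF H.bilinear] cbilinearD[OF V.bilinear] cbilinearD[OF M.module_bilinear]
  note ft = cbilinearD[OF cbilinear_fls_tensor]
  have lin: "clinear (Y\<^sub>V u)" for u using V.bilinear by (simp add: cbilinear_def)
  have plus: "Y\<^sub>V (u + u') = (\<lambda>a. Y\<^sub>V u a + Y\<^sub>V u' a)" and sc: "Y\<^sub>V (c *\<^sub>C u) = (\<lambda>a. c *\<^sub>C Y\<^sub>V u a)"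
    for u u' c by (simp_all add: fun_eq_iff bl)
  note ext = fls_extend_add fls_extend_scale fls_extend_add_fun fls_extend_scale_fun
    lin plus sc action_tensor_laurent
  have b1: "cbilinear (smash_term u v k)" for u v k
    by (rule cbilinearI) (simp_all add: bl ft ext)
  have b2: "cbilinear (\<lambda>v k. tensor_lift (smash_term u v k) (\<Delta> h))" for u h
    by (rule cbilinearI) (simp_all add: bl ft ext tensor_lift_add_fun tensor_lift_scale_fun)
  have b3: "cbilinear (\<lambda>u h. tensor_lift (\<lambda>v k. tensor_lift (smash_term u v k) (\<Delta> h)) t)" for t
    by (rule cbilinearI)
      (simp_all add: bl ft ext tensor_lift_add_fun tensor_lift_scale_fun
        clinear_add[OF H.comult_linear] clinear_scale[OF H.comult_linear]
        clinear_add[OF clinear_tensor_lift[OF b1]] clinear_scale[OF clinear_tensor_lift[OF b1]])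
  show ?thesis
    unfolding smash_Y_def by (subst tensor_lift_tensor[OF b3], subst tensor_lift_tensor[OF b2]) simp
qed

end

end

theory Submission
  imports Defs
begin

text \<open>
  Weak associativity compares \<open>F(x\<^sub>0 + x\<^sub>2, x\<^sub>2)\<close>, for \<open>F\<close> a product of two vertex operators, with
  the iterate, after multiplication by a power of \<open>x\<^sub>0 + x\<^sub>2\<close>.  On decomposable tensors the action
  axiom moves \<open>h\<close> past \<open>v\<close> in the product, which becomes the sum of
  \<open>Y(u,x\<^sub>1) Y(Y(h\<^sub>1,x\<^sub>1 - x\<^sub>2)v,x\<^sub>2) Y(h\<^sub>2,x\<^sub>1) Y(k\<^sub>1,x\<^sub>2)w \<otimes> Y(h\<^sub>3,x\<^sub>1) Y(k\<^sub>2,x\<^sub>2)m\<close>,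
  and the substitution \<open>x\<^sub>1 = x\<^sub>0 + x\<^sub>2\<close> is multiplicative, so weak associativity of \<open>V\<close>, of the
  \<open>H\<close>-module \<open>V\<close> and of \<open>H\<close> applies to the three pairs of operators separately.  One exponent
  serves all coefficients because \<open>Y(h,x)v\<close> lies in \<open>V \<otimes> \<complex>((x))\<close>, so that its coefficients
  span a finite-dimensional space.  Coassociativity, and compatibility of \<open>\<Delta>\<close> with the vertex
  operators, identify the outcome with the iterate.
\<close>

section \<open>Diagonals of series in four variables\<close>

text \<open>The operators in x1 and those in x2 are interleaved, so the product is not an ordinary
  product of two series in (x1, x2): the operators of \<open>V\<close> act on the coefficients of
  the \<open>H\<close>-action. It is therefore written as the \<open>diagonal\<close> of a family
  with four exponents, and weak associativity is applied to one pair of exponents with the other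
  pair as parameter. This is what forces bounds uniform in the parameter.

  The difference x1 - x2 is kept as a separate variable with exponent n. Under x1 = x0 + x2 it
  becomes x0 exactly, so Y(h1, x1 - x2)v in the product turns into Y(h1, x0)v in the iterate without
  costing a further factor x0 + x2. Both this fact and the multiplicativity of the substitution come
  down to Vandermonde convolution.

  A Sigma sum is a finite sum over one fixed representative of \<open>\<Delta> h\<close>. Bounds,
  interchange of sums and closure under addition are therefore termwise and hold for arbitrary
  summands; multilinearity is established where coassociativity or multiplicativity of \<Delta> is
  applied.\<close>

lemma Sum_any_sum:
  fixes f :: "'p \<Rightarrow> 'a \<Rightarrow> 'b::comm_monoid_add"
  assumes "finite A" "\<And>p. p \<in> A \<Longrightarrow> finite {x. f p x \<noteq> 0}"
  shows "Sum_any (\<lambda>x. \<Sum>p\<in>A. f p x) = (\<Sum>p\<in>A. Sum_any (f p))"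
proof -
  let ?S = "\<Union>p\<in>A. {x. f p x \<noteq> 0}"
  have S: "finite ?S" using assms by blast
  have "Sum_any (\<lambda>x. \<Sum>p\<in>A. f p x) = (\<Sum>x\<in>?S. \<Sum>p\<in>A. f p x)"
    by (rule Sum_any.expand_superset[OF S]) (auto elim: sum.not_neutral_contains_not_neutral)
  also have "\<dots> = (\<Sum>p\<in>A. \<Sum>x\<in>?S. f p x)" by (rule sum.swap)
  also have "\<dots> = (\<Sum>p\<in>A. Sum_any (f p))"
    by (intro sum.cong refl Sum_any.expand_superset[OF S, symmetric]) auto
  finally show ?thesis .
qed

lemma clinear_sum: "clinear \<phi> \<Longrightarrow> \<phi> (\<Sum>x\<in>A. f x) = (\<Sum>x\<in>A. \<phi> (f x))"
  by (induction A rule: infinite_finite_induct) (simp_all add: clinear_0 clinear_add)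

lemma clinear_Sum_any:
  assumes "clinear \<phi>" "finite {x. f x \<noteq> 0}"
  shows "\<phi> (Sum_any f) = Sum_any (\<lambda>x. \<phi> (f x))"
proof -
  have "Sum_any (\<lambda>x. \<phi> (f x)) = (\<Sum>x\<in>{x. f x \<noteq> 0}. \<phi> (f x))"
    by (rule Sum_any.expand_superset[OF assms(2)]) (auto simp: clinear_0[OF assms(1)])
  then show ?thesis by (simp add: Sum_any.expand_set clinear_sum[OF assms(1)])
qed

lemma Sum_any_Sigma:
  fixes g :: "'a \<Rightarrow> 'b \<Rightarrow> 'c::comm_monoid_add"
  assumes fin: "finite {(a, b). g a b \<noteq> 0}"
  shows "Sum_any (\<lambda>a. Sum_any (g a)) = Sum_any (\<lambda>(a, b). g a b)"
proof (rule Sum_any.cartesian_product)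
  let ?D = "{(a, b). g a b \<noteq> 0}"
  show "finite (fst ` ?D \<times> snd ` ?D)" using fin by blast
  show "{a. \<exists>b. g a b \<noteq> 0} \<times> {b. \<exists>a. g a b \<noteq> 0} \<subseteq> fst ` ?D \<times> snd ` ?D"
    by (auto simp: image_iff) 
qed

lemma Sum_any_reindex:
  assumes "\<And>x. h' (h x) = x" "\<And>y. h (h' y) = y"
  shows "Sum_any g = Sum_any (\<lambda>x. g (h x))"
  by (rule Sum_any.reindex_cong[of h]) (auto simp: o_def intro!: o_bij[of h'] assms)

lemma uniform_lower_bound:
  fixes Q :: "'x \<Rightarrow> int \<Rightarrow> bool"
  assumes "finite S" "\<And>x. x \<in> S \<Longrightarrow> \<exists>N. \<forall>y<N. Q x y"
  shows "\<exists>N. \<forall>x\<in>S. \<forall>y<N. Q x y"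
proof -
  obtain N where N: "\<And>x. x \<in> S \<Longrightarrow> \<forall>y<N x. Q x y" using assms(2) by metis
  \<comment> \<open>\<open>insert 0\<close> keeps the minimum defined when \<open>S\<close> is
    empty.\<close>
  have "Min (insert 0 (N ` S)) \<le> N x" if "x \<in> S" for x using that assms(1) by (intro Min_le) auto
  then show ?thesis using N by (intro exI[of _ "Min (insert 0 (N ` S))"]) force
qed

text \<open>
  \<open>F n\<close> lies in \<open>A((x\<^sub>1))((x\<^sub>2))\<close>, with bounds uniform in the parameter \<open>n\<close>; membership in
  \<open>A((x\<^sub>2))((x\<^sub>1))\<close> is expressed by exchanging the two exponents.
\<close>

definition laurent2 :: "('p \<Rightarrow> int \<Rightarrow> int \<Rightarrow> 'a::zero) \<Rightarrow> bool"
  where "laurent2 F \<longleftrightarrow> (\<exists>K. \<forall>n a b. b < K \<longrightarrow> F n a b = 0) \<and>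
    (\<forall>M. \<exists>N. \<forall>n a b. b \<le> M \<longrightarrow> a < N \<longrightarrow> F n a b = 0)"

text \<open>The exponents i and k belong to x1, the exponents j and l to x2. The x1 exponents are
  bounded below only once both x2 exponents are bounded above, which is what finiteness of the
  diagonal needs.\<close>

definition laurent4 :: "('p \<Rightarrow> int \<Rightarrow> int \<Rightarrow> int \<Rightarrow> int \<Rightarrow> 'a::zero) \<Rightarrow> bool"
  where "laurent4 \<kappa> \<longleftrightarrow> (\<exists>K. \<forall>n i j k l. j < K \<or> l < K \<longrightarrow> \<kappa> n i j k l = 0) \<and>
    (\<forall>M. \<exists>N. \<forall>n i j k l. j \<le> M \<longrightarrow> l \<le> M \<longrightarrow> i < N \<or> k < N \<longrightarrow> \<kappa> n i j k l = 0)"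

text \<open>\<open>\<kappa>(x\<^sub>1, x\<^sub>2, x\<^sub>1, x\<^sub>2)\<close>, where \<open>\<kappa>\<close> has coefficients \<open>\<kappa> i j k l\<close>\<close>

definition diagonal :: "(int \<Rightarrow> int \<Rightarrow> int \<Rightarrow> int \<Rightarrow> 'a::comm_monoid_add) \<Rightarrow> int \<Rightarrow> int \<Rightarrow> 'a"
  where "diagonal \<kappa> a b = Sum_any (\<lambda>(i, j). \<kappa> i j (a - i) (b - j))"

definition diagonal_finite :: "(int \<Rightarrow> int \<Rightarrow> int \<Rightarrow> int \<Rightarrow> 'a::zero) \<Rightarrow> bool"
  where "diagonal_finite \<kappa> \<longleftrightarrow> (\<forall>a b. finite {(i, j). \<kappa> i j (a - i) (b - j) \<noteq> 0})"

lemma laurent2I: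
  assumes "\<And>n a b. b < K \<Longrightarrow> F n a b = 0"
    and "\<And>b. \<exists>N. \<forall>n a. a < N \<longrightarrow> F n a b = 0"
  shows "laurent2 F"
  unfolding laurent2_def
proof (intro conjI allI)
  fix M
  obtain N where N: "\<forall>b\<in>{K..M}. \<forall>a<N. \<forall>n. F n a b = 0"
    using uniform_lower_bound[of "{K..M}" "\<lambda>b a. \<forall>n. F n a b = 0"] assms(2)
    by (metis finite_atLeastAtMost_int)
  show "\<exists>N. \<forall>n a b. b \<le> M \<longrightarrow> a < N \<longrightarrow> F n a b = 0"
    using N assms(1) by (intro exI[of _ N]) (metis atLeastAtMost_iff not_le)
qed (use assms(1) in blast)

lemma laurent4I:
  assumes "\<And>n i j k l. j < K \<or> l < K \<Longrightarrow> \<kappa> n i j k l = 0"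
    and "\<And>j l. \<exists>N. \<forall>n i k. i < N \<or> k < N \<longrightarrow> \<kappa> n i j k l = 0"
  shows "laurent4 \<kappa>"
  unfolding laurent4_def
proof (intro conjI allI)
  fix M
  \<comment> \<open>Writing \<open>i = y \<or> k = y\<close> puts a simultaneous bound on two
    exponents into the one-exponent form of \<open>uniform_lower_bound\<close>.\<close>
  have "\<exists>N. \<forall>x\<in>{K..M} \<times> {K..M}. \<forall>y<N. \<forall>n i k. i = y \<or> k = y \<longrightarrow> \<kappa> n i (fst x) k (snd x) = 0"
  proof (rule uniform_lower_bound)
    fix x :: "int \<times> int"
    obtain N where "\<forall>n i k. i < N \<or> k < N \<longrightarrow> \<kappa> n i (fst x) k (snd x) = 0"
      using assms(2) by blast
    then show "\<exists>N. \<forall>y<N. \<forall>n i k. i = y \<or> k = y \<longrightarrow> \<kappa> n i (fst x) k (snd x) = 0" by blast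
  qed simp
  then obtain N where
    N: "\<And>j l n i k. j \<in> {K..M} \<Longrightarrow> l \<in> {K..M} \<Longrightarrow> i < N \<or> k < N \<Longrightarrow> \<kappa> n i j k l = 0" by fastforce
  show "\<exists>N. \<forall>n i j k l. j \<le> M \<longrightarrow> l \<le> M \<longrightarrow> i < N \<or> k < N \<longrightarrow> \<kappa> n i j k l = 0"
    using N assms(1) by (intro exI[of _ N]) (metis atLeastAtMost_iff not_le)
qed (use assms(1) in blast)

lemma diagonal_finite_laurent4:
  assumes "laurent4 \<kappa>"
  shows "diagonal_finite (\<kappa> n)"
  unfolding diagonal_finite_def
proof (intro allI)
  fix a b
  obtain K where K: "\<And>i j k l. j < K \<or> l < K \<Longrightarrow> \<kappa> n i j k l = 0"
    using assms unfolding laurent4_def by blast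
  \<comment> \<open>If j and b - j are both at least K, then both are at most b - K; hence this
    choice of the upper bound.\<close>
  obtain N where N: "\<And>i j k l. j \<le> b - K \<Longrightarrow> l \<le> b - K \<Longrightarrow> i < N \<or> k < N \<Longrightarrow> \<kappa> n i j k l = 0"
    using assms unfolding laurent4_def by metis
  have "i \<in> {N..a - N} \<and> j \<in> {K..b - K}" if "\<kappa> n i j (a - i) (b - j) \<noteq> 0" for i j
  proof -
    have j: "\<not> (j < K \<or> b - j < K)" using K[of j "b - j" i "a - i"] that by blast
    then have "\<not> (i < N \<or> a - i < N)" using N[of j "b - j" i "a - i"] that by force
    with j show ?thesis by auto
  qed
  then have "{(i, j). \<kappa> n i j (a - i) (b - j) \<noteq> 0} \<subseteq> {N..a - N} \<times> {K..b - K}" by auto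
  then show "finite {(i, j). \<kappa> n i j (a - i) (b - j) \<noteq> 0}"
    by (rule finite_subset) simp
qed

lemma diagonal_swap: "diagonal (\<lambda>i j k l. \<kappa> j i l k) a b = diagonal \<kappa> b a"
proof -
  have "diagonal \<kappa> b a = Sum_any (\<lambda>p. case prod.swap p of (i, j) \<Rightarrow> \<kappa> i j (b - i) (a - j))"
    unfolding diagonal_def by (rule Sum_any_reindex[of prod.swap]) (rule swap_swap)+
  also have "(\<lambda>p. case prod.swap p of (i, j) \<Rightarrow> \<kappa> i j (b - i) (a - j)) = 
      (\<lambda>(i, j). \<kappa> j i (b - j) (a - i))"
    by (rule ext) (simp split: prod.split)
  finally show ?thesis by (simp only: diagonal_def)
qed

lemma diagonal_finite_swap: "diagonal_finite (\<lambda>i j k l. \<kappa> j i l k) \<longleftrightarrow> diagonal_finite \<kappa>"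
proof -
  have "diagonal_finite (\<lambda>i j k l. \<kappa> j i l k)" if "diagonal_finite \<kappa>"
    for \<kappa> :: "int \<Rightarrow> int \<Rightarrow> int \<Rightarrow> int \<Rightarrow> 'a"
    unfolding diagonal_finite_def
  proof (intro allI)
    fix a b
    have "finite (prod.swap ` {(i, j). \<kappa> i j (b - i) (a - j) \<noteq> 0})"
      using that unfolding diagonal_finite_def by blast
    also have "prod.swap ` {(i, j). \<kappa> i j (b - i) (a - j) \<noteq> 0} = {(i, j). \<kappa> j i (b - j) (a - i) \<noteq> 0}"
      by (auto simp: image_iff)
    finally show "finite {(i, j). \<kappa> j i (b - j) (a - i) \<noteq> 0}" .
  qed
  from this[of \<kappa>] this[of "\<lambda>i j k l. \<kappa> j i l k"] show ?thesis by blast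
qed

lemma diagonal_add:
  assumes "diagonal_finite \<kappa>" "diagonal_finite \<mu>"
  shows "diagonal (\<lambda>i j k l. \<kappa> i j k l + \<mu> i j k l) a b = diagonal \<kappa> a b + diagonal \<mu> a b"
  using Sum_any.distrib[of "\<lambda>(i, j). \<kappa> i j (a - i) (b - j)" "\<lambda>(i, j). \<mu> i j (a - i) (b - j)"] assms
  by (simp add: diagonal_def diagonal_finite_def case_prod_unfold)

lemma diagonal_scale:
  "diagonal (\<lambda>i j k l. c *\<^sub>C \<kappa> i j k l) a b = c *\<^sub>C diagonal \<kappa> a b"
  by (simp add: diagonal_def Sum_any_scaleC[symmetric] case_prod_unfold)

lemma laurent2_diagonal:
  assumes "laurent4 \<kappa>"
  shows "laurent2 (\<lambda>n. diagonal (\<kappa> n))"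
proof -
  obtain K where K: "\<And>n i j k l. j < K \<or> l < K \<Longrightarrow> \<kappa> n i j k l = 0"
    using assms unfolding laurent4_def by blast
  have nz: "\<exists>i j. \<kappa> n i j (a - i) (b - j) \<noteq> 0" if "diagonal (\<kappa> n) a b \<noteq> 0" for n a b
    using that unfolding diagonal_def by (auto elim!: Sum_any.not_neutral_obtains_not_neutral)
  show ?thesis
  proof (rule laurent2I)
    fix n a b assume "b < 2 * K"
    then have "j < K \<or> b - j < K" for j by linarith
    then show "diagonal (\<kappa> n) a b = 0" using nz K by blast
  next
    fix b
    obtain N where N: "\<And>n i j k l. j \<le> b - K \<Longrightarrow> l \<le> b - K \<Longrightarrow> i < N \<or> k < N \<Longrightarrow> \<kappa> n i j k l = 0"
      using assms unfolding laurent4_def by metis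
    have "diagonal (\<kappa> n) a b = 0" if "a < 2 * N" for n a
    proof (rule ccontr)
      assume "diagonal (\<kappa> n) a b \<noteq> 0"
      then obtain i j where *: "\<kappa> n i j (a - i) (b - j) \<noteq> 0" using nz by blast
      then have "\<not> (j < K \<or> b - j < K)" using K by blast
      then have "\<not> (i < N \<or> a - i < N)" using N[of j "b - j" i "a - i" n] * by force
      then show False using that by linarith
    qed
    then show "\<exists>N. \<forall>n a. a < N \<longrightarrow> diagonal (\<kappa> n) a b = 0" by blast
  qed
qed

section \<open>Elementary rules for multiplication by powers of x0 + x2 and for the substitution x1
  = x0 + x2\<close>

lemma mult_add_power_0: "mult_add_power 0 F = F"
  by (simp add: mult_add_power_def scaleC_one fun_eq_iff)

text \<open>Pascal's rule splits off one factor x0 + x2. Inductions on the power then only deal with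
  two shifts of exponents.\<close>

lemma mult_add_power_Suc:
  "mult_add_power (Suc l) F a b = mult_add_power l F (a - 1) b + mult_add_power l F a (b - 1)"
proof -
  define X where "X j = F (a - int (Suc l - j)) (b - int j)" for j
  have "mult_add_power (Suc l) F a b = (\<Sum>j\<le>Suc l. (of_nat (Suc l choose j) :: complex) *\<^sub>C X j)"
    by (simp add: mult_add_power_def X_def)
  also have "\<dots> = X 0 + (\<Sum>j\<le>l. (of_nat (l choose Suc j) + of_nat (l choose j) :: complex) *\<^sub>C X (Suc j))"
    by (subst sum.atMost_Suc_shift) (simp add: scaleC_one add.commute)
  also have "\<dots> = (X 0 + (\<Sum>j\<le>l. (of_nat (l choose Suc j) :: complex) *\<^sub>C X (Suc j)))
      + (\<Sum>j\<le>l. (of_nat (l choose j) :: complex) *\<^sub>C X (Suc j))"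
    by (simp add: scaleC_add_left sum.distrib)
  also have "X 0 + (\<Sum>j\<le>l. (of_nat (l choose Suc j) :: complex) *\<^sub>C X (Suc j)) =
      (\<Sum>j\<le>Suc l. (of_nat (l choose j) :: complex) *\<^sub>C X j)"
    by (subst sum.atMost_Suc_shift) (simp add: scaleC_one)
  also have "\<dots> = mult_add_power l F (a - 1) b"
    by (auto simp: mult_add_power_def X_def cvec.scale_zero_left Suc_diff_le intro!: sum.cong)
      (simp add: algebra_simps)
  also have "(\<Sum>j\<le>l. (of_nat (l choose j) :: complex) *\<^sub>C X (Suc j)) = mult_add_power l F a (b - 1)"
    by (auto simp: mult_add_power_def X_def simp: algebra_simps intro!: sum.cong)
  finally show ?thesis .
qed

lemma mult_add_power_linear:
  "clinear \<phi> \<Longrightarrow> mult_add_power l (\<lambda>a b. \<phi> (F a b)) a b = \<phi> (mult_add_power l F a b)"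
  by (simp add: mult_add_power_def clinear_sum clinear_scale)

lemma mult_add_power_add_fun:
  "mult_add_power l (\<lambda>a b. F a b + G a b) a b = mult_add_power l F a b + mult_add_power l G a b"
  by (simp add: mult_add_power_def scaleC_add_right sum.distrib)

lemma mult_add_power_mono:
  assumes "mult_add_power l F = mult_add_power l G" "l \<le> l'"
  shows "mult_add_power l' F = mult_add_power l' G"
  using assms(2,1) by (induction rule: dec_induct) (simp_all add: fun_eq_iff mult_add_power_Suc)

lemma subst_add_linear:
  assumes "clinear \<phi>" "\<And>a b. b < K \<Longrightarrow> F a b = 0"
  shows "subst_add (\<lambda>a b. \<phi> (F a b)) a b = \<phi> (subst_add F a b)"
  unfolding subst_add_def clinear_scale[OF assms(1), symmetric]
  by (rule clinear_Sum_any[OF assms(1), symmetric], rule subst_add_finite[of K]) (rule assms(2))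

lemma subst_add_add_fun:
  assumes "\<And>a b. b < K \<Longrightarrow> F a b = 0" "\<And>a b. b < K \<Longrightarrow> G a b = 0"
  shows "subst_add (\<lambda>a b. F a b + G a b) a b = subst_add F a b + subst_add G a b"
  unfolding subst_add_def scaleC_add_right
  by (rule Sum_any.distrib; rule subst_add_finite[of K]) (simp_all add: assms)

lemma subst_add_atMost:
  assumes "\<And>a b. b < K \<Longrightarrow> F a b = 0" "b - K \<le> int R"
  shows "subst_add F a b = (\<Sum>j\<le>R. ((of_int (a + int j) :: complex) gchoose j) *\<^sub>C F (a +
      int j) (b - int j))"
  unfolding subst_add_def
proof (rule Sum_any.expand_superset)
  have "j \<le> R" if "((of_int (a + int j) :: complex) gchoose j) *\<^sub>C F (a + int j) (b - int j) \<noteq> 0" for j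
    using that assms by (cases "b - int j < K") auto
  then show "{j. ((of_int (a + int j) :: complex) gchoose j) *\<^sub>C F (a + int j) (b - int j) \<noteq> 0} \<subseteq> {..R}"
    by blast
qed simp

text \<open>An operation on series in two variables is applied to one pair of exponents, the other
  pair being parameters. This takes the place of operating on one factor of a product, since
  \<kappa> need not split into factors.\<close>

abbreviation slot1 :: "((int \<Rightarrow> int \<Rightarrow> 'a) \<Rightarrow> int \<Rightarrow> int \<Rightarrow> 'b) \<Rightarrow>
    (int \<Rightarrow> int \<Rightarrow> int \<Rightarrow> int \<Rightarrow> 'a) \<Rightarrow> int \<Rightarrow> int \<Rightarrow> int \<Rightarrow> int \<Rightarrow> 'b"
  where "slot1 \<Phi> \<kappa> \<equiv> \<lambda>i j k l. \<Phi> (\<lambda>i j. \<kappa> i j k l) i j"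

abbreviation slot2 :: "((int \<Rightarrow> int \<Rightarrow> 'a) \<Rightarrow> int \<Rightarrow> int \<Rightarrow> 'b) \<Rightarrow>
    (int \<Rightarrow> int \<Rightarrow> int \<Rightarrow> int \<Rightarrow> 'a) \<Rightarrow> int \<Rightarrow> int \<Rightarrow> int \<Rightarrow> int \<Rightarrow> 'b"
  where "slot2 \<Phi> \<kappa> \<equiv> \<lambda>i j. \<Phi> (\<kappa> i j)"

section \<open>Diagonals under shifts, multiplication and substitution\<close>

lemma diagonal_shift:
  "diagonal (\<lambda>i j k l. \<kappa> (i - c) (j - d) (k - c') (l - d')) a b = diagonal \<kappa> (a - c - c') (b - d - d')"
proof -
  have "diagonal (\<lambda>i j k l. \<kappa> (i - c) (j - d) (k - c') (l - d')) a b =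
      Sum_any (\<lambda>p. case (fst p + c, snd p + d) of (i, j) \<Rightarrow>
        \<kappa> (i - c) (j - d) (a - i - c') (b - j - d'))"
    unfolding diagonal_def by (rule Sum_any_reindex[of "\<lambda>p. (fst p - c, snd p - d)"]) simp_all
  also have "\<dots> = diagonal \<kappa> (a - c - c') (b - d - d')"
    unfolding diagonal_def case_prod_unfold by (rule Sum_any.cong) (simp add: algebra_simps)
  finally show ?thesis .
qed

lemma diagonal_finite_shift:
  assumes "diagonal_finite \<kappa>"
  shows "diagonal_finite (\<lambda>i j k l. \<kappa> (i - c) (j - d) (k - c') (l - d'))"
  unfolding diagonal_finite_def
proof (intro allI)
  fix a b
  let ?S = "{(i, j). \<kappa> i j (a - c - c' - i) (b - d - d' - j) \<noteq> 0}"
  have "{(i, j). \<kappa> (i - c) (j - d) (a - i - c') (b - j - d') \<noteq> 0} \<subseteq> (\<lambda>(i, j). (i + c, j + d)) ` ?S"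
  proof safe
    fix i j assume "\<kappa> (i - c) (j - d) (a - i - c') (b - j - d') \<noteq> 0"
    moreover have "a - i - c' = a - c - c' - (i - c)" "b - j - d' = b - d - d' - (j - d)" by simp_all
    ultimately show "(i, j) \<in> (\<lambda>(i, j). (i + c, j + d)) ` ?S"
      by (intro image_eqI[of _ _ "(i - c, j - d)"]) auto
  qed
  moreover have "finite ?S" using assms unfolding diagonal_finite_def by blast
  ultimately show "finite {(i, j). \<kappa> (i - c) (j - d) (a - i - c') (b - j - d') \<noteq> 0}"
    using finite_surj by blast
qed

lemma diagonal_finite_add:
  assumes "diagonal_finite \<kappa>" "diagonal_finite \<mu>"
  shows "diagonal_finite (\<lambda>i j k l. \<kappa> i j k l + \<mu> i j k l :: 'a::comm_monoid_add)"
  unfolding diagonal_finite_def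
proof (intro allI)
  fix a b
  have "finite ({(i, j). \<kappa> i j (a - i) (b - j) \<noteq> 0} \<union> {(i, j). \<mu> i j (a - i) (b - j) \<noteq> 0})"
    using assms unfolding diagonal_finite_def by blast
  then show "finite {(i, j). \<kappa> i j (a - i) (b - j) + \<mu> i j (a - i) (b - j) \<noteq> 0}"
    by (rule rev_finite_subset) auto
qed

text \<open>Multiplying one factor multiplies the product. The induction peels off x0 + x2, whose
  two terms shift one pair of exponents; finiteness is carried along because \<open>Sum_any\<close>
  is additive only on finite supports.\<close>

lemma
  fixes \<kappa> :: "int \<Rightarrow> int \<Rightarrow> int \<Rightarrow> int \<Rightarrow> 'a::complex_vector"
  assumes fin: "diagonal_finite \<kappa>"
  shows diagonal_finite_mult_slot1: "diagonal_finite (slot1 (mult_add_power l) \<kappa>)"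
    and diagonal_mult_slot1: "diagonal (slot1 (mult_add_power l) \<kappa>) = mult_add_power l (diagonal \<kappa>)"
proof -
  have "diagonal_finite (slot1 (mult_add_power l) \<kappa>) \<and>
    diagonal (slot1 (mult_add_power l) \<kappa>) = mult_add_power l (diagonal \<kappa>)"
  proof (induction l)
    case 0
    show ?case using fin by (simp add: mult_add_power_0)
  next
    case (Suc l)
    define \<mu> where "\<mu> = slot1 (mult_add_power l) \<kappa>"
    have fin': "diagonal_finite \<mu>" and eq: "diagonal \<mu> = mult_add_power l (diagonal \<kappa>)"
      using Suc by (simp_all add: \<mu>_def)
    have sum: "slot1 (mult_add_power (Suc l)) \<kappa> = (\<lambda>i j k l. \<mu> (i - 1) j k l + \<mu> i (j - 1) k l)"
      by (simp add: mult_add_power_Suc \<mu>_def)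
    note shift = diagonal_finite_shift[OF fin', of 1 0 0 0] diagonal_finite_shift[OF fin', of 0 1 0 0]
    show ?case
      unfolding sum using diagonal_finite_add[OF shift] diagonal_add[OF shift]
        diagonal_shift[of \<mu> 1 0 0 0] diagonal_shift[of \<mu> 0 1 0 0]
      by (simp add: fun_eq_iff mult_add_power_Suc eq)
  qed
  then show "diagonal_finite (slot1 (mult_add_power l) \<kappa>)"
    "diagonal (slot1 (mult_add_power l) \<kappa>) = mult_add_power l (diagonal \<kappa>)" by auto
qed

lemma
  fixes \<kappa> :: "int \<Rightarrow> int \<Rightarrow> int \<Rightarrow> int \<Rightarrow> 'a::complex_vector"
  assumes fin: "diagonal_finite \<kappa>"
  shows diagonal_mult_slot2: "diagonal (slot2 (mult_add_power l) \<kappa>) = mult_add_power l (diagonal \<kappa>)"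
proof -
  have "diagonal_finite (slot2 (mult_add_power l) \<kappa>) \<and>
    diagonal (slot2 (mult_add_power l) \<kappa>) = mult_add_power l (diagonal \<kappa>)"
  proof (induction l)
    case 0
    show ?case using fin by (simp add: mult_add_power_0)
  next
    case (Suc l)
    define \<mu> where "\<mu> = slot2 (mult_add_power l) \<kappa>"
    have fin': "diagonal_finite \<mu>" and eq: "diagonal \<mu> = mult_add_power l (diagonal \<kappa>)"
      using Suc by (simp_all add: \<mu>_def)
    have sum: "slot2 (mult_add_power (Suc l)) \<kappa> = (\<lambda>i j k l. \<mu> i j (k - 1) l + \<mu> i j k (l - 1))"
      by (simp add: mult_add_power_Suc \<mu>_def fun_eq_iff)
    note shift = diagonal_finite_shift[OF fin', of 0 0 1 0] diagonal_finite_shift[OF fin', of 0 0 0 1]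
    show ?case
      unfolding sum using diagonal_finite_add[OF shift] diagonal_add[OF shift]
        diagonal_shift[of \<mu> 0 0 1 0] diagonal_shift[of \<mu> 0 0 0 1]
      by (simp add: fun_eq_iff mult_add_power_Suc eq)
  qed
  then show "diagonal (slot2 (mult_add_power l) \<kappa>) = mult_add_power l (diagonal \<kappa>)" by auto
qed

lemma finite_sum_support:
  assumes "finite A" "\<And>p. p \<in> A \<Longrightarrow> finite {x. f p x \<noteq> 0}"
  shows "finite {x. (\<Sum>p\<in>A. f p x) \<noteq> (0::'a::comm_monoid_add)}"
proof (rule finite_subset)
  show "{x. (\<Sum>p\<in>A. f p x) \<noteq> 0} \<subseteq> (\<Union>p\<in>A. {x. f p x \<noteq> 0})"
    by (auto elim: sum.not_neutral_contains_not_neutral)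
qed (use assms in blast)

lemma sum_square_triangle:
  fixes f :: "nat \<Rightarrow> nat \<Rightarrow> 'a::comm_monoid_add"
  assumes "\<And>p q. p + q > R \<Longrightarrow> f p q = 0"
  shows "(\<Sum>p\<le>R. \<Sum>q\<le>R. f p q) = (\<Sum>r\<le>R. \<Sum>p\<le>r. f p (r - p))"
proof -
  have "(\<Sum>p\<le>R. \<Sum>q\<le>R. f p q) = (\<Sum>(p, q)\<in>{..R} \<times> {..R}. f p q)"
    by (rule sum.cartesian_product)
  also have "\<dots> = (\<Sum>(p, q)\<in>{(p, q). p + q \<le> R}. f p q)"
    using assms by (intro sum.mono_neutral_right) (auto simp flip: not_le)
  finally show ?thesis by (simp add: sum.triangle_reindex_eq)
qed

text \<open>The upper entry on the left moves with j; after reflection it is fixed, which is the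
  form that Vandermonde convolution accepts.\<close>

lemma gbinomial_add_nat_reflect:
  "((of_int (a + int j) :: complex) gchoose j) = (-1) ^ j * (of_int (- a - 1) gchoose j)"
  by (subst gbinomial_negated_upper) (simp add: algebra_simps)

text \<open>Substituting x1 = x0 + x2 is multiplicative. When the two factors supply p and q powers
  of x2 with p + q = r, the coefficients (i choose p) and (a + r - i choose q) are summed over p,
  and Vandermonde gives (a + r choose r), the coefficient for the product.\<close>

lemma subst_add_diagonal:
  fixes \<kappa> :: "'p \<Rightarrow> int \<Rightarrow> int \<Rightarrow> int \<Rightarrow> int \<Rightarrow> 'a::complex_vector"
  assumes \<kappa>: "laurent4 \<kappa>"
  shows "subst_add (diagonal (\<kappa> n)) = diagonal (slot1 subst_add (slot2 subst_add (\<kappa> n)))"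
proof (intro ext)
  fix a b
  define C :: "int \<Rightarrow> nat \<Rightarrow> complex" where "C i p = (of_int i gchoose p)" for i p
  obtain K where K: "\<And>n i j k l. j < K \<or> l < K \<Longrightarrow> \<kappa> n i j k l = 0"
    using \<kappa> unfolding laurent4_def by blast
  \<comment> \<open>Both x2 exponents are at least K, so the two expansions together contribute at
    most b - 2K to the exponent b.\<close>
  define R where "R = nat (b - 2 * K)"
  define E where "E p q = (\<lambda>i j k l. (C (i + int p) p * C (k + int q) q) *\<^sub>C
    \<kappa> n (i + int p) (j - int p) (k + int q) (l - int q))" for p q :: nat
  have E_fin: "finite {x. (\<lambda>(i, j). E p q i j (a - i) (b - j)) x \<noteq> 0}" for p q
  proof -
    have "diagonal_finite (\<lambda>i j k l. \<kappa> n (i - (- int p)) (j - int p) (k - (- int q)) (l - int q))"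
      by (rule diagonal_finite_shift[OF diagonal_finite_laurent4[OF \<kappa>]])
    then have "finite {(i, j). \<kappa> n (i + int p) (j - int p) (a - i + int q) (b - j - int q) \<noteq> 0}"
      unfolding diagonal_finite_def by simp
    then show ?thesis
      by (rule rev_finite_subset) (auto simp: E_def)
  qed
  have slots: "slot1 subst_add (slot2 subst_add (\<kappa> n)) i j k l = (\<Sum>p\<le>R. \<Sum>q\<le>R. E p q i j k l)"
    if "j + l = b" for i j k l
  proof -
    have K1: "subst_add (\<kappa> n i j) k l = 0" if "j < K \<or> l < K" for i j k l
      \<comment> \<open>For l < K the bound K itself applies; for j < K the whole series is zero and
        l + 1 serves as a lower bound.\<close>
      using that by (auto simp: subst_add_atMost[of K "\<kappa> n i j" l 0] K
        subst_add_atMost[of "l + 1" "\<kappa> n i j" l 0] )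
    show ?thesis
    proof (cases "j < K \<or> l < K")
      case True
      then have "E p q i j k l = 0" for p q using K by (auto simp: E_def)
      moreover have "subst_add (\<lambda>i j. subst_add (\<kappa> n i j) k l) i j = 0"
        using True by (subst subst_add_atMost[of K _ j "nat (j - K)"]) (auto simp: K1)
      ultimately show ?thesis by simp
    next
      case False
      then have jl: "j - K \<le> int R" "l - K \<le> int R" using that by (auto simp: R_def)
      show ?thesis
        by (subst subst_add_atMost[of K, OF _ jl(1)], simp add: K1)
          (simp add: subst_add_atMost[of K, OF _ jl(2)] K E_def C_def cvec.scale_sum_right
              scaleC_scaleC)
    qed
  qed
  \<comment> \<open>\<open>U\<close> is \<open>E\<close> with i and j moved back to the exponents
    before the substitution, so that \<kappa> is read at a place depending on p and q only through p
    + q.\<close>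
  define U where "U p q = (\<lambda>(i, j). (C i p * C (a + int p + int q - i) q) *\<^sub>C
    \<kappa> n i j (a + int p + int q - i) (b - int p - int q - j))" for p q :: nat
  have E_U: "Sum_any (\<lambda>(i, j). E p q i j (a - i) (b - j)) = Sum_any (U p q)" for p q
  proof -
    have "Sum_any (U p q) = Sum_any (\<lambda>x. U p q (fst x + int p, snd x - int p))"
      by (rule Sum_any_reindex[of "\<lambda>x. (fst x - int p, snd x + int p)"]) simp_all
    then show ?thesis by (simp add: U_def E_def case_prod_unfold algebra_simps)
  qed
  have vanish: "\<kappa> n i j k l = 0" if "j + l < b - int R" for i j k l
  proof -
    have "j < K \<or> l < K" using that unfolding R_def by linarith
    then show ?thesis by (rule K)
  qed
  have "diagonal (slot1 subst_add (slot2 subst_add (\<kappa> n))) a b =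
      Sum_any (\<lambda>x. \<Sum>p\<le>R. \<Sum>q\<le>R. (\<lambda>(i, j). E p q i j (a - i) (b - j)) x)"
    unfolding diagonal_def by (rule Sum_any.cong) (auto simp: slots)
  also have "\<dots> = (\<Sum>p\<le>R. \<Sum>q\<le>R. Sum_any (\<lambda>(i, j). E p q i j (a - i) (b - j)))"
    using E_fin by (simp add: Sum_any_sum finite_sum_support)
  also have "\<dots> = (\<Sum>p\<le>R. \<Sum>q\<le>R. Sum_any (U p q))"
    by (intro sum.cong refl E_U)
  also have "\<dots> = (\<Sum>r\<le>R. \<Sum>p\<le>r. Sum_any (U p (r - p)))"
  proof (rule sum_square_triangle)
    fix p q assume "R < p + q"
    then have "U p q = (\<lambda>_. 0)" by (auto simp: U_def fun_eq_iff vanish)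
    then show "Sum_any (U p q) = 0" by simp
  qed
  also have "\<dots> = (\<Sum>r\<le>R. C (a + int r) r *\<^sub>C diagonal (\<kappa> n) (a + int r) (b - int r))"
  proof (rule sum.cong[OF refl])
    fix r
    have "U p (r - p) = (\<lambda>(i, j). (C i p * C (a + int r - i) (r - p)) *\<^sub>C
        \<kappa> n i j (a + int r - i) (b - int r - j))" if "p \<le> r" for p
      using that by (simp add: U_def of_nat_diff)
    then have "(\<Sum>p\<le>r. Sum_any (U p (r - p))) = (\<Sum>p\<le>r. Sum_any (\<lambda>(i, j).
        (C i p * C (a + int r - i) (r - p)) *\<^sub>C \<kappa> n i j (a + int r - i) (b - int r - j)))"
      by (intro sum.cong refl) simp
    also have "\<dots> = Sum_any (\<lambda>x. \<Sum>p\<le>r. (\<lambda>(i, j).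
        (C i p * C (a + int r - i) (r - p)) *\<^sub>C \<kappa> n i j (a + int r - i) (b - int r - j)) x)"
    proof (rule Sum_any_sum[symmetric])
      fix p
      have "finite {(i, j). \<kappa> n i j (a + int r - i) (b - int r - j) \<noteq> 0}"
        using diagonal_finite_laurent4[OF \<kappa>] unfolding diagonal_finite_def by blast
      then show "finite {x. (\<lambda>(i, j). (C i p * C (a + int r - i) (r - p)) *\<^sub>C
          \<kappa> n i j (a + int r - i) (b - int r - j)) x \<noteq> 0}"
        by (rule rev_finite_subset) auto
    qed simp
    also have "\<dots> = Sum_any (\<lambda>x. C (a + int r) r *\<^sub>C
        (\<lambda>(i, j). \<kappa> n i j (a + int r - i) (b - int r - j)) x)"
    proof (rule Sum_any.cong)
      fix x
      have "(\<Sum>p\<le>r. C i p * C (a + int r - i) (r - p)) = C (a + int r) r" for i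
        using gbinomial_Vandermonde[of "of_int i" "of_int (a + int r - i)" r]
        by (simp add: C_def atLeast0AtMost)
      then show "(\<Sum>p\<le>r. (\<lambda>(i, j). (C i p * C (a + int r - i) (r - p)) *\<^sub>C
          \<kappa> n i j (a + int r - i) (b - int r - j)) x) = C (a + int r) r *\<^sub>C
        (\<lambda>(i, j). \<kappa> n i j (a + int r - i) (b - int r - j)) x"
        by (simp add: case_prod_unfold cvec.scale_sum_left[symmetric])
    qed
    finally show "(\<Sum>p\<le>r. Sum_any (U p (r - p))) =
        C (a + int r) r *\<^sub>C diagonal (\<kappa> n) (a + int r) (b - int r)"
      by (simp add: Sum_any_scaleC diagonal_def)
  qed
  also have "\<dots> = subst_add (diagonal (\<kappa> n)) a b"
    unfolding C_def
  proof (rule subst_add_atMost[symmetric])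
    show "b - 2 * K \<le> int R" by (simp add: R_def)
    fix a b assume b: "b < 2 * K"
    have "\<kappa> n i j (a - i) (b - j) = 0" for i j
      by (rule K) (use b in linarith)
    then show "diagonal (\<kappa> n) a b = 0" by (simp add: diagonal_def)
  qed
  finally show "subst_add (diagonal (\<kappa> n)) a b =
      diagonal (slot1 subst_add (slot2 subst_add (\<kappa> n))) a b" by simp
qed

section \<open>Weak associativity as a relation between series\<close>

lemma laurent2_bounds:
  assumes "laurent2 F"
  obtains K where "\<And>n a b. b < K \<Longrightarrow> F n a b = 0"
  using assms unfolding laurent2_def by blast

lemma laurent2_bounds_le:
  assumes "laurent2 F"
  obtains N where "\<And>n a b. b \<le> M \<Longrightarrow> a < N \<Longrightarrow> F n a b = 0"
  using assms unfolding laurent2_def by meson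

lemma laurent4_bounds:
  assumes "laurent4 \<kappa>"
  obtains K where "\<And>n i j k l. j < K \<or> l < K \<Longrightarrow> \<kappa> n i j k l = 0"
  using assms unfolding laurent4_def by blast

lemma laurent4_bounds_le:
  assumes "laurent4 \<kappa>"
  obtains N where "\<And>n i j k l. j \<le> M \<Longrightarrow> l \<le> M \<Longrightarrow> i < N \<or> k < N \<Longrightarrow> \<kappa> n i j k l = 0"
  using assms unfolding laurent4_def by meson

lemma subst_add_nonzero:
  assumes "subst_add F a b \<noteq> 0"
  obtains r :: nat where "F (a + int r) (b - int r) \<noteq> 0"
proof -
  obtain r where "((of_int (a + int r) :: complex) gchoose r) *\<^sub>C F (a + int r) (b - int r) \<noteq> 0"
    using assms unfolding subst_add_def by (elim Sum_any.not_neutral_obtains_not_neutral)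
  then show ?thesis using that[of r] by auto
qed

section \<open>Bounds under substitution, and commuting operations on different pairs of
  exponents\<close>

lemma laurent2_subst_add:
  assumes "laurent2 F"
  shows "laurent2 (\<lambda>n. subst_add (F n))"
proof -
  obtain K where K: "\<And>n a b. b < K \<Longrightarrow> F n a b = 0" using laurent2_bounds[OF assms] by blast
  show ?thesis
  proof (rule laurent2I)
    fix n a b assume "b < K"
    then have "F n (a + int r) (b - int r) = 0" for r :: nat by (intro K) simp
    then show "subst_add (F n) a b = 0" by (simp add: subst_add_def)
  next
    fix b
    obtain N where N: "\<And>n a b'. b' \<le> b \<Longrightarrow> a < N \<Longrightarrow> F n a b' = 0"
      using laurent2_bounds_le[OF assms] by blast
    \<comment> \<open>A nonzero term needs b - r \<ge> K and a + r \<ge> N, hence a \<ge> N - (b -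
      K).\<close>
    have "subst_add (F n) a b = 0" if a: "a < N - \<bar>b - K\<bar>" for n a
    proof (rule ccontr)
      assume "subst_add (F n) a b \<noteq> 0"
      then obtain r :: nat where r: "F n (a + int r) (b - int r) \<noteq> 0" by (rule subst_add_nonzero)
      have "\<not> b - int r < K" using K r by blast
      then show False using N[of "b - int r" "a + int r" n] r a by linarith
    qed
    then show "\<exists>N. \<forall>n a. a < N \<longrightarrow> subst_add (F n) a b = 0" by blast
  qed
qed

lemma laurent4_subst_add_slot2:
  assumes "laurent4 \<kappa>"
  shows "laurent4 (\<lambda>n. slot2 subst_add (\<kappa> n))"
proof -
  obtain K where K: "\<And>n i j k l. j < K \<or> l < K \<Longrightarrow> \<kappa> n i j k l = 0" using laurent4_bounds[OF assms]
      by blast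
  show ?thesis
  proof (rule laurent4I)
    fix n i j k l assume *: "j < K \<or> l < K"
    show "subst_add (\<kappa> n i j) k l = 0"
    proof (rule ccontr)
      assume "subst_add (\<kappa> n i j) k l \<noteq> 0"
      then obtain r :: nat where r: "\<kappa> n i j (k + int r) (l - int r) \<noteq> 0" by (rule subst_add_nonzero)
      moreover have "j < K \<or> l - int r < K" using * by linarith
      ultimately show False using K by blast
    qed
  next
    fix j l
    obtain N where N: "\<And>n i j' k l'. j' \<le> max j l \<Longrightarrow> l' \<le> max j l \<Longrightarrow> i < N \<or> k < N \<Longrightarrow> \<kappa> n i j' k l' = 0"
      using laurent4_bounds_le[OF assms] by blast
    have "subst_add (\<kappa> n i j) k l = 0" if ik: "i < N - \<bar>l - K\<bar> \<or> k < N - \<bar>l - K\<bar>" for n i k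
    proof (rule ccontr)
      assume "subst_add (\<kappa> n i j) k l \<noteq> 0"
      then obtain r :: nat where r: "\<kappa> n i j (k + int r) (l - int r) \<noteq> 0" by (rule subst_add_nonzero)
      have "\<not> l - int r < K" using K r by blast
      then have "i < N \<or> k + int r < N" using ik by linarith
      then show False using N[of j "l - int r" i "k + int r" n] r by (simp add: le_max_iff_disj)
    qed
    then show "\<exists>N. \<forall>n i k. i < N \<or> k < N \<longrightarrow> subst_add (\<kappa> n i j) k l = 0" by blast
  qed
qed

lemma laurent4_flip: "laurent4 \<kappa> \<Longrightarrow> laurent4 (\<lambda>n i j k l. \<kappa> n k l i j)"
  unfolding laurent4_def by meson

lemma laurent4_subst_add_slot1: "laurent4 \<kappa> \<Longrightarrow> laurent4 (\<lambda>n. slot1 subst_add (\<kappa> n))"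
  using laurent4_flip[OF laurent4_subst_add_slot2[OF laurent4_flip]] .

text \<open>The operations concern different pairs of exponents. The bound on j makes the
  substitution a finite sum, hence additive, so it passes through the factors x0 + x2 one at a
  time.\<close>

lemma subst_add_mult_slots:
  assumes "\<And>i j k l. j < K \<Longrightarrow> \<kappa> i j k l = 0"
  shows "slot1 subst_add (slot2 (mult_add_power m) \<kappa>) = slot2 (mult_add_power m) (slot1 subst_add \<kappa>)"
proof (induction m)
  case 0
  show ?case by (simp add: mult_add_power_0)
next
  case (Suc m)
  have 0: "mult_add_power m (\<kappa> i j) k l = 0" if "j < K" for i j k l
    using that assms by (simp add: mult_add_power_def)
  have IH: "subst_add (\<lambda>i j. mult_add_power m (\<kappa> i j) k l) i j =
      mult_add_power m (\<lambda>k l. subst_add (\<lambda>i j. \<kappa> i j k l) i j) k l" for i j k l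
    using Suc by (simp add: fun_eq_iff)
  show ?case
    by (simp add: fun_eq_iff mult_add_power_Suc subst_add_add_fun[of K] 0 IH)
qed

lemma mult_mult_slots:
  "slot1 (mult_add_power l) (slot2 (mult_add_power m) \<kappa>) = slot2 (mult_add_power m) (slot1
      (mult_add_power l) \<kappa>)"
proof (induction m)
  case (Suc m)
  have IH: "mult_add_power l (\<lambda>i j. mult_add_power m (\<kappa> i j) k' l') i j =
      mult_add_power m (\<lambda>k' l'. mult_add_power l (\<lambda>i j. \<kappa> i j k' l') i j) k' l'" for i j k' l'
    using Suc by (simp add: fun_eq_iff)
  show ?case
    by (simp add: fun_eq_iff mult_add_power_Suc mult_add_power_add_fun IH)
qed (simp add: mult_add_power_0)

lemma mult_add_power_add: "mult_add_power (l + m) F = mult_add_power m (mult_add_power l F)"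
  by (induction m) (simp_all add: fun_eq_iff mult_add_power_0 mult_add_power_Suc)

lemma weak_assoc_diagonal:
  fixes \<kappa> \<kappa>' \<kappa>'' :: "'p \<Rightarrow> int \<Rightarrow> int \<Rightarrow> int \<Rightarrow> int \<Rightarrow> 'a::complex_vector"
  assumes \<kappa>: "laurent4 \<kappa>" and \<kappa>'': "laurent4 (\<lambda>n i j k l. \<kappa>'' n j i l k)"
    and bound: "\<And>n i j k l. j < K \<Longrightarrow> \<kappa>' n i j k l = 0"
    and slot2: "\<And>n i j. mult_add_power m (subst_add (\<kappa> n i j)) = mult_add_power m (\<kappa>' n i j)"
    and slot1: "\<And>n k l. mult_add_power l' (subst_add (\<lambda>i j. \<kappa>' n i j k l)) =
      mult_add_power l' (\<lambda>i j. \<kappa>'' n i j k l)"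
  shows "mult_add_power (l' + m) (subst_add (diagonal (\<kappa> n))) = mult_add_power (l' +
      m) (diagonal (\<kappa>'' n))"
proof -
  have s2: "laurent4 (\<lambda>n. slot2 subst_add (\<kappa> n))" by (rule laurent4_subst_add_slot2[OF \<kappa>])
  obtain K2 where K2: "\<And>n i j k l. j < K2 \<or> l < K2 \<Longrightarrow> subst_add (\<kappa> n i j) k l = 0"
    using laurent4_bounds[OF s2] by blast
  have fin: "diagonal_finite (slot1 subst_add (slot2 subst_add (\<kappa> n)))"
    using diagonal_finite_laurent4[OF laurent4_subst_add_slot1[OF s2]] .
  have fin'': "diagonal_finite (\<kappa>'' n)"
    using diagonal_finite_laurent4[OF \<kappa>'', of n] diagonal_finite_swap[of "\<kappa>'' n"] by simp
  have "slot2 (mult_add_power m) (slot1 (mult_add_power l') (slot1 subst_add (slot2 subst_add (\<kappa> n)))) =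
    slot1 (mult_add_power l') (slot2 (mult_add_power m) (slot1 subst_add (slot2 subst_add (\<kappa> n))))"
    by (rule mult_mult_slots[symmetric])
  also have "\<dots> = slot1 (mult_add_power l') (slot1 subst_add (slot2 (mult_add_power m) (slot2
      subst_add (\<kappa> n))))"
    by (rule arg_cong[OF subst_add_mult_slots[of K2, symmetric],
      where f = "slot1 (mult_add_power l')"]) (simp add: K2)
  also have "\<dots> = slot1 (mult_add_power l') (slot1 subst_add (slot2 (mult_add_power m) (\<kappa>' n)))"
    by (simp only: slot2)
  also have "\<dots> = slot1 (mult_add_power l') (slot2 (mult_add_power m) (slot1 subst_add (\<kappa>' n)))"
    by (rule arg_cong[OF subst_add_mult_slots[of K], where f = "slot1 (mult_add_power l')"]) (simp
      add: bound)
  also have "\<dots> = slot2 (mult_add_power m) (slot1 (mult_add_power l') (slot1 subst_add (\<kappa>' n)))"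
    by (rule mult_mult_slots)
  also have "\<dots> = slot2 (mult_add_power m) (slot1 (mult_add_power l') (\<kappa>'' n))"
    by (simp only: slot1)
  finally have "diagonal (slot2 (mult_add_power m) (slot1 (mult_add_power l') (slot1 subst_add
      (slot2 subst_add (\<kappa> n)))))
    = diagonal (slot2 (mult_add_power m) (slot1 (mult_add_power l') (\<kappa>'' n)))" by simp
  then show ?thesis
    by (simp only: diagonal_mult_slot2[OF diagonal_finite_mult_slot1[OF fin]] diagonal_mult_slot1[OF
      fin]
        diagonal_mult_slot2[OF diagonal_finite_mult_slot1[OF fin'']] diagonal_mult_slot1[OF fin'']
        subst_add_diagonal[OF \<kappa>, symmetric] mult_add_power_add)
qed

section \<open>Replacing a third variable by x1 - x2\<close>

lemma gbinomial_subst_convolution: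
  "(\<Sum>r\<le>t. (of_int (a + int r) gchoose r) * ((-1) ^ (t - r) * (of_int m gchoose (t - r)))) =
    ((of_int (a - m + int t) :: complex) gchoose t)"
proof -
  \<comment> \<open>Reflecting the first binomial produces (-1)^r, which joins (-1)^(t - r) to a
    common sign and leaves a Vandermonde sum.\<close>
  have "(\<Sum>r\<le>t. (of_int (a + int r) gchoose r) * ((-1) ^ (t - r) * (of_int m gchoose (t - r)))) =
      (\<Sum>r\<le>t. (-1) ^ t * ((of_int (- a - 1) gchoose r) * (of_int m gchoose (t - r)) :: complex))"
  proof (rule sum.cong[OF refl])
    fix r assume "r \<in> {..t}"
    then have "(-1 :: complex) ^ t = (-1) ^ r * (-1) ^ (t - r)" by (simp flip: power_add)
    then show "(of_int (a + int r) gchoose r) * ((-1) ^ (t - r) * (of_int m gchoose (t - r))) =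
      (-1) ^ t * ((of_int (- a - 1) gchoose r) * (of_int m gchoose (t - r)) :: complex)"
      by (simp only: gbinomial_add_nat_reflect) (simp add: mult_ac)
  qed
  also have "\<dots> = (-1) ^ t * ((of_int (- a - 1) + of_int m :: complex) gchoose t)"
    using gbinomial_Vandermonde[of "of_int (- a - 1) :: complex" "of_int m" t]
    by (simp only: sum_distrib_left[symmetric] atLeast0AtMost)
  also have "of_int (- a - 1) + of_int m = (of_int (- (a - m) - 1) :: complex)" by simp
  finally show ?thesis by (simp only: gbinomial_add_nat_reflect)
qed

text \<open>From b - j \<ge> K follows j \<le> R, and then a - n + j \<ge> N bounds n from above. R
  and M may exceed these bounds, so that one box serves every term of an outer substitution.\<close>

lemma subst_diff_box:
  assumes K: "\<And>n a b. b < K \<Longrightarrow> G n a b = 0" and N0: "\<And>n a b. n < N0 \<Longrightarrow> G n a b = 0"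
    and N: "\<And>n a b'. b' \<le> b \<Longrightarrow> a < N \<Longrightarrow> G n a b' = 0"
    and R: "b - K \<le> int R" and M: "a - N + int R \<le> M"
  shows "subst_diff G a b = (\<Sum>n\<in>{N0..M}. \<Sum>j\<le>R.
    ((-1) ^ j * ((of_int n :: complex) gchoose j)) *\<^sub>C G n (a - n + int j) (b - int j))"
proof -
  have "n \<in> {N0..M} \<and> j \<in> {..R}" if nz: "G n (a - n + int j) (b - int j) \<noteq> 0" for n j
  proof -
    have "\<not> b - int j < K" "\<not> n < N0" "\<not> a - n + int j < N" using K N0 N nz by force+
    then show ?thesis using R M by auto
  qed
  then have "{p. (\<lambda>(n, j). ((-1) ^ j * ((of_int n :: complex) gchoose j)) *\<^sub>C
      G n (a - n + int j) (b - int j)) p \<noteq> 0} \<subseteq> {N0..M} \<times> {..R}" by fastforce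
  then show ?thesis
    unfolding subst_diff_def sum.cartesian_product by (intro Sum_any.expand_superset) simp_all
qed

text \<open>This is (x0 + x2) - x2 = x0: G(x1 - x2, x1, x2) at x1 = x0 + x2 equals G(x0, x0 + x2,
  x2). On coefficients it is \<open>gbinomial_subst_convolution\<close>, with t collecting the
  powers of x2 from both expansions.\<close>

lemma subst_add_subst_diff:
  assumes G: "laurent2 G" and N0: "\<And>n a b. n < N0 \<Longrightarrow> G n a b = 0"
  shows "subst_add (subst_diff G) a b = Sum_any (\<lambda>n. subst_add (G n) (a - n) b)"
proof -
  obtain K where K: "\<And>n a b. b < K \<Longrightarrow> G n a b = 0" using laurent2_bounds[OF G] by blast
  obtain N where N: "\<And>n a b'. b' \<le> b \<Longrightarrow> a < N \<Longrightarrow> G n a b' = 0" using laurent2_bounds_le[OF G] by blast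
  define R where "R = nat (b - K)"
  have R: "b - K \<le> int R" by (simp add: R_def)
  \<comment> \<open>One R accounts for the shift r of the outer substitution, the other for the
    range of j.\<close>
  define M where "M = a - N + 2 * int R"
  define D where "D n r j = ((of_int (a + int r) gchoose r) * ((-1) ^ j * ((of_int n :: complex)
      gchoose j))) *\<^sub>C
    G n (a - n + int r + int j) (b - int r - int j)" for n r j
  have diff0: "subst_diff G a b = 0" if "b < K" for a b
  proof -
    have "(\<lambda>(m, j). ((-1) ^ j * ((of_int m :: complex) gchoose j)) *\<^sub>C G m (a - m + int j) (b - int
        j)) = (\<lambda>_. 0)"
      using that by (auto simp: fun_eq_iff K)
    then show ?thesis by (simp add: subst_diff_def)
  qed
  have "subst_add (subst_diff G) a b =
      (\<Sum>r\<le>R. (of_int (a + int r) gchoose r) *\<^sub>C subst_diff G (a + int r) (b - int r))"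
    using diff0 R by (intro subst_add_atMost) auto
  also have "\<dots> = (\<Sum>r\<le>R. \<Sum>n\<in>{N0..M}. \<Sum>j\<le>R. D n r j)"
  proof (rule sum.cong[OF refl])
    fix r assume "r \<in> {..R}"
    then have "subst_diff G (a + int r) (b - int r) = (\<Sum>n\<in>{N0..M}. \<Sum>j\<le>R.
        ((-1) ^ j * ((of_int n :: complex) gchoose j)) *\<^sub>C G n (a + int r - n + int j) (b - int r -
            int j))"
      using R by (intro subst_diff_box[of K G N0 _ N] K N0 N) (auto simp: M_def)
    then show "(of_int (a + int r) gchoose r) *\<^sub>C subst_diff G (a + int r) (b - int r) =
        (\<Sum>n\<in>{N0..M}. \<Sum>j\<le>R. D n r j)"
      by (simp add: D_def cvec.scale_sum_right scaleC_scaleC algebra_simps)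
  qed
  also have "\<dots> = (\<Sum>n\<in>{N0..M}. \<Sum>r\<le>R. \<Sum>j\<le>R. D n r j)" by (rule sum.swap)
  also have "\<dots> = (\<Sum>n\<in>{N0..M}. subst_add (G n) (a - n) b)"
  proof (rule sum.cong[OF refl])
    fix n
    have "(\<Sum>r\<le>R. \<Sum>j\<le>R. D n r j) = (\<Sum>t\<le>R. \<Sum>r\<le>t. D n r (t - r))"
      using R by (intro sum_square_triangle) (simp add: D_def K)
    also have "\<dots> = (\<Sum>t\<le>R. (of_int (a - n + int t) gchoose t) *\<^sub>C G n (a - n + int t) (b - int t))"
    proof (rule sum.cong[OF refl])
      fix t
      have "D n r (t - r) = ((of_int (a + int r) gchoose r) * ((-1) ^ (t - r) * ((of_int n ::
          complex) gchoose (t - r)))) *\<^sub>C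
          G n (a - n + int t) (b - int t)" if "r \<le> t" for r
        using that by (simp add: D_def of_nat_diff algebra_simps)
      then have "(\<Sum>r\<le>t. D n r (t - r)) = (\<Sum>r\<le>t. ((of_int (a + int r) gchoose r) *
          ((-1) ^ (t - r) * ((of_int n :: complex) gchoose (t - r)))) *\<^sub>C G n (a - n + int t) (b -
              int t))"
        by (intro sum.cong refl) auto
      then show "(\<Sum>r\<le>t. D n r (t - r)) = (of_int (a - n + int t) gchoose t) *\<^sub>C G n (a - n +
          int t) (b - int t)"
        by (simp only: cvec.scale_sum_left[symmetric] gbinomial_subst_convolution)
    qed
    also have "\<dots> = subst_add (G n) (a - n) b"
      using K R by (intro subst_add_atMost[symmetric]) auto
    finally show "(\<Sum>r\<le>R. \<Sum>j\<le>R. D n r j) = subst_add (G n) (a - n) b" .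
  qed
  also have "\<dots> = Sum_any (\<lambda>n. subst_add (G n) (a - n) b)"
  proof (rule Sum_any.expand_superset[symmetric])
    have "n \<in> {N0..M}" if nz: "subst_add (G n) (a - n) b \<noteq> 0" for n
    proof -
      obtain r :: nat where r: "G n (a - n + int r) (b - int r) \<noteq> 0" by (rule subst_add_nonzero[OF nz])
      then have "\<not> n < N0" "\<not> b - int r < K" "\<not> a - n + int r < N"
        using K N0 N[of "b - int r" "a - n + int r" n] by (blast, blast, force)
      then show ?thesis using R by (auto simp: M_def)
    qed
    then show "{n. subst_add (G n) (a - n) b \<noteq> 0} \<subseteq> {N0..M}" by blast
  qed simp
  finally show ?thesis .
qed

lemma mult_add_power_Sum_any_shift:
  fixes F :: "int \<Rightarrow> int \<Rightarrow> int \<Rightarrow> 'a::complex_vector"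
  assumes "\<And>a b. finite {n. F n (a - n) b \<noteq> 0}"
  shows "finite {n. mult_add_power l (F n) (a - n) b \<noteq> 0}"
    and "mult_add_power l (\<lambda>a b. Sum_any (\<lambda>n. F n (a - n) b)) a b = Sum_any (\<lambda>n. mult_add_power l (F
        n) (a - n) b)"
proof -
  have "finite {n. mult_add_power l (F n) (a - n) b \<noteq> 0} \<and>
    mult_add_power l (\<lambda>a b. Sum_any (\<lambda>n. F n (a - n) b)) a b = Sum_any (\<lambda>n. mult_add_power l (F n)
        (a - n) b)" for a b
  proof (induction l arbitrary: a b)
    case 0
    show ?case using assms by (simp add: mult_add_power_0)
  next
    case (Suc l)
    have f1: "finite {n. mult_add_power l (F n) (a - n - 1) b \<noteq> 0}"
      using Suc[of "a - 1" b] by (simp add: algebra_simps)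
    have f2: "finite {n. mult_add_power l (F n) (a - n) (b - 1) \<noteq> 0}" using Suc[of a "b - 1"] by simp
    have "finite ({n. mult_add_power l (F n) (a - n - 1) b \<noteq> 0} \<union> {n. mult_add_power l (F n) (a - n)
        (b - 1) \<noteq> 0})"
      using f1 f2 by simp
    then have "finite {n. mult_add_power (Suc l) (F n) (a - n) b \<noteq> 0}"
      by (rule rev_finite_subset) (auto simp: mult_add_power_Suc)
    moreover have "mult_add_power (Suc l) (\<lambda>a b. Sum_any (\<lambda>n. F n (a - n) b)) a b =
        Sum_any (\<lambda>n. mult_add_power (Suc l) (F n) (a - n) b)"
      using Suc[of "a - 1" b] Suc[of a "b - 1"] Sum_any.distrib[OF f1 f2] 
      by (simp add: mult_add_power_Suc algebra_simps)
    ultimately show ?case by blast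
  qed
  then show "finite {n. mult_add_power l (F n) (a - n) b \<noteq> 0}"
    and "mult_add_power l (\<lambda>a b. Sum_any (\<lambda>n. F n (a - n) b)) a b = Sum_any (\<lambda>n. mult_add_power l (F
        n) (a - n) b)"
    by blast+
qed

text \<open>The two Laurent conditions, in opposite orders of the variables as for a product and an
  iterate, are carried along because substitution and diagonals are additive only for such series.
  The exponent is a separate argument so that uniform exponents can be stated.\<close>

definition weak_assoc_at :: "nat \<Rightarrow> (int \<Rightarrow> int \<Rightarrow> 'a::complex_vector) \<Rightarrow> (int \<Rightarrow> int \<Rightarrow> 'a) \<Rightarrow> bool"
  where "weak_assoc_at l F F' \<longleftrightarrow> laurent2 (\<lambda>_::unit. F) \<and> laurent2 (\<lambda>_::unit. \<lambda>a b. F' b a) \<and>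
    mult_add_power l (subst_add F) = mult_add_power l F'"

definition weak_assoc :: "(int \<Rightarrow> int \<Rightarrow> 'a::complex_vector) \<Rightarrow> (int \<Rightarrow> int \<Rightarrow> 'a) \<Rightarrow> bool"
  where "weak_assoc F F' \<longleftrightarrow> (\<exists>l. weak_assoc_at l F F')"

section \<open>Closure of the relation under sums, linear maps, products and the substitution of x1
  - x2\<close>

lemma weak_assoc_at_mono: "weak_assoc_at l F F' \<Longrightarrow> l \<le> l' \<Longrightarrow> weak_assoc_at l' F F'"
  unfolding weak_assoc_at_def using mult_add_power_mono by blast

lemma laurent2_add:
  assumes "laurent2 F" "laurent2 G"
  shows "laurent2 (\<lambda>n a b. F n a b + G n a b :: 'a::monoid_add)"
proof -
  obtain K where K: "\<And>n a b. b < K \<Longrightarrow> F n a b = 0" using assms(1) unfolding laurent2_def by blast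
  obtain L where L: "\<And>n a b. b < L \<Longrightarrow> G n a b = 0" using assms(2) unfolding laurent2_def by blast
  show ?thesis
  proof (rule laurent2I[of "min K L"])
    fix b
    obtain N where N: "\<And>n a b'. b' \<le> b \<Longrightarrow> a < N \<Longrightarrow> F n a b' = 0" using assms(1) unfolding laurent2_def
        by meson
    obtain N' where N': "\<And>n a b'. b' \<le> b \<Longrightarrow> a < N' \<Longrightarrow> G n a b' = 0" using assms(2)
        unfolding laurent2_def by meson
    show "\<exists>N. \<forall>n a. a < N \<longrightarrow> F n a b + G n a b = 0"
      by (rule exI[of _ "min N N'"]) (simp add: N N')
  qed (simp add: K L)
qed

lemma laurent2_map:
  assumes "laurent2 F" "\<phi> 0 = 0"
  shows "laurent2 (\<lambda>n a b. \<phi> (F n a b))"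
  using assms unfolding laurent2_def by metis

lemma weak_assoc_at_add:
  assumes "weak_assoc_at l F F'" "weak_assoc_at l G G'"
  shows "weak_assoc_at l (\<lambda>a b. F a b + G a b) (\<lambda>a b. F' a b + G' a b)"
proof -
  have F: "laurent2 (\<lambda>_::unit. F)" and G: "laurent2 (\<lambda>_::unit. G)"
    and F': "laurent2 (\<lambda>_::unit. \<lambda>a b. F' b a)" and G': "laurent2 (\<lambda>_::unit. \<lambda>a b. G' b a)"
    and k: "mult_add_power l (subst_add F) = mult_add_power l F'" "mult_add_power l (subst_add G) =
        mult_add_power l G'"
    using assms by (auto simp: weak_assoc_at_def)
  obtain K where K: "\<And>a b. b < K \<Longrightarrow> F a b = 0" using F unfolding laurent2_def by blast
  obtain L where L: "\<And>a b. b < L \<Longrightarrow> G a b = 0" using G unfolding laurent2_def by blast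
  have "subst_add (\<lambda>a b. F a b + G a b) = (\<lambda>a b. subst_add F a b + subst_add G a b)"
    by (intro ext subst_add_add_fun[of "min K L"]) (simp_all add: K L)
  then have "mult_add_power l (subst_add (\<lambda>a b. F a b + G a b)) = mult_add_power l (\<lambda>a b. F' a b +
      G' a b)"
    by (simp only:) (simp add: fun_eq_iff mult_add_power_add_fun k)
  then show ?thesis using laurent2_add[OF F G] laurent2_add[OF F' G'] by (auto simp: weak_assoc_at_def)
qed

lemma weak_assoc_add:
  assumes "weak_assoc F F'" "weak_assoc G G'"
  shows "weak_assoc (\<lambda>a b. F a b + G a b) (\<lambda>a b. F' a b + G' a b)"
proof -
  obtain l m where "weak_assoc_at l F F'" "weak_assoc_at m G G'" using assms
      by (auto simp: weak_assoc_def)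
  then have "weak_assoc_at (max l m) F F'" "weak_assoc_at (max l m) G G'"
    by (auto intro: weak_assoc_at_mono)
  then show ?thesis unfolding weak_assoc_def by (blast intro: weak_assoc_at_add)
qed

lemma weak_assoc_at_map:
  assumes "weak_assoc_at l F F'" and \<phi>: "clinear \<phi>"
  shows "weak_assoc_at l (\<lambda>a b. \<phi> (F a b)) (\<lambda>a b. \<phi> (F' a b))"
proof -
  have F: "laurent2 (\<lambda>_::unit. F)" and F': "laurent2 (\<lambda>_::unit. \<lambda>a b. F' b a)"
    and l: "mult_add_power l (subst_add F) = mult_add_power l F'"
    using assms by (auto simp: weak_assoc_at_def)
  obtain K where K: "\<And>a b. b < K \<Longrightarrow> F a b = 0" using F unfolding laurent2_def by blast
  have "subst_add (\<lambda>a b. \<phi> (F a b)) = (\<lambda>a b. \<phi> (subst_add F a b))"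
    by (intro ext subst_add_linear[OF \<phi>, of K] K)
  then have "mult_add_power l (subst_add (\<lambda>a b. \<phi> (F a b))) = mult_add_power l (\<lambda>a b. \<phi> (F' a b))"
    by (simp only:) (simp add: fun_eq_iff mult_add_power_linear[OF \<phi>] l)
  then show ?thesis
    using laurent2_map[of "\<lambda>_. F" \<phi>] laurent2_map[of "\<lambda>_ a b. F' b a" \<phi>] clinear_0[OF \<phi>] F F'
    by (auto simp: weak_assoc_at_def)
qed

lemma weak_assoc_map: "weak_assoc F F' \<Longrightarrow> clinear \<phi> \<Longrightarrow> weak_assoc (\<lambda>a b. \<phi> (F a b)) (\<lambda>a b. \<phi> (F' a b))"
  unfolding weak_assoc_def by (blast intro: weak_assoc_at_map)

lemma clinear_scaleC: "clinear (\<lambda>x. c *\<^sub>C x)"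
  by (rule clinearI) (simp_all add: scaleC_add_right scaleC_scaleC mult.commute)

lemma weak_assoc_at_0: "weak_assoc_at l (\<lambda>a b. 0) (\<lambda>a b. 0)"
  by (auto simp: weak_assoc_at_def laurent2_def subst_add_def)

lemma weak_assoc_0: "weak_assoc (\<lambda>a b. 0) (\<lambda>a b. 0)"
  unfolding weak_assoc_def by (blast intro: weak_assoc_at_0)

lemma weak_assoc_sum:
  assumes "\<And>x. x \<in> A \<Longrightarrow> weak_assoc (F x) (F' x)"
  shows "weak_assoc (\<lambda>a b. \<Sum>x\<in>A. F x a b) (\<lambda>a b. \<Sum>x\<in>A. F' x a b)"
  using assms by (induction A rule: infinite_finite_induct) (simp_all add: weak_assoc_0 weak_assoc_add)

text \<open>Only finitely many x and y occur in the representative of t, so a common exponent exists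
  whatever the dependence on x and y.\<close>

lemma weak_assoc_tensor_lift:
  assumes "\<And>x y. weak_assoc (F x y) (F' x y)"
  shows "weak_assoc (\<lambda>a b. tensor_lift (\<lambda>x y. F x y a b) t) (\<lambda>a b. tensor_lift (\<lambda>x y. F' x y a b) t)"
  unfolding tensor_lift_def Let_def
  by (intro weak_assoc_sum weak_assoc_map[OF _ clinear_scaleC] assms)

lemma tensor_lift_linear:
  "clinear \<phi> \<Longrightarrow> \<phi> (tensor_lift f t) = tensor_lift (\<lambda>x y. \<phi> (f x y)) t"
  by (simp add: tensor_lift_def Let_def clinear_sum clinear_scale)

lemma laurent4_bilinear:
  assumes \<beta>: "cbilinear \<beta>" and F: "laurent2 F" and G: "laurent2 G"
  shows "laurent4 (\<lambda>n i j k l. \<beta> (F n i j) (G n k l))"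
proof -
  note bl = cbilinearD[OF \<beta>]
  obtain K where K: "\<And>n a b. b < K \<Longrightarrow> F n a b = 0" using F unfolding laurent2_def by blast
  obtain L where L: "\<And>n a b. b < L \<Longrightarrow> G n a b = 0" using G unfolding laurent2_def by blast
  show ?thesis
  proof (rule laurent4I[of "min K L"])
    fix j l
    obtain N where N: "\<And>n a b'. b' \<le> j \<Longrightarrow> a < N \<Longrightarrow> F n a b' = 0" using F unfolding laurent2_def by meson
    obtain N' where N': "\<And>n a b'. b' \<le> l \<Longrightarrow> a < N' \<Longrightarrow> G n a b' = 0" using G unfolding laurent2_def
        by meson
    show "\<exists>N. \<forall>n i k. i < N \<or> k < N \<longrightarrow> \<beta> (F n i j) (G n k l) = 0"
      by (rule exI[of _ "min N N'"]) (auto simp: N N' bl)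
  qed (auto simp: K L bl)
qed

text \<open>For a genuine product the exponents of the two factors are automatically free of the
  other factor's indices. Applied to \<otimes>, this joins the \<open>V\<close>-component with the
  \<open>H\<close>-component.\<close>

lemma weak_assoc_diagonal_bilinear:
  assumes \<beta>: "cbilinear \<beta>" and F: "weak_assoc F F'" and G: "weak_assoc G G'"
  shows "weak_assoc (diagonal (\<lambda>i j k l. \<beta> (F i j) (G k l))) (diagonal (\<lambda>i j k l. \<beta> (F' i j) (G' k l)))"
proof -
  note bl = cbilinearD[OF \<beta>]
  have lin: "clinear (\<beta> x)" "clinear (\<lambda>x. \<beta> x y)" for x y using \<beta> by (auto simp: cbilinear_def)
  have L: "laurent2 (\<lambda>_::unit. F)" "laurent2 (\<lambda>_::unit. G)"
    and L': "laurent2 (\<lambda>_::unit. \<lambda>a b. F' b a)" "laurent2 (\<lambda>_::unit. \<lambda>a b. G' b a)"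
    using F G by (auto simp: weak_assoc_def weak_assoc_at_def)
  have \<kappa>: "laurent4 (\<lambda>(_::unit) i j k l. \<beta> (F i j) (G k l))"
    using laurent4_bilinear[OF \<beta> L] .
  have \<kappa>'': "laurent4 (\<lambda>(_::unit) i j k l. \<beta> (F' j i) (G' l k))"
    using laurent4_bilinear[OF \<beta> L'] .
  obtain l m where lm: "mult_add_power l (subst_add F) = mult_add_power l F'"
    "mult_add_power m (subst_add G) = mult_add_power m G'"
    using F G by (auto simp: weak_assoc_def weak_assoc_at_def)
  obtain K where K: "\<And>a b. b < K \<Longrightarrow> F a b = 0" using L(1) unfolding laurent2_def by blast
  obtain K' where K': "\<And>a b. b < K' \<Longrightarrow> G a b = 0" using L(2) unfolding laurent2_def by blast
  have "mult_add_power (l + m) (subst_add (diagonal (\<lambda>i j k l. \<beta> (F i j) (G k l)))) =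
      mult_add_power (l + m) (diagonal (\<lambda>i j k l. \<beta> (F' i j) (G' k l)))"
  proof (rule weak_assoc_diagonal[OF \<kappa> \<kappa>'', of K "\<lambda>_ i j k l. \<beta> (F i j) (G' k l)"])
    show "\<beta> (F i j) (G' k l) = 0" if "j < K" for i j k l using that by (simp add: K bl)
    show "mult_add_power m (subst_add (\<lambda>k l. \<beta> (F i j) (G k l))) = mult_add_power m (\<lambda>k l.
        \<beta> (F i j) (G' k l))" for i j
    proof -
      have "subst_add (\<lambda>k l. \<beta> (F i j) (G k l)) = (\<lambda>k l. \<beta> (F i j) (subst_add G k l))"
        by (intro ext subst_add_linear[OF lin(1), of K'] K')
      then show ?thesis by (simp only:) (simp add: fun_eq_iff mult_add_power_linear[OF lin(1)] lm)
    qed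
    show "mult_add_power l (subst_add (\<lambda>i j. \<beta> (F i j) (G' k l'))) = mult_add_power l (\<lambda>i j.
        \<beta> (F' i j) (G' k l'))" for k l'
    proof -
      have "subst_add (\<lambda>i j. \<beta> (F i j) (G' k l')) = (\<lambda>i j. \<beta> (subst_add F i j) (G' k l'))"
        by (intro ext subst_add_linear[OF lin(2), of K] K)
      then show ?thesis by (simp only:) (simp add: fun_eq_iff mult_add_power_linear[OF lin(2)] lm)
    qed
  qed
  moreover have "laurent2 (\<lambda>_::unit. diagonal (\<lambda>i j k l. \<beta> (F i j) (G k l)))"
    using laurent2_diagonal[OF \<kappa>] .
  moreover have "laurent2 (\<lambda>_::unit. \<lambda>a b. diagonal (\<lambda>i j k l. \<beta> (F' i j) (G' k l)) b a)"
    using laurent2_diagonal[OF \<kappa>''] by (simp only: diagonal_swap[of "\<lambda>i j k l. \<beta> (F' i j) (G' k l)",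
      symmetric])
  ultimately show ?thesis unfolding weak_assoc_def weak_assoc_at_def by blast
qed

lemma laurent2_subst_diff:
  assumes G: "laurent2 G" and N0: "\<And>n a b. n < N0 \<Longrightarrow> G n a b = 0"
  shows "laurent2 (\<lambda>_::unit. subst_diff G)"
proof -
  obtain K where K: "\<And>n a b. b < K \<Longrightarrow> G n a b = 0" using G unfolding laurent2_def by blast
  have nz: "\<exists>n j. G n (a - n + int j) (b - int j) \<noteq> 0" if "subst_diff G a b \<noteq> 0" for a b
  proof -
    obtain p where "(\<lambda>(n, j). ((-1) ^ j * ((of_int n :: complex) gchoose j)) *\<^sub>C
      G n (a - n + int j) (b - int j)) p \<noteq> 0"
      using \<open>subst_diff G a b \<noteq> 0\<close> unfolding subst_diff_def
        by (elim Sum_any.not_neutral_obtains_not_neutral)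
    then show ?thesis by (auto simp: case_prod_unfold)
  qed
  show ?thesis
  proof (rule laurent2I)
    fix a b assume b: "b < K"
    then have "G n (a - n + int j) (b - int j) = 0" for n j by (intro K) simp
    then show "subst_diff G a b = 0" using nz by blast
  next
    fix b
    obtain N where N: "\<And>n a b'. b' \<le> b \<Longrightarrow> a < N \<Longrightarrow> G n a b' = 0" using G unfolding laurent2_def by meson
    \<comment> \<open>The exponent a is n + (a - n + j) - j, and a nonzero term has n \<ge> N0, a -
      n + j \<ge> N and j \<le> b - K.\<close>
    have "subst_diff G a b = 0" if a: "a < N + N0 - \<bar>b - K\<bar>" for a
    proof (rule ccontr)
      assume "subst_diff G a b \<noteq> 0"
      then obtain n j where nj: "G n (a - n + int j) (b - int j) \<noteq> 0" using nz by blast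
      then have "\<not> n < N0" "\<not> b - int j < K" using K N0 by blast+
      then have "a - n + int j < N" using a by linarith
      then show False using N[of "b - int j" "a - n + int j" n] nj by simp
    qed
    then show "\<exists>N. \<forall>(n::unit) a. a < N \<longrightarrow> subst_diff G a b = 0" by blast
  qed
qed

text \<open>\<open>G(x\<^sub>0, x\<^sub>1, x\<^sub>2)\<close> at \<open>x\<^sub>0 = x\<^sub>1 - x\<^sub>2\<close> against \<open>G'(x\<^sub>0, x\<^sub>0, x\<^sub>2)\<close>.\<close>

lemma weak_assoc_subst_diff:
  assumes G: "laurent2 G" and G': "laurent2 (\<lambda>n a b. G' n b a)"
    and N0: "\<And>n a b. n < N0 \<Longrightarrow> G n a b = 0" "\<And>n a b. n < N0 \<Longrightarrow> G' n a b = 0"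
    and eq: "\<And>n. mult_add_power l (subst_add (G n)) = mult_add_power l (G' n)"
  shows "weak_assoc (subst_diff G) (\<lambda>a b. Sum_any (\<lambda>n. G' n (a - n) b))"
proof -
  obtain K where K: "\<And>n a b. a < K \<Longrightarrow> G' n a b = 0" using G' unfolding laurent2_def by blast
  have fin': "finite {n. G' n (a - n) b \<noteq> 0}" for a b
  proof (rule finite_subset)
    show "{n. G' n (a - n) b \<noteq> 0} \<subseteq> {N0..a - K}"
      using K N0(2) by (force simp: not_less[symmetric])
  qed simp
  have sG: "laurent2 (\<lambda>n. subst_add (G n))" by (rule laurent2_subst_add[OF G])
  have fin: "finite {n. subst_add (G n) (a - n) b \<noteq> 0}" for a b
  proof -
    obtain N where N: "\<And>n a b'. b' \<le> b \<Longrightarrow> a < N \<Longrightarrow> subst_add (G n) a b' = 0" using sG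
        unfolding laurent2_def by meson
    have "subst_add (G n) = (\<lambda>a b. 0)" if "n < N0" for n
      using N0(1) that by (simp add: subst_add_def fun_eq_iff)
    then have "{n. subst_add (G n) (a - n) b \<noteq> 0} \<subseteq> {N0..a - N}"
      using N by (force simp: not_less[symmetric])
    then show ?thesis by (rule finite_subset) simp
  qed
  have "mult_add_power l (subst_add (subst_diff G)) = mult_add_power l (\<lambda>a b. Sum_any (\<lambda>n.
      subst_add (G n) (a - n) b))"
    by (rule arg_cong[where f = "mult_add_power l"], intro ext subst_add_subst_diff[OF G, of N0] N0(1))
  \<comment> \<open>The exponent l does not depend on n, so multiplication by (x0 + x2)^l can be
    moved inside the sum over n.\<close>
  also have "\<dots> = mult_add_power l (\<lambda>a b. Sum_any (\<lambda>n. G' n (a - n) b))"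
    by (intro ext) (simp only: mult_add_power_Sum_any_shift(2)[of "\<lambda>n. subst_add (G n)", OF fin]
        mult_add_power_Sum_any_shift(2)[of G', OF fin'] eq)
  finally have *: "mult_add_power l (subst_add (subst_diff G)) = mult_add_power l (\<lambda>a b.
      Sum_any (\<lambda>n. G' n (a - n) b))" .
  have nz: "\<exists>n. G' n (a - n) b \<noteq> 0" if "Sum_any (\<lambda>n. G' n (a - n) b) \<noteq> 0" for a b
    using that by (auto elim!: Sum_any.not_neutral_obtains_not_neutral)
  have "laurent2 (\<lambda>_::unit. \<lambda>b a. Sum_any (\<lambda>n. G' n (a - n) b))"
  proof (rule laurent2I)
    fix a b assume "a < K + N0"
    then have "n < N0 \<or> a - n < K" for n by linarith
    then show "Sum_any (\<lambda>n. G' n (a - n) b) = 0" using nz K N0(2) by blast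
  next
    fix a
    obtain N where N: "\<And>n a' b. a' \<le> a - N0 \<Longrightarrow> b < N \<Longrightarrow> G' n a' b = 0" using G' unfolding laurent2_def
        by meson
    have "Sum_any (\<lambda>n. G' n (a - n) b) = 0" if "b < N" for b
    proof (rule ccontr)
      assume "Sum_any (\<lambda>n. G' n (a - n) b) \<noteq> 0"
      then obtain n where n: "G' n (a - n) b \<noteq> 0" using nz by blast
      then have "\<not> n < N0" using N0(2) by blast
      then show False using N[of "a - n" b n] that n by simp
    qed
    then show "\<exists>N. \<forall>(n::unit) b. b < N \<longrightarrow> Sum_any (\<lambda>n. G' n (a - n) b) = 0" by blast
  qed
  then show ?thesis
    using * laurent2_subst_diff[OF G N0(1)] unfolding weak_assoc_def weak_assoc_at_def by blast
qed

section \<open>Uniformity on finite-dimensional subspaces\<close>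

lemma clinear_compose: "clinear f \<Longrightarrow> clinear g \<Longrightarrow> clinear (\<lambda>x. g (f x))"
  by (rule clinearI) (simp_all add: clinear_add clinear_scale)

lemma clinear_fls_nth: "clinear (\<lambda>f. f $$ n)"
  by (rule clinearI) (simp_all add: scaleC_fls.rep_eq)

lemma cbilinear_clinear:
  assumes "cbilinear f"
  shows "clinear (f a)" "clinear (\<lambda>a. f a b)"
  using assms by (auto simp: cbilinear_def)

lemma cbilinear_clinear_nth:
  assumes "cbilinear Y"
  shows "clinear (\<lambda>v. Y u v $$ n)" "clinear (\<lambda>u. Y u v $$ n)"
  using clinear_compose[OF cbilinear_clinear(1)[OF assms] clinear_fls_nth]
    clinear_compose[OF cbilinear_clinear(2)[OF assms] clinear_fls_nth] by auto

lemma tensor_laurent_span: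
  assumes "f \<in> tensor_laurent"
  obtains S where "finite S" "\<And>n. f $$ n \<in> cvec.span S"
proof -
  have "\<exists>S. finite S \<and> (\<forall>n. f $$ n \<in> cvec.span S)"
    using assms unfolding tensor_laurent_def
  proof (induction rule: cvec.span_induct_alt)
    case base
    show ?case by (auto simp: cvec.span_zero)
  next
    case (step c x y)
    then obtain w g where x: "x = fls_vec w g" by auto
    obtain S where S: "finite S" "\<forall>n. y $$ n \<in> cvec.span S" using step by blast
    have "y $$ n \<in> cvec.span (insert w S)" "w \<in> cvec.span (insert w S)" for n
      using S(2) cvec.span_mono[of S "insert w S"] by (auto intro: cvec.span_base)
    then show ?case using S(1)
      by (intro exI[of _ "insert w S"]) (simp add: x scaleC_fls.rep_eq fls_vec_nth cvec.span_add
        cvec.span_scale)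
  qed
  then show ?thesis using that by blast
qed

text \<open>Monotonicity gives one l for the finitely many pairs of generators. The subspace
  conditions extend it to the span in the second argument, and then in the first.\<close>

lemma uniform_on_spans:
  fixes Q :: "nat \<Rightarrow> 'a::complex_vector \<Rightarrow> 'b::complex_vector \<Rightarrow> bool"
  assumes S: "finite S" and T: "finite T"
    and mono: "\<And>l l' v z. Q l v z \<Longrightarrow> l \<le> l' \<Longrightarrow> Q l' v z"
    and sub: "\<And>l v. cvec.subspace {z. Q l v z}" "\<And>l z. cvec.subspace {v. Q l v z}"
    and ex: "\<And>v z. \<exists>l. Q l v z"
  obtains l where "\<And>v z. v \<in> cvec.span S \<Longrightarrow> z \<in> cvec.span T \<Longrightarrow> Q l v z"
proof -
  obtain m where m: "\<And>v z. Q (m v z) v z" using ex by metis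
  \<comment> \<open>A sum bounds its terms and, unlike a maximum, is defined for an empty index
    set.\<close>
  define l where "l = (\<Sum>(v, z)\<in>S \<times> T. m v z)"
  have ST: "Q l v z" if "v \<in> S" "z \<in> T" for v z
  proof (rule mono[OF m])
    show "m v z \<le> l"
      using that member_le_sum[of "(v, z)" "S \<times> T" "\<lambda>(v, z). m v z"] S T by (simp add: l_def)
  qed
  have "Q l v z" if "v \<in> S" "z \<in> cvec.span T" for v z
    using cvec.span_minimal[of T "{z. Q l v z}", OF _ sub(1)] ST that by blast
  then have "Q l v z" if "v \<in> cvec.span S" "z \<in> cvec.span T" for v z
    using cvec.span_minimal[of S "{v. Q l v z}", OF _ sub(2)] that by blast
  then show ?thesis using that by blast
qed

section \<open>Vertex operators with arguments in finite-dimensional subspaces\<close>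

lemma laurent2_vo_product:
  assumes "cbilinear Y"
  shows "laurent2 (\<lambda>_::'p. vo_product Y u Y' v w)"
proof (rule laurent2I[of "fls_subdegree (Y' v w)"])
  fix b show "\<exists>N. \<forall>(n::'p) a. a < N \<longrightarrow> vo_product Y u Y' v w a b = 0"
    by (rule exI[of _ "fls_subdegree (Y u (Y' v w $$ b))"]) (simp add: vo_product_def)
qed (simp add: vo_product_def cbilinearD[OF assms])

lemma laurent2_vo_iterate:
  assumes "cbilinear Y"
  shows "laurent2 (\<lambda>(_::'p) a b. vo_iterate Y Y' u v w b a)"
proof (rule laurent2I[of "fls_subdegree (Y' u v)"])
  fix b show "\<exists>N. \<forall>(n::'p) a. a < N \<longrightarrow> vo_iterate Y Y' u v w b a = 0"
    by (rule exI[of _ "fls_subdegree (Y (Y' u v $$ b) w)"]) (simp add: vo_iterate_def)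
qed (simp add: vo_iterate_def cbilinearD[OF assms])

lemma weakly_associative_iff:
  assumes "cbilinear Y" "cbilinear Y\<^sub>W"
  shows "weakly_associative Y Y\<^sub>W \<longleftrightarrow> (\<forall>u v w. weak_assoc (vo_product Y\<^sub>W u Y\<^sub>W v w) (vo_iterate Y\<^sub>W Y u v
      w))"
  by (simp add: weakly_associative_def weak_assoc_def weak_assoc_at_def
      laurent2_vo_product[OF assms(2)] laurent2_vo_iterate[OF assms(2)])

text \<open>Vanishing below a bound and weak associativity with a given exponent are linear
  conditions in v and in z separately, so \<open>uniform_on_spans\<close> applies to each.\<close>

lemma (in nonlocal_vertex_algebra)
  assumes S: "finite S" and T: "finite T"
  shows uniform_product_bound: "\<exists>B. \<forall>v\<in>cvec.span S. \<forall>z\<in>cvec.span T. \<forall>b<B. Y v z $$ b = 0"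
    and uniform_product_bound2: "\<exists>A. \<forall>v\<in>cvec.span S. \<forall>z\<in>cvec.span T. \<forall>a<A. Y u (Y v z $$ b) $$ a = 0"
    and uniform_weak_assoc: "\<exists>l. \<forall>v\<in>cvec.span S. \<forall>z\<in>cvec.span T.
      weak_assoc_at l (vo_product Y u Y v z) (vo_iterate Y Y u v z)"
proof -
  note bl = cbilinearD[OF bilinear]
  note lin = cbilinear_clinear[OF bilinear] cbilinear_clinear_nth[OF bilinear]
  have forall: "cvec.subspace {x. \<forall>b<c. \<phi> b x = 0}" if "\<And>b. clinear (\<phi> b)" for \<phi> :: "int \<Rightarrow> 'v \<Rightarrow> 'v"
      and c
    using that unfolding cvec.subspace_def by (simp add: clinear_0 clinear_add clinear_scale)
  \<comment> \<open>Lower bounds are written as \<open>- int l\<close>, so that a larger l is a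
    weaker condition.\<close>
  obtain l where "\<And>v z. v \<in> cvec.span S \<Longrightarrow> z \<in> cvec.span T \<Longrightarrow> \<forall>b< - int l. Y v z $$ b = 0"
  proof (rule uniform_on_spans[OF S T, of "\<lambda>l v z. \<forall>b< - int l. Y v z $$ b = 0"])
    show "\<exists>l. \<forall>b< - int l. Y v z $$ b = 0" for v z
      by (rule exI[of _ "nat (- fls_subdegree (Y v z))"]) simp
  qed (use lin in \<open>auto intro: forall\<close>)
  then show "\<exists>B. \<forall>v\<in>cvec.span S. \<forall>z\<in>cvec.span T. \<forall>b<B. Y v z $$ b = 0" by blast
  obtain l where "\<And>v z. v \<in> cvec.span S \<Longrightarrow> z \<in> cvec.span T \<Longrightarrow> \<forall>a< - int l. Y u (Y v z $$ b) $$ a = 0"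
  proof (rule uniform_on_spans[OF S T, of "\<lambda>l v z. \<forall>a< - int l. Y u (Y v z $$ b) $$ a = 0"])
    show "\<exists>l. \<forall>a< - int l. Y u (Y v z $$ b) $$ a = 0" for v z
      by (rule exI[of _ "nat (- fls_subdegree (Y u (Y v z $$ b)))"]) simp
    show "cvec.subspace {z. \<forall>a< - int l. Y u (Y v z $$ b) $$ a = 0}" for l v
      by (rule forall) (rule clinear_compose[OF lin(3) lin(3)])
    show "cvec.subspace {v. \<forall>a< - int l. Y u (Y v z $$ b) $$ a = 0}" for l z
      by (rule forall) (rule clinear_compose[OF lin(4) lin(3)])
  qed auto
  then show "\<exists>A. \<forall>v\<in>cvec.span S. \<forall>z\<in>cvec.span T. \<forall>a<A. Y u (Y v z $$ b) $$ a = 0" by blast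
  let ?Q = "\<lambda>l v z. weak_assoc_at l (vo_product Y u Y v z) (vo_iterate Y Y u v z)"
  have eqs:
    "vo_product Y u Y v (x + y) = (\<lambda>a b. vo_product Y u Y v x a b + vo_product Y u Y v y a b)"
    "vo_iterate Y Y u v (x + y) = (\<lambda>a b. vo_iterate Y Y u v x a b + vo_iterate Y Y u v y a b)"
    "vo_product Y u Y (x + y) v = (\<lambda>a b. vo_product Y u Y x v a b + vo_product Y u Y y v a b)"
    "vo_iterate Y Y u (x + y) v = (\<lambda>a b. vo_iterate Y Y u x v a b + vo_iterate Y Y u y v a b)"
    "vo_product Y u Y v (c *\<^sub>C x) = (\<lambda>a b. c *\<^sub>C vo_product Y u Y v x a b)"
    "vo_iterate Y Y u v (c *\<^sub>C x) = (\<lambda>a b. c *\<^sub>C vo_iterate Y Y u v x a b)"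
    "vo_product Y u Y (c *\<^sub>C x) v = (\<lambda>a b. c *\<^sub>C vo_product Y u Y x v a b)"
    "vo_iterate Y Y u (c *\<^sub>C x) v = (\<lambda>a b. c *\<^sub>C vo_iterate Y Y u x v a b)"
    "vo_product Y u Y v 0 = (\<lambda>a b. 0)" "vo_iterate Y Y u v 0 = (\<lambda>a b. 0)"
    "vo_product Y u Y 0 v = (\<lambda>a b. 0)" "vo_iterate Y Y u 0 v = (\<lambda>a b. 0)" for v x y c
    by (simp_all add: fun_eq_iff vo_product_def vo_iterate_def bl scaleC_fls.rep_eq)
  obtain l where "\<And>v z. v \<in> cvec.span S \<Longrightarrow> z \<in> cvec.span T \<Longrightarrow> ?Q l v z"
  proof (rule uniform_on_spans[OF S T, of ?Q])
    show "\<exists>l. ?Q l v z" for v z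
      using weak_associativity weakly_associative_iff[OF bilinear bilinear]
        by (simp add: weak_assoc_def)
    show "cvec.subspace {z. ?Q l v z}" for l v
      unfolding cvec.subspace_def mem_Collect_eq eqs
      by (blast intro: weak_assoc_at_0 weak_assoc_at_add weak_assoc_at_map[OF _ clinear_scaleC])
    show "cvec.subspace {v. ?Q l v z}" for l z
      unfolding cvec.subspace_def mem_Collect_eq eqs
      by (blast intro: weak_assoc_at_0 weak_assoc_at_add weak_assoc_at_map[OF _ clinear_scaleC])
  qed (auto intro: weak_assoc_at_mono)
  then show "\<exists>l. \<forall>v\<in>cvec.span S. \<forall>z\<in>cvec.span T. ?Q l v z" by blast
qed

section \<open>The \<open>V\<close>-component of product and iterate, for fixed coproduct
  factors\<close>

context module_nonlocal_vertex_algebra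
begin

text \<open>
  The index \<open>n\<close> is the exponent of \<open>x\<^sub>1 - x\<^sub>2\<close> (of \<open>x\<^sub>0\<close> in the iterate), \<open>i\<close> and \<open>j\<close> are the exponents
  contributed by the action of \<open>H\<close>, and \<open>k'\<close> and \<open>l\<close> those contributed by the vertex operators of \<open>V\<close>.
\<close>

definition product_kernel where
  "product_kernel u v w h\<^sub>1 h\<^sub>2 k n i j k' l =
    Y\<^sub>V u (Y\<^sub>V (Y\<^sub>M h\<^sub>1 v $$ n) (Y\<^sub>M h\<^sub>2 (Y\<^sub>M k w $$ j) $$ i) $$ l) $$ k'"

definition iterate_kernel where
  "iterate_kernel u v w h\<^sub>1 h\<^sub>2 k n i j k' l =
    Y\<^sub>V (Y\<^sub>V u (Y\<^sub>M h\<^sub>1 v $$ n) $$ k') (Y\<^sub>M (Y\<^sub>H h\<^sub>2 k $$ i) w $$ j) $$ l"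

text \<open>Y(k, x)w has coefficients in the span of finitely many vectors, each of which has the
  same property under h; linearity of the action covers the rest of the span.\<close>

lemma action_iterated_span:
  obtains T where "finite T" "\<And>p q. Y\<^sub>M h (Y\<^sub>M k w $$ p) $$ q \<in> cvec.span T"
proof -
  obtain S where S: "finite S" "\<And>n. Y\<^sub>M k w $$ n \<in> cvec.span S"
    using tensor_laurent_span[OF action_tensor_laurent] by blast
  have "\<exists>T. finite T \<and> (\<forall>n. Y\<^sub>M h s $$ n \<in> cvec.span T)" for s
    using tensor_laurent_span[OF action_tensor_laurent[of h s]] by metis
  then obtain T where T: "\<And>s. finite (T s)" "\<And>s n. Y\<^sub>M h s $$ n \<in> cvec.span (T s)" by metis
  let ?T = "\<Union>s\<in>S. T s"
  have "cvec.span S \<subseteq> {z. \<forall>q. Y\<^sub>M h z $$ q \<in> cvec.span ?T}"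
  proof (rule cvec.span_minimal)
    show "S \<subseteq> {z. \<forall>q. Y\<^sub>M h z $$ q \<in> cvec.span ?T}"
      using T(2) cvec.span_mono[of "T _" ?T] by blast
    show "cvec.subspace {z. \<forall>q. Y\<^sub>M h z $$ q \<in> cvec.span ?T}"
      unfolding cvec.subspace_def
      by (simp add: cbilinearD[OF M.module_bilinear] scaleC_fls.rep_eq cvec.span_zero cvec.span_add
        cvec.span_scale)
  qed
  then show ?thesis using that[of ?T] S T(1) by blast
qed

text \<open>The arguments of the operators of \<open>V\<close> stay in two finite-dimensional
  spaces, whatever n, i and j are. Hence the bounds hold for all n at once, as the later summation
  over n demands.\<close>

lemma laurent4_product_kernel: "laurent4 (product_kernel u v w h\<^sub>1 h\<^sub>2 k)"
proof -
  note bl = cbilinearD[OF V.bilinear] cbilinearD[OF M.module_bilinear]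
  obtain S where S: "finite S" "\<And>n. Y\<^sub>M h\<^sub>1 v $$ n \<in> cvec.span S"
    using tensor_laurent_span[OF action_tensor_laurent] by blast
  obtain T where T: "finite T" "\<And>p q. Y\<^sub>M h\<^sub>2 (Y\<^sub>M k w $$ p) $$ q \<in> cvec.span T"
    using action_iterated_span by blast
  obtain B where B: "\<forall>v\<in>cvec.span S. \<forall>z\<in>cvec.span T. \<forall>b<B. Y\<^sub>V v z $$ b = 0"
    using V.uniform_product_bound[OF S(1) T(1)] by blast
  show ?thesis
  proof (rule laurent4I[of "min B (fls_subdegree (Y\<^sub>M k w))"])
    show "product_kernel u v w h\<^sub>1 h\<^sub>2 k n i j k' l = 0"
        if "j < min B (fls_subdegree (Y\<^sub>M k w)) \<or> l < min B (fls_subdegree (Y\<^sub>M k w))" for n i j k' l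
      using that B S(2) T(2) by (auto simp: product_kernel_def bl)
    fix j l
    obtain A where A: "\<forall>v\<in>cvec.span S. \<forall>z\<in>cvec.span T. \<forall>a<A. Y\<^sub>V u (Y\<^sub>V v z $$ l) $$ a = 0"
      using V.uniform_product_bound2[OF S(1) T(1)] by blast
    show "\<exists>N. \<forall>n i k'. i < N \<or> k' < N \<longrightarrow> product_kernel u v w h\<^sub>1 h\<^sub>2 k n i j k' l = 0"
      using A S(2) T(2)
      by (intro exI[of _ "min A (fls_subdegree (Y\<^sub>M h\<^sub>2 (Y\<^sub>M k w $$ j)))"]) (auto simp:
        product_kernel_def bl)
  qed
qed

text \<open>The x0 exponents, the arguments \<open>i\<close> and \<open>k'\<close> of
  \<open>iterate_kernel\<close>, are bounded first and the x2 exponents afterwards, hence the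
  exchanged arguments. A fixed coefficient of Y(u, x0) maps the span of \<open>S\<close> onto
  another finite-dimensional space, where the uniform bound applies again.\<close>

lemma laurent4_iterate_kernel: "laurent4 (\<lambda>n i j k' l. iterate_kernel u v w h\<^sub>1 h\<^sub>2 k n j i l k')"
proof -
  note bl = cbilinearD[OF V.bilinear] cbilinearD[OF M.module_bilinear]
  have lin: "clinear (\<lambda>x. Y\<^sub>V u x $$ n)" "clinear (Y\<^sub>V u)" for u n
    using cbilinear_clinear_nth[OF V.bilinear] cbilinear_clinear[OF V.bilinear] by auto
  obtain S where S: "finite S" "\<And>n. Y\<^sub>M h\<^sub>1 v $$ n \<in> cvec.span S"
    using tensor_laurent_span[OF action_tensor_laurent] by blast
  obtain B where B: "\<forall>m n. n < B \<longrightarrow> Y\<^sub>V u (Y\<^sub>M h\<^sub>1 v $$ m) $$ n = 0"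
    using tensor_laurent_bounded[OF action_tensor_laurent lin(2)] by blast
  show ?thesis
  proof (rule laurent4I[of "min B (fls_subdegree (Y\<^sub>H h\<^sub>2 k))"])
    show "iterate_kernel u v w h\<^sub>1 h\<^sub>2 k n j i l k' = 0" if "j < min B (fls_subdegree (Y\<^sub>H h\<^sub>2 k)) \<or> l <
        min B (fls_subdegree (Y\<^sub>H h\<^sub>2 k))" for n i j k' l
      using that B by (auto simp: iterate_kernel_def bl)
    fix j l
    obtain T where T: "finite T" "\<And>n. Y\<^sub>M (Y\<^sub>H h\<^sub>2 k $$ j) w $$ n \<in> cvec.span T"
      using tensor_laurent_span[OF action_tensor_laurent] by blast
    let ?S = "(\<lambda>x. Y\<^sub>V u x $$ l) ` S"
    have S': "Y\<^sub>V u (Y\<^sub>M h\<^sub>1 v $$ n) $$ l \<in> cvec.span ?S" for n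
    proof -
      have "cvec.span S \<subseteq> {x. Y\<^sub>V u x $$ l \<in> cvec.span ?S}"
        by (rule cvec.span_minimal)
          (auto simp: cvec.subspace_def clinear_0[OF lin(1)] clinear_add[OF lin(1)] clinear_scale[OF
              lin(1)]
            cvec.span_zero cvec.span_add cvec.span_scale intro: cvec.span_base)
      then show ?thesis using S(2) by blast
    qed
    obtain A where A: "\<forall>v\<in>cvec.span ?S. \<forall>z\<in>cvec.span T. \<forall>b<A. Y\<^sub>V v z $$ b = 0"
      using V.uniform_product_bound[OF _ T(1), of ?S] S(1) by blast
    show "\<exists>N. \<forall>n i k'. i < N \<or> k' < N \<longrightarrow> iterate_kernel u v w h\<^sub>1 h\<^sub>2 k n j i l k' = 0"
      using A S' T(2)
      by (intro exI[of _ "min A (fls_subdegree (Y\<^sub>M (Y\<^sub>H h\<^sub>2 k $$ j) w))"]) (auto simp: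
        iterate_kernel_def bl)
  qed
qed

text \<open>For each n the operators of \<open>V\<close> and the action are exchanged with exponents
  m and l that are free of n. The sum over n can then be taken last: it inserts x1 - x2 on the
  product side and x0 on the iterate side.\<close>

lemma weak_assoc_kernels:
  "weak_assoc (subst_diff (\<lambda>n. diagonal (product_kernel u v w h\<^sub>1 h\<^sub>2 k n)))
    (\<lambda>a b. Sum_any (\<lambda>n. diagonal (iterate_kernel u v w h\<^sub>1 h\<^sub>2 k n) (a - n) b))"
proof -
  note bl = cbilinearD[OF V.bilinear] cbilinearD[OF M.module_bilinear]
  note linV = cbilinear_clinear_nth[OF V.bilinear]
  obtain S where S: "finite S" "\<And>n. Y\<^sub>M h\<^sub>1 v $$ n \<in> cvec.span S"
    using tensor_laurent_span[OF action_tensor_laurent] by blast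
  obtain T where T: "finite T" "\<And>p q. Y\<^sub>M h\<^sub>2 (Y\<^sub>M k w $$ p) $$ q \<in> cvec.span T"
    using action_iterated_span by blast
  obtain m where m: "\<forall>v\<in>cvec.span S. \<forall>z\<in>cvec.span T. weak_assoc_at m (vo_product Y\<^sub>V u Y\<^sub>V v z)
      (vo_iterate Y\<^sub>V Y\<^sub>V u v z)"
    using V.uniform_weak_assoc[OF S(1) T(1)] by blast
  obtain l where l: "mult_add_power l (subst_add (vo_product Y\<^sub>M h\<^sub>2 Y\<^sub>M k w)) =
      mult_add_power l (vo_iterate Y\<^sub>M Y\<^sub>H h\<^sub>2 k w)"
    using M.module_weak_associativity unfolding weakly_associative_def by blast
  \<comment> \<open>The operators of \<open>V\<close> are exchanged first: before the action is exchanged, their arguments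
    run through finite-dimensional spaces, so that a single exponent suffices.\<close>
  define \<kappa>' where "\<kappa>' n i j k' l = Y\<^sub>V (Y\<^sub>V u (Y\<^sub>M h\<^sub>1 v $$ n) $$ k') (Y\<^sub>M h\<^sub>2 (Y\<^sub>M k w $$ j) $$ i) $$ l"
    for n i j k' l
  let ?K = "fls_subdegree (Y\<^sub>M k w)"
  have eq: "mult_add_power (l + m) (subst_add (diagonal (product_kernel u v w h\<^sub>1 h\<^sub>2 k n))) =
      mult_add_power (l + m) (diagonal (iterate_kernel u v w h\<^sub>1 h\<^sub>2 k n))" for n
  proof (rule weak_assoc_diagonal[OF laurent4_product_kernel laurent4_iterate_kernel, of ?K \<kappa>'])
    show "\<kappa>' n i j k' l = 0" if "j < ?K" for n i j k' l
      using that by (simp add: \<kappa>'_def bl)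
    show "mult_add_power m (subst_add (product_kernel u v w h\<^sub>1 h\<^sub>2 k n i j)) =
        mult_add_power m (\<kappa>' n i j)" for n i j
      using m S(2)[of n] T(2)[of j i]
      by (simp add: weak_assoc_at_def product_kernel_def[abs_def] \<kappa>'_def[abs_def] vo_product_def
        vo_iterate_def)
    show "mult_add_power l (subst_add (\<lambda>i j. \<kappa>' n i j k' l')) =
      mult_add_power l (\<lambda>i j. iterate_kernel u v w h\<^sub>1 h\<^sub>2 k n i j k' l')" for n k' l'
    proof -
      define \<phi> where "\<phi> z = Y\<^sub>V (Y\<^sub>V u (Y\<^sub>M h\<^sub>1 v $$ n) $$ k') z $$ l'" for z
      have \<phi>: "clinear \<phi>" unfolding \<phi>_def by (rule linV(1))
      have "subst_add (\<lambda>i j. \<kappa>' n i j k' l') = (\<lambda>a b. \<phi> (subst_add (vo_product Y\<^sub>M h\<^sub>2 Y\<^sub>M k w) a b))"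
        unfolding \<kappa>'_def \<phi>_def[symmetric]
        by (intro ext, subst subst_add_linear[OF \<phi>, of ?K, symmetric]) (simp_all add: vo_product_def bl)
      then have "mult_add_power l (subst_add (\<lambda>i j. \<kappa>' n i j k' l')) =
          (\<lambda>a b. \<phi> (mult_add_power l (vo_iterate Y\<^sub>M Y\<^sub>H h\<^sub>2 k w) a b))"
        by (simp only:) (simp add: fun_eq_iff mult_add_power_linear[OF \<phi>] l)
      also have "\<dots> = mult_add_power l (\<lambda>i j. iterate_kernel u v w h\<^sub>1 h\<^sub>2 k n i j k' l')"
        unfolding iterate_kernel_def \<phi>_def[symmetric]
        by (simp add: fun_eq_iff mult_add_power_linear[OF \<phi>, symmetric] vo_iterate_def)
      finally show ?thesis .
    qed
  qed
  show ?thesis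
  proof (rule weak_assoc_subst_diff[of _ _ "fls_subdegree (Y\<^sub>M h\<^sub>1 v)", OF _ _ _ _ eq])
    show "laurent2 (\<lambda>n. diagonal (product_kernel u v w h\<^sub>1 h\<^sub>2 k n))"
      by (rule laurent2_diagonal[OF laurent4_product_kernel])
    have "(\<lambda>n a b. diagonal (iterate_kernel u v w h\<^sub>1 h\<^sub>2 k n) b a) =
        (\<lambda>n. diagonal (\<lambda>i j k' l. iterate_kernel u v w h\<^sub>1 h\<^sub>2 k n j i l k'))"
      by (intro ext) (rule diagonal_swap[symmetric])
    then show "laurent2 (\<lambda>n a b. diagonal (iterate_kernel u v w h\<^sub>1 h\<^sub>2 k n) b a)"
      using laurent2_diagonal[OF laurent4_iterate_kernel, of u v w h\<^sub>1 h\<^sub>2 k] by simp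
    show "diagonal (product_kernel u v w h\<^sub>1 h\<^sub>2 k n) a b = 0" if "n < fls_subdegree (Y\<^sub>M h\<^sub>1 v)" for n a b
      using that by (simp add: diagonal_def product_kernel_def bl)
    show "diagonal (iterate_kernel u v w h\<^sub>1 h\<^sub>2 k n) a b = 0" if "n < fls_subdegree (Y\<^sub>M h\<^sub>1 v)" for n a b
      using that by (simp add: diagonal_def iterate_kernel_def bl)
  qed
qed

end

section \<open>Rearranging finite sums over exponents and over coproduct terms\<close>

lemma Sum_any_nested_reindex:
  fixes T :: "'a \<Rightarrow> 'b \<Rightarrow> 'e::comm_monoid_add" and U :: "'c \<Rightarrow> 'd \<Rightarrow> 'e"
  assumes fin: "finite {(a, b). T a b \<noteq> 0}"
    and h: "\<And>x. h' (h x) = x" "\<And>y. h (h' y) = y"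
    and U: "\<And>c d. U c d = T (fst (h (c, d))) (snd (h (c, d)))"
  shows "Sum_any (\<lambda>a. Sum_any (T a)) = Sum_any (\<lambda>c. Sum_any (U c))"
proof -
  have "{(c, d). U c d \<noteq> 0} \<subseteq> h' ` {(a, b). T a b \<noteq> 0}"
  proof safe
    fix c d assume "U c d \<noteq> 0"
    then show "(c, d) \<in> h' ` {(a, b). T a b \<noteq> 0}"
      by (intro image_eqI[of _ _ "h (c, d)"]) (auto simp: h U case_prod_unfold)
  qed
  then have fin': "finite {(c, d). U c d \<noteq> 0}" using fin finite_surj by blast
  have "Sum_any (\<lambda>a. Sum_any (T a)) = Sum_any (\<lambda>(a, b). T a b)" by (rule Sum_any_Sigma[OF fin])
  also have "\<dots> = Sum_any (\<lambda>x. case h x of (a, b) \<Rightarrow> T a b)" by (rule Sum_any_reindex[OF h])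
  also have "\<dots> = Sum_any (\<lambda>(c, d). U c d)" by (simp add: U case_prod_unfold)
  also have "\<dots> = Sum_any (\<lambda>c. Sum_any (U c))" by (rule Sum_any_Sigma[OF fin', symmetric])
  finally show ?thesis .
qed

lemma
  fixes R :: "'a::complex_vector \<Rightarrow> 'b::complex_vector \<Rightarrow> 'z \<Rightarrow> 'c::complex_vector"
  assumes "\<And>x y. finite {z. R x y z \<noteq> 0}"
  shows finite_tensor_lift_support: "finite {z. tensor_lift (\<lambda>x y. R x y z) t \<noteq> 0}"
    and tensor_lift_Sum_any: "tensor_lift (\<lambda>x y. Sum_any (R x y)) t =
        Sum_any (\<lambda>z. tensor_lift (\<lambda>x y. R x y z) t)"
proof -
  have fin: "finite {z. c *\<^sub>C R x y z \<noteq> 0}" for c x y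
    using assms by (rule rev_finite_subset) auto
  show "finite {z. tensor_lift (\<lambda>x y. R x y z) t \<noteq> 0}"
    unfolding tensor_lift_def Let_def by (rule finite_sum_support) (simp_all add: fin del:
      cvec.scale_eq_0_iff)
  show "tensor_lift (\<lambda>x y. Sum_any (R x y)) t = Sum_any (\<lambda>z. tensor_lift (\<lambda>x y. R x y z) t)"
    unfolding tensor_lift_def Let_def
    by (subst Sum_any_sum) (simp_all add: fin Sum_any_scaleC del: cvec.scale_eq_0_iff)
qed

section \<open>Coefficients of the \<open>V\<close>-component, before the kernels are
  separated\<close>

context module_nonlocal_vertex_algebra
begin

text \<open>Multiplying by Y(u, x1) on the left and by Y(k, x2)w on the right commutes with
  inserting x1 - x2, because the indices q', p', n and j of the nonzero terms lie in one finite
  box.\<close>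

lemma
  fixes p q
  defines "R \<equiv> \<lambda>u v w h\<^sub>1 h\<^sub>2 k (q', p'). Y\<^sub>V u (twisted_product Y\<^sub>V id Y\<^sub>M h\<^sub>1 v Y\<^sub>M h\<^sub>2 (Y\<^sub>M k w $$ p') q'
      (p - p')) $$ (q - q')"
  shows finite_twisted_action: "finite {x. R u v w h\<^sub>1 h\<^sub>2 k x \<noteq> 0}"
    and Sum_any_twisted_action: "Sum_any (R u v w h\<^sub>1 h\<^sub>2 k) =
      subst_diff (\<lambda>n. diagonal (product_kernel u v w h\<^sub>1 h\<^sub>2 k n)) q p"
proof -
  let ?f = "Y\<^sub>M h\<^sub>1 v" and ?g = "Y\<^sub>M k w" and ?pk = "product_kernel u v w h\<^sub>1 h\<^sub>2 k"
  define c :: "int \<Rightarrow> nat \<Rightarrow> complex" where "c n j = (-1) ^ j * (of_int n gchoose j)" for n j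
  define T where "T = (\<lambda>(q', p') (n, j). c n j *\<^sub>C ?pk n (q' - n + int j) p' (q - q') (p - p' - int j))"
  obtain K where K: "\<And>n i j k l. j < K \<or> l < K \<Longrightarrow> ?pk n i j k l = 0"
    using laurent4_bounds[OF laurent4_product_kernel[of u v w h\<^sub>1 h\<^sub>2 k]] by blast
  obtain N where N: "\<And>n i j k l. j \<le> p - K \<Longrightarrow> l \<le> p - K \<Longrightarrow> i < N \<or> k < N \<Longrightarrow> ?pk n i j k l = 0"
    using laurent4_bounds_le[OF laurent4_product_kernel[of u v w h\<^sub>1 h\<^sub>2 k], of "p - K"] by blast
  let ?N0 = "fls_subdegree ?f" and ?J = "p - 2 * K"
  have N0: "?pk n i j k l = 0" if "n < ?N0" for n i j k l
    using that by (simp add: product_kernel_def cbilinearD[OF V.bilinear])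
  \<comment> \<open>From K \<le> p' and K \<le> p - p' - j follows j \<le> p - 2K; the lower bound N
    on the two x1 exponents then confines q' and n.\<close>
  have fin: "finite {(x, y). T x y \<noteq> 0}"
  proof (rule finite_subset)
    have "q' \<in> {N + ?N0 - ?J..q - N} \<and> p' \<in> {K..p - K} \<and> n \<in> {?N0..q - 2 * N + ?J} \<and> j \<in> {..nat ?J}"
      if nz: "?pk n (q' - n + int j) p' (q - q') (p - p' - int j) \<noteq> 0" for q' p' n j
    proof -
      have 1: "\<not> p' < K" "\<not> p - p' - int j < K" "\<not> n < ?N0" using nz K N0 by blast+
      then have "p' \<le> p - K" "p - p' - int j \<le> p - K" by linarith+
      then have "\<not> q' - n + int j < N" "\<not> q - q' < N" using nz N by blast+
      with 1 show ?thesis by auto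
    qed
    then show "{(x, y). T x y \<noteq> 0} \<subseteq>
        ({N + ?N0 - ?J..q - N} \<times> {K..p - K}) \<times> ({?N0..q - 2 * N + ?J} \<times> {..nat ?J})"
      unfolding T_def by fastforce
  qed simp
  have R: "R u v w h\<^sub>1 h\<^sub>2 k x = Sum_any (T x)" for x
  proof -
    obtain q' p' where x: "x = (q', p')" by fastforce
    obtain N M K where "\<forall>m a b. m < N \<or> a < M \<or> b < K \<longrightarrow> Y\<^sub>V (?f $$ m) (Y\<^sub>M h\<^sub>2 (?g $$ p') $$ a) $$ b = 0"
      using twisted_product_bounded by blast
    then have bd: "m < N \<or> a < M \<or> b < K \<Longrightarrow> Y\<^sub>V (?f $$ m) (Y\<^sub>M h\<^sub>2 (?g $$ p') $$ a) $$ b = 0" for m a b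
      by blast
    have fin: "finite {z. (\<lambda>(n, j). c n j *\<^sub>C (Y\<^sub>V (?f $$ n) (Y\<^sub>M h\<^sub>2 (?g $$ p') $$ (q' - n +
        int j)) $$ (p - p' - int j))) z \<noteq> 0}"
      using subst_diff_finite[where c = c and a = q' and b = "p - p'", OF bd]
        by (simp only: case_prod_unfold Collect_case_prod)
    have \<phi>: "clinear (\<lambda>z. Y\<^sub>V u z $$ (q - q'))" by (rule cbilinear_clinear_nth(1)[OF V.bilinear])
    show ?thesis
      unfolding R_def x prod.case twisted_product_def subst_diff_def id_apply c_def[symmetric]
        clinear_Sum_any[OF \<phi> fin]
      by (simp add: T_def product_kernel_def case_prod_unfold clinear_scale[OF \<phi>])
  qed
  show "finite {x. R u v w h\<^sub>1 h\<^sub>2 k x \<noteq> 0}"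
  proof (rule finite_subset)
    show "{x. R u v w h\<^sub>1 h\<^sub>2 k x \<noteq> 0} \<subseteq> fst ` {(x, y). T x y \<noteq> 0}"
    proof
      fix x assume "x \<in> {x. R u v w h\<^sub>1 h\<^sub>2 k x \<noteq> 0}"
      then have "Sum_any (T x) \<noteq> 0" by (simp add: R)
      then obtain y where "T x y \<noteq> 0" by (rule Sum_any.not_neutral_obtains_not_neutral)
      then show "x \<in> fst ` {(x, y). T x y \<noteq> 0}" by (intro image_eqI[of _ _ "(x, y)"]) auto
    qed
  qed (use fin in blast)
  have "Sum_any (R u v w h\<^sub>1 h\<^sub>2 k) = Sum_any (\<lambda>x. Sum_any (T x))"
    by (rule Sum_any.cong) (rule R)
  \<comment> \<open>The new index \<alpha> = q' - n + j is the x1 exponent belonging to the action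
    of h2.\<close>
  also have "\<dots> = Sum_any (\<lambda>y. Sum_any (\<lambda>z. c (fst y) (snd y) *\<^sub>C (case z of (\<alpha>, p') \<Rightarrow>
      ?pk (fst y) \<alpha> p' (q - fst y + int (snd y) - \<alpha>) (p - int (snd y) - p'))))"
    by (rule Sum_any_nested_reindex[OF fin, of
        "\<lambda>(x, y). (y, (fst x - fst y + int (snd y), snd x))"
        "\<lambda>(y, z). ((fst z + fst y - int (snd y), snd z), y)"])
      (auto simp: T_def case_prod_unfold algebra_simps)
  also have "\<dots> = subst_diff (\<lambda>n. diagonal (?pk n)) q p"
    by (simp add: subst_diff_def c_def[symmetric] diagonal_def Sum_any_scaleC case_prod_unfold)
  finally show "Sum_any (R u v w h\<^sub>1 h\<^sub>2 k) = subst_diff (\<lambda>n. diagonal (?pk n)) q p" .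
qed

text \<open>The action axiom moves h past Y(v, x2) in each coefficient; the sums that distribute
  exponents over operators in the same variable are those of the diagonal.\<close>

lemma product_coefficient:
  "fls_extend (Y\<^sub>V u) (Y\<^sub>M h (fls_extend (Y\<^sub>V v) (Y\<^sub>M k w) $$ p)) $$ q =
    tensor_lift (\<lambda>h\<^sub>1 h\<^sub>2. subst_diff (\<lambda>n. diagonal (product_kernel u v w h\<^sub>1 h\<^sub>2 k n)) q p) (\<Delta> h)"
proof -
  note lin = cbilinear_clinear[OF V.bilinear] cbilinear_clinear_nth[OF V.bilinear]
      cbilinear_clinear_nth[OF M.module_bilinear]
  define R where "R h\<^sub>1 h\<^sub>2 = (\<lambda>(q', p'). Y\<^sub>V u (twisted_product Y\<^sub>V id Y\<^sub>M h\<^sub>1 v Y\<^sub>M h\<^sub>2 (Y\<^sub>M k w $$ p') q'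
      (p - p')) $$ (q - q'))"
    for h\<^sub>1 h\<^sub>2
  have fin: "finite {x. R h\<^sub>1 h\<^sub>2 x \<noteq> 0}" for h\<^sub>1 h\<^sub>2
    unfolding R_def by (rule finite_twisted_action)
  have eq: "Sum_any (R h\<^sub>1 h\<^sub>2) = subst_diff (\<lambda>n. diagonal (product_kernel u v w h\<^sub>1 h\<^sub>2 k n)) q p"
      for h\<^sub>1 h\<^sub>2
    unfolding R_def by (rule Sum_any_twisted_action)
  have "fls_extend (Y\<^sub>V u) (Y\<^sub>M h (fls_extend (Y\<^sub>V v) (Y\<^sub>M k w) $$ p)) $$ q =
      Sum_any (\<lambda>q'. Y\<^sub>V u (Y\<^sub>M h (fls_extend (Y\<^sub>V v) (Y\<^sub>M k w) $$ p) $$ q') $$ (q - q'))"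
    by (rule fls_extend_nth[OF action_tensor_laurent lin(1)])
  also have "\<dots> = Sum_any (\<lambda>q'. Sum_any (\<lambda>p'. tensor_lift (\<lambda>h\<^sub>1 h\<^sub>2. R h\<^sub>1 h\<^sub>2 (q', p')) (\<Delta> h)))"
  proof (rule Sum_any.cong)
    fix q'
    have \<phi>: "clinear (\<lambda>z. Y\<^sub>V u (Y\<^sub>M h z $$ q') $$ (q - q'))"
      by (rule clinear_compose[OF lin(5) lin(3)])
    have "Y\<^sub>V u (Y\<^sub>M h (fls_extend (Y\<^sub>V v) (Y\<^sub>M k w) $$ p) $$ q') $$ (q - q') =
        Sum_any (\<lambda>p'. Y\<^sub>V u (Y\<^sub>M h (Y\<^sub>V v (Y\<^sub>M k w $$ p') $$ (p - p')) $$ q') $$ (q - q'))"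
      unfolding fls_extend_nth[OF action_tensor_laurent lin(1)]
      by (rule clinear_Sum_any[OF \<phi> fls_extend_finite[OF action_tensor_laurent lin(1)]])
    also have "\<dots> = Sum_any (\<lambda>p'. tensor_lift (\<lambda>h\<^sub>1 h\<^sub>2. R h\<^sub>1 h\<^sub>2 (q', p')) (\<Delta> h))"
    proof (rule Sum_any.cong)
      fix p'
      show "Y\<^sub>V u (Y\<^sub>M h (Y\<^sub>V v (Y\<^sub>M k w $$ p') $$ (p - p')) $$ q') $$ (q - q') =
          tensor_lift (\<lambda>h\<^sub>1 h\<^sub>2. R h\<^sub>1 h\<^sub>2 (q', p')) (\<Delta> h)"
        using action_product[of h v "Y\<^sub>M k w $$ p'" q' "p - p'"]
        by (simp add: vo_product_def tensor_lift_linear[OF lin(3)] R_def)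
    qed
    finally show "Y\<^sub>V u (Y\<^sub>M h (fls_extend (Y\<^sub>V v) (Y\<^sub>M k w) $$ p) $$ q') $$ (q - q') =
      Sum_any (\<lambda>p'. tensor_lift (\<lambda>h\<^sub>1 h\<^sub>2. R h\<^sub>1 h\<^sub>2 (q', p')) (\<Delta> h))" .
  qed
  also have "\<dots> = Sum_any (\<lambda>(q', p'). tensor_lift (\<lambda>h\<^sub>1 h\<^sub>2. R h\<^sub>1 h\<^sub>2 (q', p')) (\<Delta> h))"
    using finite_tensor_lift_support[of R "\<Delta> h", OF fin]
    by (intro Sum_any_Sigma) (simp add: case_prod_unfold)
  also have "\<dots> = tensor_lift (\<lambda>h\<^sub>1 h\<^sub>2. Sum_any (R h\<^sub>1 h\<^sub>2)) (\<Delta> h)"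
    by (simp add: tensor_lift_Sum_any[of R, OF fin] case_prod_unfold)
  finally show ?thesis by (simp only: eq)
qed

text \<open>Coefficient of x0^a x2^b in Y(Y(u,x0)Y(h1,x0)v, x2) Y(Y(h2,x0)k, x2)w, the
  \<open>V\<close>-component of the smash iterate.\<close>

definition iterate_coefficient where
  "iterate_coefficient u v w h\<^sub>1 h\<^sub>2 k a b =
    Sum_any (\<lambda>i. fls_extend (Y\<^sub>V (fls_extend (Y\<^sub>V u) (Y\<^sub>M h\<^sub>1 v) $$ i)) (Y\<^sub>M (Y\<^sub>H h\<^sub>2 k $$ (a - i)) w) $$ b)"

lemma iterate_coefficient_finite:
  "finite {i. fls_extend (Y\<^sub>V (fls_extend (Y\<^sub>V u) (Y\<^sub>M h\<^sub>1 v) $$ i)) (Y\<^sub>M (Y\<^sub>H h\<^sub>2 k $$ (a - i)) w) $$ b \<noteq> 0}"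
proof (rule finite_subset)
  note bl = cbilinearD[OF V.bilinear] cbilinearD[OF M.module_bilinear]
  have ext0: "fls_extend (Y\<^sub>V 0) f = 0" "fls_extend (Y\<^sub>V u) 0 = 0" for f u
    by (simp_all add: fls_extend_def bl fls_eq_iff)
  let ?X = "fls_extend (Y\<^sub>V u) (Y\<^sub>M h\<^sub>1 v)"
  have "fls_extend (Y\<^sub>V (?X $$ i)) (Y\<^sub>M (Y\<^sub>H h\<^sub>2 k $$ (a - i)) w) $$ b = 0"
    if "i \<notin> {fls_subdegree ?X..a - fls_subdegree (Y\<^sub>H h\<^sub>2 k)}" for i
  proof (cases "i < fls_subdegree ?X")
    case True
    then show ?thesis by (simp add: ext0)
  next
    case False
    then have "a - i < fls_subdegree (Y\<^sub>H h\<^sub>2 k)" using that by simp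
    then show ?thesis by (simp add: ext0 bl)
  qed
  then show "{i. fls_extend (Y\<^sub>V (?X $$ i)) (Y\<^sub>M (Y\<^sub>H h\<^sub>2 k $$ (a - i)) w) $$ b \<noteq> 0} \<subseteq>
      {fls_subdegree ?X..a - fls_subdegree (Y\<^sub>H h\<^sub>2 k)}" by blast
qed simp

lemma iterate_coefficient_diagonal:
  "iterate_coefficient u v w h\<^sub>1 h\<^sub>2 k a b = Sum_any (\<lambda>n. diagonal (iterate_kernel u v w h\<^sub>1 h\<^sub>2 k n) (a
      - n) b)"
proof -
  note lin = cbilinear_clinear[OF V.bilinear] cbilinear_clinear_nth[OF V.bilinear]
  let ?f = "Y\<^sub>M h\<^sub>1 v" and ?ik = "iterate_kernel u v w h\<^sub>1 h\<^sub>2 k"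
  \<comment> \<open>The exponent a of x0 is split as n + (i - n) + (a - i) over Y(h1, x0)v, Y(u, x0)
    and Y(h2, x0)k.\<close>
  define T where "T i = (\<lambda>(j, n). ?ik n (a - i) j (i - n) (b - j))" for i
  obtain K where K: "\<And>n i j k l. i < K \<or> k < K \<Longrightarrow> ?ik n i j k l = 0"
    using laurent4_iterate_kernel[of u v w h\<^sub>1 h\<^sub>2 k] unfolding laurent4_def by blast
  let ?N0 = "fls_subdegree ?f"
  let ?M = "a - ?N0 - K"
  obtain N where N: "\<And>n i j k l. i \<le> ?M \<Longrightarrow> k \<le> ?M \<Longrightarrow> j < N \<or> l < N \<Longrightarrow> ?ik n i j k l = 0"
    using laurent4_iterate_kernel[of u v w h\<^sub>1 h\<^sub>2 k] unfolding laurent4_def by meson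
  have N0: "?ik n i j k l = 0" if "n < ?N0" for n i j k l
    using that by (simp add: iterate_kernel_def cbilinearD[OF V.bilinear])
  have box: "i \<in> {K + ?N0..a - K} \<and> j \<in> {N..b - N} \<and> n \<in> {?N0..a - 2 * K}"
    if nz: "?ik n (a - i) j (i - n) (b - j) \<noteq> 0" for i j n
  proof -
    have 1: "\<not> a - i < K" "\<not> i - n < K" "\<not> n < ?N0" using nz K N0 by blast+
    then have "a - i \<le> ?M" "i - n \<le> ?M" by linarith+
    then have "\<not> j < N" "\<not> b - j < N" using nz N by blast+
    with 1 show ?thesis by auto
  qed
  have fin: "finite {(i, x). T i x \<noteq> 0}"
    by (rule finite_subset[of _ "{K + ?N0..a - K} \<times> {N..b - N} \<times> {?N0..a - 2 * K}"])
      (use box in \<open>fastforce simp: T_def\<close>)+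
  have "iterate_coefficient u v w h\<^sub>1 h\<^sub>2 k a b = Sum_any (\<lambda>i. Sum_any (T i))"
    unfolding iterate_coefficient_def
  proof (rule Sum_any.cong)
    fix i
    let ?g = "Y\<^sub>M (Y\<^sub>H h\<^sub>2 k $$ (a - i)) w"
    have "fls_extend (Y\<^sub>V (fls_extend (Y\<^sub>V u) ?f $$ i)) ?g $$ b =
        Sum_any (\<lambda>j. Y\<^sub>V (fls_extend (Y\<^sub>V u) ?f $$ i) (?g $$ j) $$ (b - j))"
      by (rule fls_extend_nth[OF action_tensor_laurent lin(1)])
    also have "\<dots> = Sum_any (\<lambda>j. Sum_any (\<lambda>n. T i (j, n)))"
      unfolding fls_extend_nth[OF action_tensor_laurent lin(1)] T_def prod.case iterate_kernel_def
      by (rule Sum_any.cong) (rule clinear_Sum_any[OF lin(4) fls_extend_finite[OF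
        action_tensor_laurent lin(1)]])
    also have "\<dots> = Sum_any (\<lambda>(j, n). T i (j, n))"
    proof (rule Sum_any_Sigma)
      show "finite {(j, n). T i (j, n) \<noteq> 0}"
        by (rule finite_subset[of _ "{N..b - N} \<times> {?N0..a - 2 * K}"])
          (use box in \<open>fastforce simp: T_def\<close>)+
    qed
    finally show "fls_extend (Y\<^sub>V (fls_extend (Y\<^sub>V u) ?f $$ i)) ?g $$ b = Sum_any (T i)" by simp
  qed
  also have "\<dots> = Sum_any (\<lambda>n. Sum_any (\<lambda>(i, j). ?ik n i j (a - n - i) (b - j)))"
    by (rule Sum_any_nested_reindex[OF fin, of "\<lambda>(i, x). (snd x, (a - i, fst x))" "\<lambda>(n, x).
      (a - fst x, (snd x, n))"])
      (auto simp: T_def case_prod_unfold algebra_simps)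
  finally show ?thesis by (simp only: diagonal_def)
qed

lemma weak_assoc_coefficients:
  "weak_assoc (\<lambda>q p. fls_extend (Y\<^sub>V u) (Y\<^sub>M h (fls_extend (Y\<^sub>V v) (Y\<^sub>M k w) $$ p)) $$ q)
    (\<lambda>a b. tensor_lift (\<lambda>h\<^sub>1 h\<^sub>2. iterate_coefficient u v w h\<^sub>1 h\<^sub>2 k a b) (\<Delta> h))"
  unfolding product_coefficient iterate_coefficient_diagonal
  by (rule weak_assoc_tensor_lift) (rule weak_assoc_kernels)

end

section \<open>The smash product on decomposable tensors\<close>

text \<open>A scalar can be absorbed into the first factor, so every tensor is a sum of decomposable
  ones and the induction has no scaling case.\<close>

lemma tensor_induct [case_names tensor add]:
  fixes t :: "('a::complex_vector, 'b::complex_vector) tensor"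
  assumes tensor: "\<And>a b. P (a \<otimes> b)" and add: "\<And>s t. P s \<Longrightarrow> P t \<Longrightarrow> P (s + t)"
  shows "P t"
proof -
  obtain r where t: "t = abs_tensor r" by (metis Quotient3_abs_rep[OF Quotient3_tensor])
  have zero: "abs_tensor 0 = (0::'a) \<otimes> (0::'b)"
    using cbilinearD(5)[OF cbilinear_tensor] by (simp flip: zero_tensor.abs_eq)
  have single: "abs_tensor (Poly_Mapping.single (a, b) c) = (c *\<^sub>C a) \<otimes> b" for a :: 'a and b :: 'b and c
  proof -
    have "Poly_Mapping.single (a, b) c = c *\<^sub>C Poly_Mapping.single (a, b) (1::complex)"
      by (rule poly_mapping_eqI) (simp add: scaleC_poly_mapping.rep_eq scaleC_complex_def
        lookup_single when_def)
    then have "abs_tensor (Poly_Mapping.single (a, b) c) = c *\<^sub>C (a \<otimes> b)"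
      by (simp only: scaleC_tensor.abs_eq tensor.abs_eq)
    then show ?thesis by (simp add: cbilinearD[OF cbilinear_tensor])
  qed
  have "P (abs_tensor r)"
  proof (induction r rule: update_induct)
    case const
    show ?case using tensor[of 0 0] by (simp add: zero)
  next
    case (update f x c)
    obtain a b where x: "x = (a, b)" by fastforce
    have "Poly_Mapping.update x c f = f + Poly_Mapping.single x c"
      using update(1) by (intro poly_mapping_eqI) (auto simp: lookup_update lookup_add lookup_single
        when_def in_keys_iff)
    then show ?case using update(3) tensor by (simp add: plus_tensor.abs_eq[symmetric] x single add)
  qed
  then show ?thesis by (simp add: t)
qed

lemma tensor_lift_swap:
  "tensor_lift (\<lambda>a b. tensor_lift (\<lambda>c d. f a b c d) t) s = tensor_lift (\<lambda>c d. tensor_lift (\<lambda>a b.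
      f a b c d) s) t"
  unfolding tensor_lift_def Let_def cvec.scale_sum_right
  by (subst sum.swap) (simp add: scaleC_scaleC mult.commute)

text \<open>A trilinear T factors through a linear map \<open>L\<close> on H \<otimes> (H \<otimes>
  H); applying \<open>L\<close> to both sides of coassociativity yields the two nested sums.\<close>

lemma (in coalgebra) coassoc_lift:
  fixes T :: "'h \<Rightarrow> 'h \<Rightarrow> 'h \<Rightarrow> 'c::complex_vector"
  assumes T: "\<And>a. cbilinear (T a)" "\<And>b c. clinear (\<lambda>a. T a b c)"
  shows "tensor_lift (\<lambda>g c. tensor_lift (\<lambda>a b. T a b c) (\<Delta> g)) (\<Delta> h) =
    tensor_lift (\<lambda>a g. tensor_lift (T a) (\<Delta> g)) (\<Delta> h)"
proof -
  note bl = cbilinearD[OF cbilinear_tensor]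
  define L where "L = tensor_lift (\<lambda>a. tensor_lift (T a))"
  have TL: "clinear (tensor_lift (T a))" "tensor_lift (T a) (b \<otimes> c) = T a b c" for a b c
    using clinear_tensor_lift[OF T(1)] tensor_lift_tensor[OF T(1)] by auto
  have T': "T (a + a') = (\<lambda>b c. T a b c + T a' b c)" "T (r *\<^sub>C a) = (\<lambda>b c. r *\<^sub>C T a b c)" for a a' r
    by (simp_all add: fun_eq_iff clinear_add[OF T(2)] clinear_scale[OF T(2)])
  have b: "cbilinear (\<lambda>a. tensor_lift (T a))"
    by (rule cbilinearI)
      (simp_all add: clinear_add[OF TL(1)] clinear_scale[OF TL(1)] T' tensor_lift_add_fun
          tensor_lift_scale_fun)
  have L: "clinear L" "L (a \<otimes> t) = tensor_lift (T a) t" for a t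
    using clinear_tensor_lift[OF b] tensor_lift_tensor[OF b] by (auto simp: L_def)
  have i: "cbilinear (\<lambda>(a::'h) (b::'h). a \<otimes> (b \<otimes> c))" for c :: 'h
    by (rule cbilinearI) (simp_all add: bl)
  have o: "cbilinear (\<lambda>(t::('h, 'h) tensor) (c::'h). tensor_lift (\<lambda>a b. a \<otimes> (b \<otimes> c)) t)"
    by (rule cbilinearI)
      (simp_all add: bl clinear_add[OF clinear_tensor_lift[OF i]] clinear_scale[OF
          clinear_tensor_lift[OF i]]
        tensor_lift_add_fun tensor_lift_scale_fun)
  have A: "clinear (tensor_assoc :: (('h, 'h) tensor, 'h) tensor \<Rightarrow> _)" "tensor_assoc (t \<otimes> c) =
      tensor_lift (\<lambda>a b. a \<otimes> (b \<otimes> c)) t" for t :: "('h, 'h) tensor" and c :: 'h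
    unfolding tensor_assoc_def using clinear_tensor_lift[OF o] tensor_lift_tensor[OF o] by auto
  have "L (tensor_assoc (tensor_map \<Delta> id (\<Delta> h))) = tensor_lift (\<lambda>g c. tensor_lift (\<lambda>a b.
      T a b c) (\<Delta> g)) (\<Delta> h)"
    by (simp add: tensor_map_def tensor_lift_linear[OF A(1)] tensor_lift_linear[OF L(1)] A(2) L(2)
      TL(2))
  moreover have "L (tensor_map id \<Delta> (\<Delta> h)) = tensor_lift (\<lambda>a g. tensor_lift (T a) (\<Delta> g)) (\<Delta> h)"
    by (simp add: tensor_map_def tensor_lift_linear[OF L(1)] L(2))
  ultimately show ?thesis using coassoc[of h] by simp
qed

lemma fls_tensor_support: "finite {i. (f $$ i) \<otimes> (g $$ (n - i)) \<noteq> 0}"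
  and fls_tensor_nth_Sum_any: "fls_tensor f g $$ n = Sum_any (\<lambda>i. (f $$ i) \<otimes> (g $$ (n - i)))"
proof -
  let ?S = "{fls_subdegree f..n - fls_subdegree g}"
  have sub: "{i. (f $$ i) \<otimes> (g $$ (n - i)) \<noteq> 0} \<subseteq> ?S"
  proof
    fix i assume "i \<in> {i. (f $$ i) \<otimes> (g $$ (n - i)) \<noteq> 0}"
    then have "f $$ i \<noteq> 0" "g $$ (n - i) \<noteq> 0" by (auto simp: cbilinearD[OF cbilinear_tensor])
    then show "i \<in> ?S" using fls_subdegree_leI[of f i] fls_subdegree_leI[of g "n - i"] by simp
  qed
  then show "finite {i. (f $$ i) \<otimes> (g $$ (n - i)) \<noteq> 0}" by (rule finite_subset) simp
  show "fls_tensor f g $$ n = Sum_any (\<lambda>i. (f $$ i) \<otimes> (g $$ (n - i)))"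
    unfolding fls_tensor_nth by (rule Sum_any.expand_superset[symmetric, OF _ sub]) simp
qed

lemma diagonal_Sum_any:
  assumes "diagonal_finite \<kappa>"
  shows "diagonal \<kappa> a b = Sum_any (\<lambda>j. Sum_any (\<lambda>i. \<kappa> i j (a - i) (b - j)))"
    and "finite {j. Sum_any (\<lambda>i. \<kappa> i j (a - i) (b - j)) \<noteq> 0}"
proof -
  have fin: "finite {(i, j). \<kappa> i j (a - i) (b - j) \<noteq> 0}"
    using assms unfolding diagonal_finite_def by blast
  have fin': "finite {(j, i). \<kappa> i j (a - i) (b - j) \<noteq> 0}"
  proof -
    have "finite (prod.swap ` {(i, j). \<kappa> i j (a - i) (b - j) \<noteq> 0})" using fin by blast
    also have "prod.swap ` {(i, j). \<kappa> i j (a - i) (b - j) \<noteq> 0} = {(j, i). \<kappa> i j (a - i) (b - j) \<noteq> 0}"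
      by (auto simp: image_iff)
    finally show ?thesis .
  qed
  have "diagonal \<kappa> a b = Sum_any (\<lambda>i. Sum_any (\<lambda>j. \<kappa> i j (a - i) (b - j)))"
    unfolding diagonal_def by (rule Sum_any_Sigma[OF fin, symmetric])
  also have "\<dots> = Sum_any (\<lambda>j. Sum_any (\<lambda>i. \<kappa> i j (a - i) (b - j)))"
    by (rule Sum_any_nested_reindex[OF fin, of prod.swap prod.swap]) simp_all
  finally show "diagonal \<kappa> a b = Sum_any (\<lambda>j. Sum_any (\<lambda>i. \<kappa> i j (a - i) (b - j)))" .
  show "finite {j. Sum_any (\<lambda>i. \<kappa> i j (a - i) (b - j)) \<noteq> 0}"
  proof (rule finite_subset)
    show "{j. Sum_any (\<lambda>i. \<kappa> i j (a - i) (b - j)) \<noteq> 0} \<subseteq> fst ` {(j, i). \<kappa> i j (a - i) (b - j) \<noteq> 0}"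
    proof
      fix j assume "j \<in> {j. Sum_any (\<lambda>i. \<kappa> i j (a - i) (b - j)) \<noteq> 0}"
      then obtain i where "\<kappa> i j (a - i) (b - j) \<noteq> 0"
        by (auto elim: Sum_any.not_neutral_obtains_not_neutral)
      then show "j \<in> fst ` {(j, i). \<kappa> i j (a - i) (b - j) \<noteq> 0}"
          by (intro image_eqI[of _ _ "(j, i)"]) auto
    qed
  qed (use fin' in blast)
qed

section \<open>Product and iterate of smash operators on decomposable tensors\<close>

context module_nonlocal_vertex_algebra
begin

abbreviation smash where "smash \<equiv> smash_Y Y\<^sub>H \<Delta> Y\<^sub>V Y\<^sub>M"

lemma extend_linear:
  assumes "f \<in> tensor_laurent" "g \<in> tensor_laurent"
  shows "fls_extend (Y\<^sub>V (u + u')) f = fls_extend (Y\<^sub>V u) f + fls_extend (Y\<^sub>V u') f"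
    and "fls_extend (Y\<^sub>V (c *\<^sub>C u)) f = c *\<^sub>C fls_extend (Y\<^sub>V u) f"
    and "fls_extend (Y\<^sub>V u) (f + g) = fls_extend (Y\<^sub>V u) f + fls_extend (Y\<^sub>V u) g"
    and "fls_extend (Y\<^sub>V u) (c *\<^sub>C f) = c *\<^sub>C fls_extend (Y\<^sub>V u) f"
proof -
  note lin = cbilinear_clinear(1)[OF V.bilinear]
  have "Y\<^sub>V (u + u') = (\<lambda>a. Y\<^sub>V u a + Y\<^sub>V u' a)" "Y\<^sub>V (c *\<^sub>C u) = (\<lambda>a. c *\<^sub>C Y\<^sub>V u a)"
    by (simp_all add: fun_eq_iff cbilinearD[OF V.bilinear])
  then show "fls_extend (Y\<^sub>V (u + u')) f = fls_extend (Y\<^sub>V u) f + fls_extend (Y\<^sub>V u') f"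
    "fls_extend (Y\<^sub>V (c *\<^sub>C u)) f = c *\<^sub>C fls_extend (Y\<^sub>V u) f"
    by (simp_all add: fls_extend_add_fun fls_extend_scale_fun lin assms)
qed (simp_all add: fls_extend_add fls_extend_scale cbilinear_clinear(1)[OF V.bilinear] assms)

lemmas smash_linear_simps = cbilinearD[OF H.bilinear] cbilinearD[OF V.bilinear] cbilinearD[OF
    M.module_bilinear]
  cbilinearD[OF cbilinear_fls_tensor] extend_linear[OF action_tensor_laurent action_tensor_laurent]

lemma cbilinear_smash_term: "cbilinear (smash_term u v k)"
  by (rule cbilinearI) (simp_all add: smash_linear_simps)

lemma cbilinear_smash: "cbilinear smash"
proof -
  have b2: "cbilinear (\<lambda>v k. tensor_lift (smash_term u v k) t)" for u t
    by (rule cbilinearI) (simp_all add: smash_linear_simps tensor_lift_add_fun tensor_lift_scale_fun)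
  have b3: "cbilinear (\<lambda>u h. tensor_lift (\<lambda>v k. tensor_lift (smash_term u v k) (\<Delta> h)) t)" for t
    by (rule cbilinearI)
      (simp_all add: smash_linear_simps tensor_lift_add_fun tensor_lift_scale_fun
        clinear_add[OF H.comult_linear] clinear_scale[OF H.comult_linear]
        clinear_add[OF clinear_tensor_lift[OF cbilinear_smash_term]]
        clinear_scale[OF clinear_tensor_lift[OF cbilinear_smash_term]])
  show ?thesis
    by (rule cbilinearI)
      (simp_all add: smash_Y_def clinear_add[OF clinear_tensor_lift[OF b3]] clinear_scale[OF
          clinear_tensor_lift[OF b3]]
        clinear_add[OF clinear_tensor_lift[OF b2]] clinear_scale[OF clinear_tensor_lift[OF b2]]
        tensor_lift_add_fun tensor_lift_scale_fun)
qed

lemma smash_nth: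
  "smash (u \<otimes> h) (v \<otimes> k) $$ n =
    tensor_lift (\<lambda>h\<^sub>1 h\<^sub>2. Sum_any (\<lambda>i. (fls_extend (Y\<^sub>V u) (Y\<^sub>M h\<^sub>1 v) $$ i) \<otimes> (Y\<^sub>H h\<^sub>2 k $$ (n - i)))) (\<Delta> h)"
  by (simp add: smash_Y_tensor tensor_lift_linear[OF clinear_fls_nth] fls_tensor_nth_Sum_any)

text \<open>Each coefficient of Y(v \<otimes> k, x2)(w \<otimes> m) is a sum of decomposable
  tensors, so \<open>smash_nth\<close> applies a second time. The factor g of
  \<open>\<Delta> h\<close> stays whole here; it is the action axiom that splits it.\<close>

lemma smash_product_tensor:
  "vo_product smash (u \<otimes> h) smash (v \<otimes> k) (w \<otimes> m) a b =
    tensor_lift (\<lambda>k\<^sub>1 k\<^sub>2. tensor_lift (\<lambda>g h\<^sub>3. diagonal (\<lambda>i j i' j'.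
      (fls_extend (Y\<^sub>V u) (Y\<^sub>M g (fls_extend (Y\<^sub>V v) (Y\<^sub>M k\<^sub>1 w) $$ j)) $$ i) \<otimes> vo_product Y\<^sub>H h\<^sub>3 Y\<^sub>H k\<^sub>2 m
          i' j') a b)
    (\<Delta> h)) (\<Delta> k)"
proof -
  have lin: "clinear (\<lambda>t. smash (u \<otimes> h) t $$ a)" by (rule cbilinear_clinear_nth(1)[OF cbilinear_smash])
  let ?X = "\<lambda>k\<^sub>1. fls_extend (Y\<^sub>V v) (Y\<^sub>M k\<^sub>1 w)"
  define \<kappa> where "\<kappa> k\<^sub>1 k\<^sub>2 g h\<^sub>3 i j i' j' =
    (fls_extend (Y\<^sub>V u) (Y\<^sub>M g (?X k\<^sub>1 $$ j)) $$ i) \<otimes> vo_product Y\<^sub>H h\<^sub>3 Y\<^sub>H k\<^sub>2 m i' j'"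
    for k\<^sub>1 k\<^sub>2 g h\<^sub>3 i j i' j'
  have fin: "diagonal_finite (\<kappa> k\<^sub>1 k\<^sub>2 g h\<^sub>3)" for k\<^sub>1 k\<^sub>2 g h\<^sub>3
  proof -
    \<comment> \<open>The Laurent condition is part of the weak associativity of the
      \<open>V\<close>-component.\<close>
    have "laurent2 (\<lambda>(_::unit) i j. fls_extend (Y\<^sub>V u) (Y\<^sub>M g (?X k\<^sub>1 $$ j)) $$ i)"
      using weak_assoc_coefficients unfolding weak_assoc_def weak_assoc_at_def by blast
    from diagonal_finite_laurent4[OF laurent4_bilinear[OF cbilinear_tensor this
        laurent2_vo_product[OF H.bilinear]]]
    show ?thesis unfolding \<kappa>_def .
  qed
  have "vo_product smash (u \<otimes> h) smash (v \<otimes> k) (w \<otimes> m) a b =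
      tensor_lift (\<lambda>k\<^sub>1 k\<^sub>2. smash (u \<otimes> h) (Sum_any (\<lambda>j. (?X k\<^sub>1 $$ j) \<otimes> (Y\<^sub>H k\<^sub>2 m $$ (b - j)))) $$ a)
          (\<Delta> k)"
    by (simp only: vo_product_def smash_nth[of v k w m b] tensor_lift_linear[OF lin])
  also have "(\<lambda>k\<^sub>1 k\<^sub>2. smash (u \<otimes> h) (Sum_any (\<lambda>j. (?X k\<^sub>1 $$ j) \<otimes> (Y\<^sub>H k\<^sub>2 m $$ (b - j)))) $$ a) =
      (\<lambda>k\<^sub>1 k\<^sub>2. tensor_lift (\<lambda>g h\<^sub>3. diagonal (\<kappa> k\<^sub>1 k\<^sub>2 g h\<^sub>3) a b) (\<Delta> h))"
  proof (intro ext)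
    fix k\<^sub>1 k\<^sub>2
    have "smash (u \<otimes> h) (Sum_any (\<lambda>j. (?X k\<^sub>1 $$ j) \<otimes> (Y\<^sub>H k\<^sub>2 m $$ (b - j)))) $$ a =
        Sum_any (\<lambda>j. smash (u \<otimes> h) ((?X k\<^sub>1 $$ j) \<otimes> (Y\<^sub>H k\<^sub>2 m $$ (b - j))) $$ a)"
      by (rule clinear_Sum_any[OF lin fls_tensor_support])
    also have "\<dots> = Sum_any (\<lambda>j. tensor_lift (\<lambda>g h\<^sub>3. Sum_any (\<lambda>i. \<kappa> k\<^sub>1 k\<^sub>2 g h\<^sub>3 i j (a - i) (b - j)))
        (\<Delta> h))"
      by (simp only: smash_nth \<kappa>_def vo_product_def)
    also have "\<dots> = tensor_lift (\<lambda>g h\<^sub>3. Sum_any (\<lambda>j. Sum_any (\<lambda>i. \<kappa> k\<^sub>1 k\<^sub>2 g h\<^sub>3 i j (a - i) (b - j))))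
        (\<Delta> h)"
      by (rule tensor_lift_Sum_any[symmetric]) (rule diagonal_Sum_any(2)[OF fin])
    also have "\<dots> = tensor_lift (\<lambda>g h\<^sub>3. diagonal (\<kappa> k\<^sub>1 k\<^sub>2 g h\<^sub>3) a b) (\<Delta> h)"
      by (simp only: diagonal_Sum_any(1)[OF fin])
    finally show "smash (u \<otimes> h) (Sum_any (\<lambda>j. (?X k\<^sub>1 $$ j) \<otimes> (Y\<^sub>H k\<^sub>2 m $$ (b - j)))) $$ a =
      tensor_lift (\<lambda>g h\<^sub>3. diagonal (\<kappa> k\<^sub>1 k\<^sub>2 g h\<^sub>3) a b) (\<Delta> h)" .
  qed
  finally show ?thesis unfolding \<kappa>_def .
qed

lemma laurent2_iterate_coefficient: "laurent2 (\<lambda>(_::unit) a b. iterate_coefficient u v w h\<^sub>1 h\<^sub>2 k b a)"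
  using weak_assoc_kernels[of u v w h\<^sub>1 h\<^sub>2 k]
  unfolding weak_assoc_def weak_assoc_at_def iterate_coefficient_diagonal[symmetric] by blast

definition smash_iterate_kernel where
  "smash_iterate_kernel u v w k m k' h\<^sub>1 h\<^sub>2 h\<^sub>3 i j i' j' =
    iterate_coefficient u v w h\<^sub>1 h\<^sub>2 k i j \<otimes> vo_iterate Y\<^sub>H Y\<^sub>H h\<^sub>3 k' m i' j'"

lemma diagonal_finite_smash_iterate: "diagonal_finite (smash_iterate_kernel u v w k m k' h\<^sub>1 h\<^sub>2 h\<^sub>3)"
proof -
  have "diagonal_finite (\<lambda>i j i' j'. smash_iterate_kernel u v w k m k' h\<^sub>1 h\<^sub>2 h\<^sub>3 j i j' i')"
    using diagonal_finite_laurent4[OF laurent4_bilinear[OF cbilinear_tensor laurent2_iterate_coefficient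
        laurent2_vo_iterate[OF H.bilinear]]]
    unfolding smash_iterate_kernel_def .
  then show ?thesis by (simp only: diagonal_finite_swap[of "smash_iterate_kernel u v w k m k' h\<^sub>1 h\<^sub>2
      h\<^sub>3"])
qed

lemma iterate_coefficient_linear:
  shows "iterate_coefficient u v w (h + h') g k a b = iterate_coefficient u v w h g k a b +
      iterate_coefficient u v w h' g k a b"
    and "iterate_coefficient u v w (c *\<^sub>C h) g k a b = c *\<^sub>C iterate_coefficient u v w h g k a b"
    and "iterate_coefficient u v w g (h + h') k a b = iterate_coefficient u v w g h k a b +
        iterate_coefficient u v w g h' k a b"
    and "iterate_coefficient u v w g (c *\<^sub>C h) k a b = c *\<^sub>C iterate_coefficient u v w g h k a b"
  unfolding iterate_coefficient_def
  by (simp_all add: smash_linear_simps scaleC_fls.rep_eq Sum_any_scaleC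
      Sum_any.distrib[OF iterate_coefficient_finite iterate_coefficient_finite])

text \<open>Linearity in each coproduct factor is what \<open>coassoc_lift\<close> asks for; it
  rests on the finiteness of the diagonals.\<close>

lemma smash_iterate_trilinear:
  fixes u v w k m k' and a b :: int
  defines "D \<equiv> \<lambda>h\<^sub>1 h\<^sub>2 h\<^sub>3. diagonal (smash_iterate_kernel u v w k m k' h\<^sub>1 h\<^sub>2 h\<^sub>3) a b"
  shows "cbilinear (D h\<^sub>1)" "clinear (\<lambda>h\<^sub>1. D h\<^sub>1 h\<^sub>2 h\<^sub>3)"
proof -
  note bl = cbilinearD[OF cbilinear_tensor] cbilinearD[OF H.bilinear] iterate_coefficient_linear
      scaleC_fls.rep_eq
  note kernel = smash_iterate_kernel_def[abs_def] vo_iterate_def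
  note add = diagonal_add[OF diagonal_finite_smash_iterate diagonal_finite_smash_iterate, symmetric]
  note scale = diagonal_scale[symmetric]
  show "cbilinear (D h\<^sub>1)"
    unfolding D_def
    by (rule cbilinearI; (simp only: add scale)?; simp add: kernel bl)
  show "clinear (\<lambda>h\<^sub>1. D h\<^sub>1 h\<^sub>2 h\<^sub>3)"
    unfolding D_def
    by (rule clinearI; (simp only: add scale)?; simp add: kernel bl)
qed

text \<open>The inner operator leaves Y(g, x0)k in the second factor, and the outer operator takes
  its coproduct. Multiplicativity of \<Delta> reduces this to the coproducts of g and k, so h is
  split as h1 \<otimes> (h2 \<otimes> h3).\<close>

lemma smash_iterate_tensor:
  "vo_iterate smash smash (u \<otimes> h) (v \<otimes> k) (w \<otimes> m) a b =
    tensor_lift (\<lambda>h\<^sub>1 g. tensor_lift (\<lambda>h\<^sub>2 h\<^sub>3. tensor_lift (\<lambda>k\<^sub>1 k\<^sub>2.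
      diagonal (smash_iterate_kernel u v w k\<^sub>1 m k\<^sub>2 h\<^sub>1 h\<^sub>2 h\<^sub>3) a b) (\<Delta> k)) (\<Delta> g)) (\<Delta> h)"
proof -
  note bl = cbilinearD[OF V.bilinear] cbilinearD[OF M.module_bilinear] cbilinearD[OF H.bilinear]
    cbilinearD[OF cbilinear_tensor]
  have lin: "clinear (\<lambda>t. smash t (w \<otimes> m) $$ b)" by (rule cbilinear_clinear_nth(2)[OF cbilinear_smash])
  let ?X = "\<lambda>h\<^sub>1. fls_extend (Y\<^sub>V u) (Y\<^sub>M h\<^sub>1 v)"
  define B where "B x y\<^sub>1 y\<^sub>2 = fls_tensor (fls_extend (Y\<^sub>V x) (Y\<^sub>M y\<^sub>1 w)) (Y\<^sub>H y\<^sub>2 m) $$ b" for x y\<^sub>1 y\<^sub>2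
  have B: "cbilinear (B x)" for x
    unfolding B_def by (rule cbilinearI) (simp_all add: smash_linear_simps scaleC_fls.rep_eq)
  have B0: "B x 0 y = 0" "B x y 0 = 0" for x y using cbilinearD(5,6)[OF B] by auto
  \<comment> \<open>The exponent a of x0 is split as i + d + (a - i - d) over the
    \<open>V\<close>-part, Y(h2, x0)k1 and Y(h3, x0)k2. \<open>U\<close> also splits the exponent b
    of x2, with j for the \<open>V\<close>-part.\<close>
  define T where "T h\<^sub>1 h\<^sub>2 h\<^sub>3 k\<^sub>1 k\<^sub>2 i d = B (?X h\<^sub>1 $$ i) (Y\<^sub>H h\<^sub>2 k\<^sub>1 $$ d) (Y\<^sub>H h\<^sub>3 k\<^sub>2 $$ (a - i - d))"
    for h\<^sub>1 h\<^sub>2 h\<^sub>3 k\<^sub>1 k\<^sub>2 i d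
  define U where "U h\<^sub>1 h\<^sub>2 h\<^sub>3 k\<^sub>1 k\<^sub>2 i d j = 
    (fls_extend (Y\<^sub>V (?X h\<^sub>1 $$ i)) (Y\<^sub>M (Y\<^sub>H h\<^sub>2 k\<^sub>1 $$ d) w) $$ j) \<otimes> (Y\<^sub>H (Y\<^sub>H h\<^sub>3 k\<^sub>2 $$ (a - i - d)) m $$
        (b - j))"
    for h\<^sub>1 h\<^sub>2 h\<^sub>3 k\<^sub>1 k\<^sub>2 i d j
  have ext0: "fls_extend (Y\<^sub>V 0) f = 0" for f by (simp add: fls_extend_def bl fls_eq_iff)
  have TU: "T h\<^sub>1 h\<^sub>2 h\<^sub>3 k\<^sub>1 k\<^sub>2 i d = Sum_any (U h\<^sub>1 h\<^sub>2 h\<^sub>3 k\<^sub>1 k\<^sub>2 i d)" for h\<^sub>1 h\<^sub>2 h\<^sub>3 k\<^sub>1 k\<^sub>2 i d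
    by (simp add: T_def U_def B_def fls_tensor_nth_Sum_any)
  define S where "S h\<^sub>1 h\<^sub>2 h\<^sub>3 k\<^sub>1 k\<^sub>2 = {fls_subdegree (?X h\<^sub>1)..a - fls_subdegree (Y\<^sub>H h\<^sub>2 k\<^sub>1) -
      fls_subdegree (Y\<^sub>H h\<^sub>3 k\<^sub>2)} \<times>
      {fls_subdegree (Y\<^sub>H h\<^sub>2 k\<^sub>1)..a - fls_subdegree (?X h\<^sub>1) - fls_subdegree (Y\<^sub>H h\<^sub>3 k\<^sub>2)}" for h\<^sub>1 h\<^sub>2 h\<^sub>3
          k\<^sub>1 k\<^sub>2
  have S: "(i, d) \<in> S h\<^sub>1 h\<^sub>2 h\<^sub>3 k\<^sub>1 k\<^sub>2" if nz: "U h\<^sub>1 h\<^sub>2 h\<^sub>3 k\<^sub>1 k\<^sub>2 i d j \<noteq> 0" for h\<^sub>1 h\<^sub>2 h\<^sub>3 k\<^sub>1 k\<^sub>2 i d j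
  proof -
    have X0: "?X h\<^sub>1 $$ i \<noteq> 0" using nz unfolding U_def by (auto simp: ext0 bl)
    have "fls_extend (Y\<^sub>V x) 0 = 0" for x by (simp add: fls_extend_def bl fls_eq_iff)
    then have "Y\<^sub>H h\<^sub>2 k\<^sub>1 $$ d \<noteq> 0" "Y\<^sub>H h\<^sub>3 k\<^sub>2 $$ (a - i - d) \<noteq> 0"
      using nz unfolding U_def by (auto simp: bl)
    with X0 show ?thesis
      using fls_subdegree_leI[of "?X h\<^sub>1" i] fls_subdegree_leI[of "Y\<^sub>H h\<^sub>2 k\<^sub>1" d]
        fls_subdegree_leI[of "Y\<^sub>H h\<^sub>3 k\<^sub>2" "a - i - d"] by (simp add: S_def)
  qed
  have U_fin: "finite {(x, j). (\<lambda>(i, d). U h\<^sub>1 h\<^sub>2 h\<^sub>3 k\<^sub>1 k\<^sub>2 i d) x j \<noteq> 0}" for h\<^sub>1 h\<^sub>2 h\<^sub>3 k\<^sub>1 k\<^sub>2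
  proof (rule finite_subset)
    show "{(x, j). (\<lambda>(i, d). U h\<^sub>1 h\<^sub>2 h\<^sub>3 k\<^sub>1 k\<^sub>2 i d) x j \<noteq> 0} \<subseteq>
        Sigma (S h\<^sub>1 h\<^sub>2 h\<^sub>3 k\<^sub>1 k\<^sub>2) (\<lambda>(i, d). {j. U h\<^sub>1 h\<^sub>2 h\<^sub>3 k\<^sub>1 k\<^sub>2 i d j \<noteq> 0})"
      using S by auto
    show "finite (Sigma (S h\<^sub>1 h\<^sub>2 h\<^sub>3 k\<^sub>1 k\<^sub>2) (\<lambda>(i, d). {j. U h\<^sub>1 h\<^sub>2 h\<^sub>3 k\<^sub>1 k\<^sub>2 i d j \<noteq> 0}))"
      by (rule finite_SigmaI) (auto simp: S_def U_def intro: fls_tensor_support)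
  qed
  have T_fin: "finite {(i, d). T h\<^sub>1 h\<^sub>2 h\<^sub>3 k\<^sub>1 k\<^sub>2 i d \<noteq> 0}" for h\<^sub>1 h\<^sub>2 h\<^sub>3 k\<^sub>1 k\<^sub>2
  proof (rule finite_subset)
    show "{(i, d). T h\<^sub>1 h\<^sub>2 h\<^sub>3 k\<^sub>1 k\<^sub>2 i d \<noteq> 0} \<subseteq> S h\<^sub>1 h\<^sub>2 h\<^sub>3 k\<^sub>1 k\<^sub>2"
      using S by (auto simp: TU elim!: Sum_any.not_neutral_obtains_not_neutral)
  qed (simp add: S_def)
  have T_fin': "finite {i. Sum_any (T h\<^sub>1 h\<^sub>2 h\<^sub>3 k\<^sub>1 k\<^sub>2 i) \<noteq> 0}" for h\<^sub>1 h\<^sub>2 h\<^sub>3 k\<^sub>1 k\<^sub>2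
  proof (rule finite_subset)
    show "{i. Sum_any (T h\<^sub>1 h\<^sub>2 h\<^sub>3 k\<^sub>1 k\<^sub>2 i) \<noteq> 0} \<subseteq> fst ` {(i, d). T h\<^sub>1 h\<^sub>2 h\<^sub>3 k\<^sub>1 k\<^sub>2 i d \<noteq> 0}"
      by (force elim!: Sum_any.not_neutral_obtains_not_neutral)
  qed (use T_fin in blast)
  have T_sum: "Sum_any (\<lambda>i. Sum_any (T h\<^sub>1 h\<^sub>2 h\<^sub>3 k\<^sub>1 k\<^sub>2 i)) = diagonal (smash_iterate_kernel u v w k\<^sub>1
      m k\<^sub>2 h\<^sub>1 h\<^sub>2 h\<^sub>3) a b"
    for h\<^sub>1 h\<^sub>2 h\<^sub>3 k\<^sub>1 k\<^sub>2
  proof -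
    have "Sum_any (\<lambda>i. Sum_any (T h\<^sub>1 h\<^sub>2 h\<^sub>3 k\<^sub>1 k\<^sub>2 i)) = Sum_any (\<lambda>(i, d). T h\<^sub>1 h\<^sub>2 h\<^sub>3 k\<^sub>1 k\<^sub>2 i d)"
      by (rule Sum_any_Sigma[OF T_fin])
    also have "\<dots> = Sum_any (\<lambda>x. Sum_any ((\<lambda>(i, d). U h\<^sub>1 h\<^sub>2 h\<^sub>3 k\<^sub>1 k\<^sub>2 i d) x))"
      by (simp add: TU case_prod_unfold)
    \<comment> \<open>The new outer index is (i + d, j), the two exponents that belong to the
      \<open>V\<close>-component.\<close>
    also have "\<dots> = Sum_any (\<lambda>x. Sum_any (\<lambda>i. U h\<^sub>1 h\<^sub>2 h\<^sub>3 k\<^sub>1 k\<^sub>2 i (fst x - i) (snd x)))"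
      by (rule Sum_any_nested_reindex[OF U_fin, of
            "\<lambda>(x, j). ((fst x + snd x, j), fst x)" "\<lambda>(x, i). ((i, fst x - i), snd x)"]) auto
    also have "\<dots> = diagonal (smash_iterate_kernel u v w k\<^sub>1 m k\<^sub>2 h\<^sub>1 h\<^sub>2 h\<^sub>3) a b"
      unfolding diagonal_def
    proof (rule Sum_any.cong)
      fix x :: "int \<times> int"
      obtain i' j where x: "x = (i', j)" by fastforce
      have \<phi>: "clinear (\<lambda>z. z \<otimes> (Y\<^sub>H (Y\<^sub>H h\<^sub>3 k\<^sub>2 $$ (a - i')) m $$ (b - j)))"
        by (rule cbilinear_clinear(2)[OF cbilinear_tensor])
      show "Sum_any (\<lambda>i. U h\<^sub>1 h\<^sub>2 h\<^sub>3 k\<^sub>1 k\<^sub>2 i (fst x - i) (snd x)) =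
          (case x of (i, j) \<Rightarrow> smash_iterate_kernel u v w k\<^sub>1 m k\<^sub>2 h\<^sub>1 h\<^sub>2 h\<^sub>3 i j (a - i) (b - j))"
        unfolding x prod.case smash_iterate_kernel_def iterate_coefficient_def vo_iterate_def
          clinear_Sum_any[OF \<phi> iterate_coefficient_finite]
        by (simp add: U_def)
    qed
    finally show ?thesis .
  qed
  have comult: "tensor_lift (B x) (\<Delta> (Y\<^sub>H g k $$ c)) = tensor_lift (\<lambda>h\<^sub>2 h\<^sub>3. tensor_lift (\<lambda>k\<^sub>1 k\<^sub>2.
      Sum_any (\<lambda>d. B x (Y\<^sub>H h\<^sub>2 k\<^sub>1 $$ d) (Y\<^sub>H h\<^sub>3 k\<^sub>2 $$ (c - d)))) (\<Delta> k)) (\<Delta> g)" for x g c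
  proof -
    have \<Delta>0: "\<Delta> 0 = 0" by (rule clinear_0[OF H.comult_linear])
    have "\<Delta> (Y\<^sub>H g k $$ c) = tensor_Y Y\<^sub>H Y\<^sub>H (\<Delta> g) (\<Delta> k) $$ c"
      using H.comult_hom fls_map_nth[of \<Delta> "Y\<^sub>H g k" c, OF \<Delta>0] by (simp add: nva_hom_def)
    also have "\<dots> = tensor_lift (\<lambda>h\<^sub>2 h\<^sub>3. tensor_lift (\<lambda>k\<^sub>1 k\<^sub>2.
      Sum_any (\<lambda>d. (Y\<^sub>H h\<^sub>2 k\<^sub>1 $$ d) \<otimes> (Y\<^sub>H h\<^sub>3 k\<^sub>2 $$ (c - d)))) (\<Delta> k)) (\<Delta> g)"
      by (simp add: tensor_Y_def tensor_lift_linear[OF clinear_fls_nth] fls_tensor_nth_Sum_any)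
    finally show ?thesis
      by (simp add: tensor_lift_linear[OF clinear_tensor_lift[OF B]]
          clinear_Sum_any[OF clinear_tensor_lift[OF B] fls_tensor_support] tensor_lift_tensor[OF B])
  qed
  have "vo_iterate smash smash (u \<otimes> h) (v \<otimes> k) (w \<otimes> m) a b =
      tensor_lift (\<lambda>h\<^sub>1 g. smash (Sum_any (\<lambda>i. (?X h\<^sub>1 $$ i) \<otimes> (Y\<^sub>H g k $$ (a - i)))) (w \<otimes> m) $$ b) (\<Delta> h)"
    by (simp only: vo_iterate_def smash_nth[of u h v k a] tensor_lift_linear[OF lin])
  also have "(\<lambda>h\<^sub>1 g. smash (Sum_any (\<lambda>i. (?X h\<^sub>1 $$ i) \<otimes> (Y\<^sub>H g k $$ (a - i)))) (w \<otimes> m) $$ b) =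
      (\<lambda>h\<^sub>1 g. tensor_lift (\<lambda>h\<^sub>2 h\<^sub>3. tensor_lift (\<lambda>k\<^sub>1 k\<^sub>2.
        diagonal (smash_iterate_kernel u v w k\<^sub>1 m k\<^sub>2 h\<^sub>1 h\<^sub>2 h\<^sub>3) a b) (\<Delta> k)) (\<Delta> g))"
  proof (intro ext)
    fix h\<^sub>1 g
    have "smash (Sum_any (\<lambda>i. (?X h\<^sub>1 $$ i) \<otimes> (Y\<^sub>H g k $$ (a - i)))) (w \<otimes> m) $$ b =
        Sum_any (\<lambda>i. smash ((?X h\<^sub>1 $$ i) \<otimes> (Y\<^sub>H g k $$ (a - i))) (w \<otimes> m) $$ b)"
      by (rule clinear_Sum_any[OF lin fls_tensor_support])
    also have "\<dots> = Sum_any (\<lambda>i. tensor_lift (B (?X h\<^sub>1 $$ i)) (\<Delta> (Y\<^sub>H g k $$ (a - i))))"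
      by (simp add: smash_Y_tensor tensor_lift_linear[OF clinear_fls_nth] B_def[abs_def])
    also have "\<dots> = Sum_any (\<lambda>i. tensor_lift (\<lambda>h\<^sub>2 h\<^sub>3. tensor_lift (\<lambda>k\<^sub>1 k\<^sub>2.
        Sum_any (T h\<^sub>1 h\<^sub>2 h\<^sub>3 k\<^sub>1 k\<^sub>2 i)) (\<Delta> k)) (\<Delta> g))"
      unfolding comult T_def ..
    also have "\<dots> = tensor_lift (\<lambda>h\<^sub>2 h\<^sub>3. Sum_any (\<lambda>i. tensor_lift (\<lambda>k\<^sub>1 k\<^sub>2.
        Sum_any (T h\<^sub>1 h\<^sub>2 h\<^sub>3 k\<^sub>1 k\<^sub>2 i)) (\<Delta> k))) (\<Delta> g)"
      by (rule tensor_lift_Sum_any[symmetric]) (rule finite_tensor_lift_support[OF T_fin'])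
    also have "\<dots> = tensor_lift (\<lambda>h\<^sub>2 h\<^sub>3. tensor_lift (\<lambda>k\<^sub>1 k\<^sub>2.
        Sum_any (\<lambda>i. Sum_any (T h\<^sub>1 h\<^sub>2 h\<^sub>3 k\<^sub>1 k\<^sub>2 i))) (\<Delta> k)) (\<Delta> g)"
      by (simp only: tensor_lift_Sum_any[OF T_fin'])
    finally show "smash (Sum_any (\<lambda>i. (?X h\<^sub>1 $$ i) \<otimes> (Y\<^sub>H g k $$ (a - i)))) (w \<otimes> m) $$ b =
      tensor_lift (\<lambda>h\<^sub>2 h\<^sub>3. tensor_lift (\<lambda>k\<^sub>1 k\<^sub>2.
        diagonal (smash_iterate_kernel u v w k\<^sub>1 m k\<^sub>2 h\<^sub>1 h\<^sub>2 h\<^sub>3) a b) (\<Delta> k)) (\<Delta> g)"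
      by (simp only: T_sum)
  qed
  finally show ?thesis .
qed

end

section \<open>The smash product is a nonlocal vertex algebra\<close>

lemma fls_const_tensor_laurent: "fls_const v \<in> tensor_laurent"
proof -
  have "fls_const v = fls_vec v 1"
    by (rule fls_eqI) (simp add: fls_vec_nth scaleC_one)
  then show ?thesis unfolding tensor_laurent_def by (auto intro: cvec.span_base)
qed

lemma fls_extend_const:
  assumes "clinear \<phi>"
  shows "fls_extend \<phi> (fls_const v) = \<phi> v"
proof (rule fls_eqI)
  fix n
  have "fls_extend \<phi> (fls_const v) $$ n = Sum_any (\<lambda>m::int. if m = 0 then \<phi> v $$ n else 0)"
    unfolding fls_extend_nth[OF fls_const_tensor_laurent assms]
    by (rule Sum_any.cong) (simp add: clinear_0[OF assms])
  then show "fls_extend \<phi> (fls_const v) $$ n = \<phi> v $$ n" by simp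
qed

lemma fls_extend_fls_const:
  assumes "f \<in> tensor_laurent"
  shows "fls_extend fls_const f = (f :: 'a::complex_vector fls)"
proof (rule fls_eqI)
  fix n
  have lin: "clinear (fls_const :: 'a \<Rightarrow> 'a fls)"
    by (rule clinearI; rule fls_eqI) (simp_all add: scaleC_fls.rep_eq)
  have "fls_extend fls_const f $$ n = Sum_any (\<lambda>m. if m = n then f $$ n else 0)"
    unfolding fls_extend_nth[OF assms lin] by (rule Sum_any.cong) simp
  then show "fls_extend fls_const f $$ n = f $$ n" by simp
qed

lemma fls_tensor_const_nth:
  "fls_tensor f (fls_const y) $$ n = (f $$ n) \<otimes> y" "fls_tensor (fls_const x) g $$ n = x \<otimes> (g $$ n)"
proof -
  note bl = cbilinearD[OF cbilinear_tensor]
  have "fls_tensor f (fls_const y) $$ n = Sum_any (\<lambda>i. if i = n then (f $$ n) \<otimes> y else 0)"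
    unfolding fls_tensor_nth_Sum_any by (rule Sum_any.cong) (simp add: bl)
  then show "fls_tensor f (fls_const y) $$ n = (f $$ n) \<otimes> y" by simp
  have "fls_tensor (fls_const x) g $$ n = Sum_any (\<lambda>i::int. if i = 0 then x \<otimes> (g $$ n) else 0)"
    unfolding fls_tensor_nth_Sum_any by (rule Sum_any.cong) (simp add: bl)
  then show "fls_tensor (fls_const x) g $$ n = x \<otimes> (g $$ n)" by simp
qed

lemma tensor_lift_bounded:
  assumes "\<And>x y. \<exists>K. \<forall>z b. b < (K::int) \<longrightarrow> F x y z b = 0"
  shows "\<exists>K. \<forall>z b. b < K \<longrightarrow> tensor_lift (\<lambda>x y. F x y z b) t = 0"
proof -
  have "\<exists>K. \<forall>p\<in>Poly_Mapping.keys (rep_tensor t). \<forall>b<K. \<forall>z. F (fst p) (snd p) z b = 0"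
  proof (rule uniform_lower_bound)
    fix p :: "'a \<times> 'b"
    show "\<exists>K. \<forall>b<K. \<forall>z. F (fst p) (snd p) z b = 0" using assms by blast
  qed simp
  then obtain K where "\<forall>p\<in>Poly_Mapping.keys (rep_tensor t). \<forall>b<K. \<forall>z. F (fst p) (snd p) z b = 0"
      by blast
  then show ?thesis unfolding tensor_lift_def Let_def by (intro exI[of _ K]) (simp add: sum.neutral)
qed

section \<open>Weak associativity of the smash product\<close>

context module_nonlocal_vertex_algebra
begin

lemma smash_product_linear:
  "vo_product smash s smash t (r + r') = (\<lambda>a b. vo_product smash s smash t r a b + vo_product smash
      s smash t r' a b)"
  "vo_product smash s smash (t + t') r = (\<lambda>a b. vo_product smash s smash t r a b + vo_product smash
      s smash t' r a b)"
  "vo_product smash (s + s') smash t r = (\<lambda>a b. vo_product smash s smash t r a b + vo_product smash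
      s' smash t r a b)"
  "vo_iterate smash smash s t (r + r') = (\<lambda>a b. vo_iterate smash smash s t r a b + vo_iterate smash
      smash s t r' a b)"
  "vo_iterate smash smash s (t + t') r = (\<lambda>a b. vo_iterate smash smash s t r a b + vo_iterate smash
      smash s t' r a b)"
  "vo_iterate smash smash (s + s') t r = (\<lambda>a b. vo_iterate smash smash s t r a b + vo_iterate smash
      smash s' t r a b)"
  by (simp_all add: fun_eq_iff vo_product_def vo_iterate_def cbilinearD[OF cbilinear_smash])

lemma diagonal_tensor_lift_iterate:
  "diagonal (\<lambda>i j i' j'. tensor_lift (\<lambda>h\<^sub>1 h\<^sub>2. iterate_coefficient u v w h\<^sub>1 h\<^sub>2 k i j) t \<otimes> vo_iterate
      Y\<^sub>H Y\<^sub>H h\<^sub>3 k' m i' j') a b =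
    tensor_lift (\<lambda>h\<^sub>1 h\<^sub>2. diagonal (smash_iterate_kernel u v w k m k' h\<^sub>1 h\<^sub>2 h\<^sub>3) a b) t"
proof -
  define R where "R h\<^sub>1 h\<^sub>2 = (\<lambda>(i, j). smash_iterate_kernel u v w k m k' h\<^sub>1 h\<^sub>2 h\<^sub>3 i j (a - i) (b -
      j))" for h\<^sub>1 h\<^sub>2
  have fin: "finite {x. R h\<^sub>1 h\<^sub>2 x \<noteq> 0}" for h\<^sub>1 h\<^sub>2
    using diagonal_finite_smash_iterate unfolding R_def diagonal_finite_def
      by (simp add: case_prod_unfold)
  have lin: "clinear (\<lambda>z. z \<otimes> y)" for y :: 'h by (rule cbilinear_clinear(2)[OF cbilinear_tensor])
  have "tensor_lift (\<lambda>h\<^sub>1 h\<^sub>2. Sum_any (R h\<^sub>1 h\<^sub>2)) t = Sum_any (\<lambda>x. tensor_lift (\<lambda>h\<^sub>1 h\<^sub>2. R h\<^sub>1 h\<^sub>2 x) t)"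
    by (rule tensor_lift_Sum_any[OF fin])
  then show ?thesis
    by (simp add: diagonal_def R_def smash_iterate_kernel_def tensor_lift_linear[OF lin]
      case_prod_unfold)
qed

text \<open>The product splits h as (h1 \<otimes> h2) \<otimes> h3 and the iterate as h1 \<otimes>
  (h2 \<otimes> h3). Once coassociativity has aligned them, \<open>V\<close>- and
  \<open>H\<close>-components correspond term by term and
  \<open>weak_assoc_diagonal_bilinear\<close> applies.\<close>

lemma weak_assoc_smash_tensor:
  "weak_assoc (vo_product smash (u \<otimes> h) smash (v \<otimes> k) (w \<otimes> m)) (vo_iterate smash smash (u \<otimes> h) (v \<otimes>
      k) (w \<otimes> m))"
proof -
  have H: "weak_assoc (vo_product Y\<^sub>H h Y\<^sub>H k m) (vo_iterate Y\<^sub>H Y\<^sub>H h k m)" for h k m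
    using H.weak_associativity weakly_associative_iff[OF H.bilinear H.bilinear] by blast
  have eq: "vo_iterate smash smash (u \<otimes> h) (v \<otimes> k) (w \<otimes> m) a b =
      tensor_lift (\<lambda>k\<^sub>1 k\<^sub>2. tensor_lift (\<lambda>g h\<^sub>3. diagonal (\<lambda>i j i' j'.
        tensor_lift (\<lambda>h\<^sub>1 h\<^sub>2. iterate_coefficient u v w h\<^sub>1 h\<^sub>2 k\<^sub>1 i j) (\<Delta> g) \<otimes> vo_iterate Y\<^sub>H Y\<^sub>H h\<^sub>3 k\<^sub>2
            m i' j') a b)
      (\<Delta> h)) (\<Delta> k)" for a b
  proof -
    define D where "D k\<^sub>1 k\<^sub>2 h\<^sub>1 h\<^sub>2 h\<^sub>3 = diagonal (smash_iterate_kernel u v w k\<^sub>1 m k\<^sub>2 h\<^sub>1 h\<^sub>2 h\<^sub>3) a b"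
        for k\<^sub>1 k\<^sub>2 h\<^sub>1 h\<^sub>2 h\<^sub>3
    have D: "cbilinear (D k\<^sub>1 k\<^sub>2 h\<^sub>1)" "clinear (\<lambda>h\<^sub>1. D k\<^sub>1 k\<^sub>2 h\<^sub>1 h\<^sub>2 h\<^sub>3)" for k\<^sub>1 k\<^sub>2 h\<^sub>1 h\<^sub>2 h\<^sub>3
      unfolding D_def by (rule smash_iterate_trilinear)+
    have "vo_iterate smash smash (u \<otimes> h) (v \<otimes> k) (w \<otimes> m) a b =
        tensor_lift (\<lambda>h\<^sub>1 g. tensor_lift (\<lambda>h\<^sub>2 h\<^sub>3. tensor_lift (\<lambda>k\<^sub>1 k\<^sub>2. D k\<^sub>1 k\<^sub>2 h\<^sub>1 h\<^sub>2 h\<^sub>3) (\<Delta> k)) (\<Delta>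
            g)) (\<Delta> h)"
      by (simp only: smash_iterate_tensor D_def)
    \<comment> \<open>The sum over \<open>\<Delta> k\<close> is moved outermost, so that the two
      sums coming from h become adjacent for coassociativity.\<close>
    also have "\<dots> = tensor_lift (\<lambda>h\<^sub>1 g. tensor_lift (\<lambda>k\<^sub>1 k\<^sub>2. tensor_lift (\<lambda>h\<^sub>2 h\<^sub>3. D k\<^sub>1 k\<^sub>2 h\<^sub>1 h\<^sub>2 h\<^sub>3)
        (\<Delta> g)) (\<Delta> k)) (\<Delta> h)"
      by (subst tensor_lift_swap) (rule refl)
    also have "\<dots> = tensor_lift (\<lambda>k\<^sub>1 k\<^sub>2. tensor_lift (\<lambda>h\<^sub>1 g. tensor_lift (\<lambda>h\<^sub>2 h\<^sub>3. D k\<^sub>1 k\<^sub>2 h\<^sub>1 h\<^sub>2 h\<^sub>3)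
        (\<Delta> g)) (\<Delta> h)) (\<Delta> k)"
      by (rule tensor_lift_swap)
    also have "\<dots> = tensor_lift (\<lambda>k\<^sub>1 k\<^sub>2. tensor_lift (\<lambda>g h\<^sub>3. tensor_lift (\<lambda>h\<^sub>1 h\<^sub>2. D k\<^sub>1 k\<^sub>2 h\<^sub>1 h\<^sub>2 h\<^sub>3)
        (\<Delta> g)) (\<Delta> h)) (\<Delta> k)"
      by (simp only: H.coassoc_lift[OF D])
    finally show ?thesis by (simp only: D_def diagonal_tensor_lift_iterate)
  qed
  show ?thesis
    unfolding smash_product_tensor[abs_def] eq[abs_def]
    by (intro weak_assoc_tensor_lift weak_assoc_diagonal_bilinear[OF cbilinear_tensor
      weak_assoc_coefficients H])
qed

lemma weak_assoc_smash: "weak_assoc (vo_product smash s smash t r) (vo_iterate smash smash s t r)"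
proof (induction s rule: tensor_induct)
  case (tensor u h)
  show ?case
  proof (induction t rule: tensor_induct)
    case (tensor v k)
    show ?case
    proof (induction r rule: tensor_induct)
      case (tensor w m)
      show ?case by (rule weak_assoc_smash_tensor)
    qed (simp only: smash_product_linear weak_assoc_add)
  qed (simp only: smash_product_linear weak_assoc_add)
qed (simp only: smash_product_linear weak_assoc_add)

section \<open>Vacuum properties of the smash product\<close>

lemma comult_vacuum: "\<Delta> vac\<^sub>H = vac\<^sub>H \<otimes> vac\<^sub>H"
  and counit_vacuum: "\<epsilon> vac\<^sub>H = 1"
  using H.comult_hom H.counit_hom by (auto simp: nva_hom_def)

lemma extend_vacuum: "fls_extend (Y\<^sub>V vac\<^sub>V) (Y\<^sub>M h v) = Y\<^sub>M h v"
proof -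
  have "Y\<^sub>V vac\<^sub>V = fls_const" by (simp add: fun_eq_iff V.vacuum)
  then show ?thesis by (simp add: fls_extend_fls_const action_tensor_laurent)
qed

lemma smash_left_V: "smash (u \<otimes> vac\<^sub>H) (v \<otimes> k) = fls_tensor (Y\<^sub>V u v) (fls_const k)"
  by (simp add: smash_Y_tensor comult_vacuum tensor_lift_tensor[OF cbilinear_smash_term] M.module_vacuum
      H.vacuum fls_extend_const cbilinear_clinear(1)[OF V.bilinear])

lemma smash_left_H:
  "smash (vac\<^sub>V \<otimes> h) (v \<otimes> k) = tensor_lift (\<lambda>h\<^sub>1 h\<^sub>2. fls_tensor (Y\<^sub>M h\<^sub>1 v) (Y\<^sub>H h\<^sub>2 k)) (\<Delta> h)"
  by (simp add: smash_Y_tensor extend_vacuum)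

text \<open>The action on the vacuum is the counit, so the sum over \<open>\<Delta> h\<close>
  collapses to h by the left counit identity.\<close>

lemma smash_right_vacuum: "smash (u \<otimes> h) (vac\<^sub>V \<otimes> k) = fls_tensor (Y\<^sub>V u vac\<^sub>V) (Y\<^sub>H h k)"
proof -
  have lin: "clinear (\<lambda>x. fls_tensor (Y\<^sub>V u vac\<^sub>V) (Y\<^sub>H x k))"
    by (rule clinearI) (simp_all add: smash_linear_simps)
  have "smash_term u vac\<^sub>V k h\<^sub>1 h\<^sub>2 = fls_tensor (Y\<^sub>V u vac\<^sub>V) (Y\<^sub>H (\<epsilon> h\<^sub>1 *\<^sub>C h\<^sub>2) k)" for h\<^sub>1 h\<^sub>2
    by (simp add: action_vacuum fls_extend_const cbilinear_clinear(1)[OF V.bilinear] smash_linear_simps)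
  then have "smash (u \<otimes> h) (vac\<^sub>V \<otimes> k) =
      fls_tensor (Y\<^sub>V u vac\<^sub>V) (Y\<^sub>H (tensor_lift (\<lambda>h\<^sub>1 h\<^sub>2. \<epsilon> h\<^sub>1 *\<^sub>C h\<^sub>2) (\<Delta> h)) k)"
    by (simp add: smash_Y_tensor tensor_lift_linear[OF lin])
  then show ?thesis by (simp add: H.counit_left)
qed

lemma nonlocal_vertex_algebra_smash: "nonlocal_vertex_algebra smash (vac\<^sub>V \<otimes> vac\<^sub>H)"
proof
  show "cbilinear smash" by (rule cbilinear_smash)
  show "smash (vac\<^sub>V \<otimes> vac\<^sub>H) t = fls_const t" for t
  proof (induction t rule: tensor_induct)
    case (tensor v k)
    show ?case
      by (rule fls_eqI) (simp add: smash_left_V V.vacuum fls_tensor_const_nth cbilinearD[OF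
        cbilinear_tensor])
  next
    case (add s t)
    then show ?case by (intro fls_eqI) (simp add: cbilinearD[OF cbilinear_smash])
  qed
  show "smash t (vac\<^sub>V \<otimes> vac\<^sub>H) $$ n = 0" if "n < 0" for t n
  proof (induction t rule: tensor_induct)
    case (tensor u h)
    have "(Y\<^sub>V u vac\<^sub>V $$ i) \<otimes> (Y\<^sub>H h vac\<^sub>H $$ (n - i)) = 0" for i
      using that V.creation_regular[of i u] H.creation_regular[of "n - i" h]
      by (cases "i < 0") (simp_all add: cbilinearD[OF cbilinear_tensor])
    then show ?case by (simp add: smash_right_vacuum fls_tensor_nth_Sum_any)
  qed (simp add: cbilinearD[OF cbilinear_smash])
  show "smash t (vac\<^sub>V \<otimes> vac\<^sub>H) $$ 0 = t" for t
  proof (induction t rule: tensor_induct)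
    case (tensor u h)
    have "(Y\<^sub>V u vac\<^sub>V $$ i) \<otimes> (Y\<^sub>H h vac\<^sub>H $$ (0 - i)) = (if i = 0 then u \<otimes> h else 0)" for i
      \<comment> \<open>Neither factor has negative powers, so only i = 0 survives in the constant
        term.\<close>
      using V.creation_regular[of i u] H.creation_regular[of "- i" h] V.creation_limit H.creation_limit
      by (cases i "0::int" rule: linorder_cases) (simp_all add: cbilinearD[OF cbilinear_tensor])
    then show ?case by (simp add: smash_right_vacuum fls_tensor_nth_Sum_any)
  qed (simp add: cbilinearD[OF cbilinear_smash])
  show "weakly_associative smash smash"
    using weak_assoc_smash weakly_associative_iff[OF cbilinear_smash cbilinear_smash] by blast
qed

section \<open>The embeddings of \<open>V\<close> and \<open>H\<close>\<close>

lemma subspace_range: "clinear \<phi> \<Longrightarrow> cvec.subspace (range \<phi>)"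
  unfolding cvec.subspace_def
  by (auto simp: image_iff clinear_0 simp flip: clinear_add clinear_scale intro: exI[of _ 0])

lemma
  shows nva_hom_V: "nva_hom Y\<^sub>V vac\<^sub>V smash (vac\<^sub>V \<otimes> vac\<^sub>H) (\<lambda>u. u \<otimes> vac\<^sub>H)"
    and nva_subalgebra_V: "nva_subalgebra smash (vac\<^sub>V \<otimes> vac\<^sub>H) (range (\<lambda>u. u \<otimes> vac\<^sub>H))"
    and inj_V: "inj (\<lambda>u::'v. u \<otimes> vac\<^sub>H)"
proof -
  have lin: "clinear (\<lambda>u. u \<otimes> vac\<^sub>H)" by (rule cbilinear_clinear(2)[OF cbilinear_tensor])
  have nth: "smash (u \<otimes> vac\<^sub>H) (v \<otimes> vac\<^sub>H) $$ n = (Y\<^sub>V u v $$ n) \<otimes> vac\<^sub>H" for u v n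
    by (simp add: smash_left_V fls_tensor_const_nth)
  show "nva_hom Y\<^sub>V vac\<^sub>V smash (vac\<^sub>V \<otimes> vac\<^sub>H) (\<lambda>u. u \<otimes> vac\<^sub>H)"
    unfolding nva_hom_def using lin by (auto intro!: fls_eqI simp: fls_map_nth nth cbilinearD[OF
      cbilinear_tensor])
  show "nva_subalgebra smash (vac\<^sub>V \<otimes> vac\<^sub>H) (range (\<lambda>u. u \<otimes> vac\<^sub>H))"
    unfolding nva_subalgebra_def using subspace_range[OF lin] by (auto simp: nth)
  \<comment> \<open>The map id \<otimes> \<epsilon> is a left inverse, because \<epsilon> sends the
    vacuum of \<open>H\<close> to 1.\<close>
  have b: "cbilinear (\<lambda>(u::'v) h. \<epsilon> h *\<^sub>C u)"
    by (rule cbilinearI) (simp_all add: clinear_add[OF H.counit_linear] clinear_scale[OF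
      H.counit_linear]
        scaleC_add_left scaleC_add_right scaleC_scaleC scaleC_complex_def mult.commute)
  show "inj (\<lambda>u::'v. u \<otimes> vac\<^sub>H)"
  proof (rule injI)
    fix u v :: 'v assume "u \<otimes> vac\<^sub>H = v \<otimes> vac\<^sub>H"
    then have "tensor_lift (\<lambda>u h. \<epsilon> h *\<^sub>C u) (u \<otimes> vac\<^sub>H) = tensor_lift (\<lambda>u h. \<epsilon> h *\<^sub>C u) (v \<otimes> vac\<^sub>H)"
        by simp
    then show "u = v" by (simp add: tensor_lift_tensor[OF b] counit_vacuum scaleC_one)
  qed
qed

text \<open>A left inverse is \<phi> \<otimes> id for a linear functional \<phi> with value 1 on the
  vacuum of \<open>V\<close>, available when that vacuum is nonzero. If V = 0, the tensor product is
  zero while H is not, hence the side condition on injectivity.\<close>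

lemma
  shows nva_hom_H: "nva_hom Y\<^sub>H vac\<^sub>H smash (vac\<^sub>V \<otimes> vac\<^sub>H) (\<lambda>h. vac\<^sub>V \<otimes> h)"
    and nva_subalgebra_H: "nva_subalgebra smash (vac\<^sub>V \<otimes> vac\<^sub>H) (range (\<lambda>h. vac\<^sub>V \<otimes> h))"
    and inj_H: "(UNIV :: 'v set) \<noteq> {0} \<Longrightarrow> inj (\<lambda>h::'h. vac\<^sub>V \<otimes> h)"
proof -
  have lin: "clinear (\<lambda>h. vac\<^sub>V \<otimes> h)" by (rule cbilinear_clinear(1)[OF cbilinear_tensor])
  have nth: "smash (vac\<^sub>V \<otimes> h) (vac\<^sub>V \<otimes> k) $$ n = vac\<^sub>V \<otimes> (Y\<^sub>H h k $$ n)" for h k n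
    by (simp add: smash_right_vacuum V.vacuum fls_tensor_const_nth)
  show "nva_hom Y\<^sub>H vac\<^sub>H smash (vac\<^sub>V \<otimes> vac\<^sub>H) (\<lambda>h. vac\<^sub>V \<otimes> h)"
    unfolding nva_hom_def using lin by (auto intro!: fls_eqI simp: fls_map_nth nth cbilinearD[OF
      cbilinear_tensor])
  show "nva_subalgebra smash (vac\<^sub>V \<otimes> vac\<^sub>H) (range (\<lambda>h. vac\<^sub>V \<otimes> h))"
    unfolding nva_subalgebra_def using subspace_range[OF lin] by (auto simp: nth)
  show "inj (\<lambda>h::'h. vac\<^sub>V \<otimes> h)" if V: "(UNIV :: 'v set) \<noteq> {0}"
  proof -
    obtain v :: 'v where "v \<noteq> 0" using V by auto
    \<comment> \<open>Each v is the constant term of Y(v, x) applied to the vacuum, so a zero vacuum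
      would force V = 0.\<close>
    then have "vac\<^sub>V \<noteq> 0"
      using V.creation_limit[of v] cbilinearD(6)[OF V.bilinear, of v] by auto
    then have "cvec.independent {vac\<^sub>V}" by simp
    moreover have "vector_space_pair ((*\<^sub>C) :: complex \<Rightarrow> 'v \<Rightarrow> 'v) ((*\<^sub>C) :: complex \<Rightarrow> complex \<Rightarrow> complex)"
      by (simp add: vector_space_pair_def cvec.vector_space_axioms)
    ultimately obtain \<phi> :: "'v \<Rightarrow> complex" where \<phi>: "clinear \<phi>" "\<phi> vac\<^sub>V = 1"
      using vector_space_pair.linear_independent_extend[of "(*\<^sub>C)" "(*\<^sub>C)" "{vac\<^sub>V}" "\<lambda>_. 1"] by blast
    have b: "cbilinear (\<lambda>v (h::'h). \<phi> v *\<^sub>C h)"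
      by (rule cbilinearI) (simp_all add: clinear_add[OF \<phi>(1)] clinear_scale[OF \<phi>(1)]
          scaleC_add_left scaleC_add_right scaleC_scaleC scaleC_complex_def mult.commute)
    show ?thesis
    proof (rule injI)
      fix h k :: 'h assume "vac\<^sub>V \<otimes> h = vac\<^sub>V \<otimes> k"
      then have "tensor_lift (\<lambda>v h. \<phi> v *\<^sub>C h) (vac\<^sub>V \<otimes> h) = tensor_lift (\<lambda>v h. \<phi> v *\<^sub>C h) (vac\<^sub>V \<otimes> k)"
          by simp
      then show "h = k" by (simp add: tensor_lift_tensor[OF b] \<phi>(2) scaleC_one)
    qed
  qed
qed

section \<open>The commutation relation between \<open>H\<close> and \<open>V\<close>\<close>

lemma twisted_product_support:
  "finite {(m, j). c m j *\<^sub>C (Y\<^sub>V (Y\<^sub>M h\<^sub>1 u $$ m) (Y\<^sub>M h\<^sub>2 v $$ (a - m + int j)) $$ (b - int j)) \<noteq> 0}"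
proof -
  obtain N M K where "\<forall>m a b. m < N \<or> a < M \<or> b < K \<longrightarrow> Y\<^sub>V (Y\<^sub>M h\<^sub>1 u $$ m) (Y\<^sub>M h\<^sub>2 v $$ a) $$ b = 0"
    using twisted_product_bounded by blast
  then have bd: "m < N \<or> a < M \<or> b < K \<Longrightarrow> Y\<^sub>V (Y\<^sub>M h\<^sub>1 u $$ m) (Y\<^sub>M h\<^sub>2 v $$ a) $$ b = 0" for m a b by blast
  show ?thesis by (rule subst_diff_finite[OF bd])
qed

lemma twisted_product_linear:
  shows "twisted_product Y\<^sub>V id Y\<^sub>M (h + h') u Y\<^sub>M g v a b =
      twisted_product Y\<^sub>V id Y\<^sub>M h u Y\<^sub>M g v a b + twisted_product Y\<^sub>V id Y\<^sub>M h' u Y\<^sub>M g v a b"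
    and "twisted_product Y\<^sub>V id Y\<^sub>M (c *\<^sub>C h) u Y\<^sub>M g v a b = c *\<^sub>C twisted_product Y\<^sub>V id Y\<^sub>M h u Y\<^sub>M g v a b"
    and "twisted_product Y\<^sub>V id Y\<^sub>M g u Y\<^sub>M (h + h') v a b =
      twisted_product Y\<^sub>V id Y\<^sub>M g u Y\<^sub>M h v a b + twisted_product Y\<^sub>V id Y\<^sub>M g u Y\<^sub>M h' v a b"
    and "twisted_product Y\<^sub>V id Y\<^sub>M g u Y\<^sub>M (c *\<^sub>C h) v a b = c *\<^sub>C twisted_product Y\<^sub>V id Y\<^sub>M g u Y\<^sub>M h v a b"
proof -
  note fin = twisted_product_support[where c = "\<lambda>m j. (-1) ^ j * (of_int m gchoose j)", unfolded
      case_prod_unfold]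
  note bl = cbilinearD[OF V.bilinear] cbilinearD[OF M.module_bilinear] scaleC_fls.rep_eq
  note tw = twisted_product_def subst_diff_def id_apply case_prod_unfold
  show "twisted_product Y\<^sub>V id Y\<^sub>M (h + h') u Y\<^sub>M g v a b =
      twisted_product Y\<^sub>V id Y\<^sub>M h u Y\<^sub>M g v a b + twisted_product Y\<^sub>V id Y\<^sub>M h' u Y\<^sub>M g v a b"
    "twisted_product Y\<^sub>V id Y\<^sub>M g u Y\<^sub>M (h + h') v a b =
      twisted_product Y\<^sub>V id Y\<^sub>M g u Y\<^sub>M h v a b + twisted_product Y\<^sub>V id Y\<^sub>M g u Y\<^sub>M h' v a b"
    unfolding tw by (simp_all only: Sum_any.distrib[OF fin fin, symmetric] bl fls_plus_nth
      scaleC_add_right)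
  have comm: "x *\<^sub>C c *\<^sub>C z = c *\<^sub>C x *\<^sub>C z" for x :: complex and z :: 'v
      by (simp add: scaleC_scaleC mult.commute)
  show "twisted_product Y\<^sub>V id Y\<^sub>M (c *\<^sub>C h) u Y\<^sub>M g v a b = c *\<^sub>C twisted_product Y\<^sub>V id Y\<^sub>M h u Y\<^sub>M g v a b"
    "twisted_product Y\<^sub>V id Y\<^sub>M g u Y\<^sub>M (c *\<^sub>C h) v a b = c *\<^sub>C twisted_product Y\<^sub>V id Y\<^sub>M g u Y\<^sub>M h v a b"
    unfolding tw by (simp_all only: Sum_any_scaleC[symmetric] bl comm)
qed

text \<open>Coefficient of x1^a x2^b in Y(Y(h1, x1 - x2)u, x2)Y(h2, x1)v \<otimes> Y(h3, x1)k, the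
  trilinear expression to which both sides of the relation reduce.\<close>

definition relation_term where
  "relation_term u v k a b h\<^sub>1 h\<^sub>2 h\<^sub>3 =
    Sum_any (\<lambda>i. twisted_product Y\<^sub>V id Y\<^sub>M h\<^sub>1 u Y\<^sub>M h\<^sub>2 v i b \<otimes> (Y\<^sub>H h\<^sub>3 k $$ (a - i)))"

lemma relation_term_support:
  "finite {i. twisted_product Y\<^sub>V id Y\<^sub>M h\<^sub>1 u Y\<^sub>M h\<^sub>2 v i b \<otimes> (Y\<^sub>H h\<^sub>3 k $$ (a - i)) \<noteq> 0}"
proof -
  obtain N M K where B: "\<forall>m a b. m < N \<or> a < M \<or> b < K \<longrightarrow> Y\<^sub>V (Y\<^sub>M h\<^sub>1 u $$ m) (Y\<^sub>M h\<^sub>2 v $$ a) $$ b = 0"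
    using twisted_product_bounded by blast
  have "laurent2 (\<lambda>m a b. Y\<^sub>V (Y\<^sub>M h\<^sub>1 u $$ m) (Y\<^sub>M h\<^sub>2 v $$ a) $$ b)"
    by (rule laurent2I[of K]) (use B in blast)+
  then have "laurent2 (\<lambda>_::unit. twisted_product Y\<^sub>V id Y\<^sub>M h\<^sub>1 u Y\<^sub>M h\<^sub>2 v)"
    unfolding twisted_product_def id_apply by (rule laurent2_subst_diff[where ?N0.0 = N]) (use B in
      blast)
  then obtain L where L: "\<And>a b'. b' \<le> b \<Longrightarrow> a < L \<Longrightarrow> twisted_product Y\<^sub>V id Y\<^sub>M h\<^sub>1 u Y\<^sub>M h\<^sub>2 v a b' = 0"
    unfolding laurent2_def by meson
  have "i \<in> {L..a - fls_subdegree (Y\<^sub>H h\<^sub>3 k)}"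
    if "twisted_product Y\<^sub>V id Y\<^sub>M h\<^sub>1 u Y\<^sub>M h\<^sub>2 v i b \<otimes> (Y\<^sub>H h\<^sub>3 k $$ (a - i)) \<noteq> 0" for i
  proof -
    have "twisted_product Y\<^sub>V id Y\<^sub>M h\<^sub>1 u Y\<^sub>M h\<^sub>2 v i b \<noteq> 0" "Y\<^sub>H h\<^sub>3 k $$ (a - i) \<noteq> 0"
      using that by (auto simp: cbilinearD[OF cbilinear_tensor])
    then show ?thesis using L[of b i] fls_subdegree_leI[of "Y\<^sub>H h\<^sub>3 k" "a - i"] by force
  qed
  then have "{i. twisted_product Y\<^sub>V id Y\<^sub>M h\<^sub>1 u Y\<^sub>M h\<^sub>2 v i b \<otimes> (Y\<^sub>H h\<^sub>3 k $$ (a - i)) \<noteq> 0} \<subseteq>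
      {L..a - fls_subdegree (Y\<^sub>H h\<^sub>3 k)}" by blast
  then show ?thesis by (rule finite_subset) simp
qed

lemma relation_term_trilinear:
  "cbilinear (relation_term u v k a b h\<^sub>1)" "clinear (\<lambda>h\<^sub>1. relation_term u v k a b h\<^sub>1 h\<^sub>2 h\<^sub>3)"
proof -
  note add = Sum_any.distrib[OF relation_term_support relation_term_support, symmetric]
  note bl = cbilinearD[OF cbilinear_tensor] cbilinearD[OF H.bilinear] twisted_product_linear
      scaleC_fls.rep_eq
  show "cbilinear (relation_term u v k a b h\<^sub>1)"
    unfolding relation_term_def[abs_def]
      by (rule cbilinearI) (simp_all add: add Sum_any_scaleC[symmetric] bl)
  show "clinear (\<lambda>h\<^sub>1. relation_term u v k a b h\<^sub>1 h\<^sub>2 h\<^sub>3)"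
    unfolding relation_term_def[abs_def]
      by (rule clinearI) (simp_all add: add Sum_any_scaleC[symmetric] bl)
qed

text \<open>Applying h splits it as g \<otimes> h3, and the action axiom then splits the first
  factor g.\<close>

lemma relation_product:
  "vo_product smash (vac\<^sub>V \<otimes> h) smash (u \<otimes> vac\<^sub>H) (v \<otimes> k) a b =
    tensor_lift (\<lambda>g h\<^sub>3. tensor_lift (\<lambda>h\<^sub>1 h\<^sub>2. relation_term u v k a b h\<^sub>1 h\<^sub>2 h\<^sub>3) (\<Delta> g)) (\<Delta> h)"
proof -
  have lin: "clinear (\<lambda>z. z \<otimes> y)" for y :: 'h by (rule cbilinear_clinear(2)[OF cbilinear_tensor])
  have act: "Y\<^sub>M g (Y\<^sub>V u v $$ b) $$ i = tensor_lift (\<lambda>h\<^sub>1 h\<^sub>2. twisted_product Y\<^sub>V id Y\<^sub>M h\<^sub>1 u Y\<^sub>M h\<^sub>2 v i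
      b) (\<Delta> g)" for g i
    using action_product[of g u v i b] by (simp add: vo_product_def)
  have "Sum_any (\<lambda>i. (Y\<^sub>M g (Y\<^sub>V u v $$ b) $$ i) \<otimes> (Y\<^sub>H h\<^sub>3 k $$ (a - i))) =
      tensor_lift (\<lambda>h\<^sub>1 h\<^sub>2. relation_term u v k a b h\<^sub>1 h\<^sub>2 h\<^sub>3) (\<Delta> g)" for g h\<^sub>3
    unfolding relation_term_def act tensor_lift_linear[OF lin]
    by (rule tensor_lift_Sum_any[OF relation_term_support, symmetric])
  then show ?thesis
    unfolding vo_product_def smash_left_V fls_tensor_const_nth smash_left_H tensor_lift_linear[OF
      clinear_fls_nth]
    by (simp add: fls_tensor_nth_Sum_any)
qed

text \<open>Here it is the second factor g that is split, by its smash operator on v \<otimes> k.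
  Comparison with \<open>relation_product\<close> leaves exactly coassociativity.\<close>

lemma relation_twisted:
  "twisted_product smash (\<lambda>u. u \<otimes> vac\<^sub>H) Y\<^sub>M h\<^sub>1 u smash (vac\<^sub>V \<otimes> g) (v \<otimes> k) a b =
    tensor_lift (\<lambda>h\<^sub>2 h\<^sub>3. relation_term u v k a b h\<^sub>1 h\<^sub>2 h\<^sub>3) (\<Delta> g)"
proof -
  define W where "W h\<^sub>2 m i \<beta> = Y\<^sub>V (Y\<^sub>M h\<^sub>1 u $$ m) (Y\<^sub>M h\<^sub>2 v $$ i) $$ \<beta>" for h\<^sub>2 m i \<beta>
  define c :: "int \<Rightarrow> nat \<Rightarrow> complex" where "c m j = (-1) ^ j * (of_int m gchoose j)" for m j
  define T where "T h\<^sub>2 h\<^sub>3 = (\<lambda>(m, j) i. c m j *\<^sub>C (W h\<^sub>2 m i (b - int j) \<otimes> (Y\<^sub>H h\<^sub>3 k $$ (a - m +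
      int j - i))))" for h\<^sub>2 h\<^sub>3
  have fin: "finite {(x, i). T h\<^sub>2 h\<^sub>3 x i \<noteq> 0}" for h\<^sub>2 h\<^sub>3
  proof -
    obtain N M K where B: "\<forall>m a b. m < N \<or> a < M \<or> b < K \<longrightarrow> W h\<^sub>2 m a b = 0"
      unfolding W_def using twisted_product_bounded by blast
    let ?s = "fls_subdegree (Y\<^sub>H h\<^sub>3 k)" and ?J = "\<bar>b - K\<bar>"
    \<comment> \<open>The exponents m, i and a - m + j - i sum to a + j and are bounded below by N,
      M and \<open>?s\<close>; with j bounded, each is bounded above.\<close>
    have "m \<in> {N..a + ?J - M - ?s} \<and> j \<in> {..nat ?J} \<and> i \<in> {M..a - N + ?J - ?s}"
      if "W h\<^sub>2 m i (b - int j) \<otimes> (Y\<^sub>H h\<^sub>3 k $$ (a - m + int j - i)) \<noteq> 0" for m j i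
    proof -
      have "W h\<^sub>2 m i (b - int j) \<noteq> 0" "Y\<^sub>H h\<^sub>3 k $$ (a - m + int j - i) \<noteq> 0"
        using that by (auto simp: cbilinearD[OF cbilinear_tensor])
      then have "\<not> m < N" "\<not> i < M" "\<not> b - int j < K" "?s \<le> a - m + int j - i"
        using B fls_subdegree_leI[of "Y\<^sub>H h\<^sub>3 k" "a - m + int j - i"] by blast+
      then show ?thesis by auto
    qed
    then have "{(x, i). T h\<^sub>2 h\<^sub>3 x i \<noteq> 0} \<subseteq> ({N..a + ?J - M - ?s} \<times> {..nat ?J}) \<times> {M..a - N + ?J - ?s}"
      unfolding T_def by fastforce
    then show ?thesis by (rule finite_subset) simp
  qed
  have fin': "finite {x. Sum_any (T h\<^sub>2 h\<^sub>3 x) \<noteq> 0}" for h\<^sub>2 h\<^sub>3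
  proof (rule finite_subset)
    show "{x. Sum_any (T h\<^sub>2 h\<^sub>3 x) \<noteq> 0} \<subseteq> fst ` {(x, i). T h\<^sub>2 h\<^sub>3 x i \<noteq> 0}"
    proof
      fix x assume "x \<in> {x. Sum_any (T h\<^sub>2 h\<^sub>3 x) \<noteq> 0}"
      then obtain i where "T h\<^sub>2 h\<^sub>3 x i \<noteq> 0" by (auto elim: Sum_any.not_neutral_obtains_not_neutral)
      then show "x \<in> fst ` {(x, i). T h\<^sub>2 h\<^sub>3 x i \<noteq> 0}" by (intro image_eqI[of _ _ "(x, i)"]) auto
    qed
  qed (use fin in blast)
  have coeff: "smash ((Y\<^sub>M h\<^sub>1 u $$ m) \<otimes> vac\<^sub>H) (smash (vac\<^sub>V \<otimes> g) (v \<otimes> k) $$ \<alpha>) $$ \<beta> =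
      tensor_lift (\<lambda>h\<^sub>2 h\<^sub>3. Sum_any (\<lambda>i. W h\<^sub>2 m i \<beta> \<otimes> (Y\<^sub>H h\<^sub>3 k $$ (\<alpha> - i)))) (\<Delta> g)" for m \<alpha> \<beta>
  proof -
    have lin: "clinear (\<lambda>t. smash ((Y\<^sub>M h\<^sub>1 u $$ m) \<otimes> vac\<^sub>H) t $$ \<beta>)"
        by (rule cbilinear_clinear_nth(1)[OF cbilinear_smash])
    show ?thesis
      unfolding smash_left_H tensor_lift_linear[OF clinear_fls_nth] tensor_lift_linear[OF lin]
        fls_tensor_nth_Sum_any
        clinear_Sum_any[OF lin fls_tensor_support]
      by (simp add: smash_left_V fls_tensor_const_nth W_def)
  qed
  have "twisted_product smash (\<lambda>u. u \<otimes> vac\<^sub>H) Y\<^sub>M h\<^sub>1 u smash (vac\<^sub>V \<otimes> g) (v \<otimes> k) a b =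
      Sum_any (\<lambda>x. tensor_lift (\<lambda>h\<^sub>2 h\<^sub>3. Sum_any (T h\<^sub>2 h\<^sub>3 x)) (\<Delta> g))"
    by (simp add: twisted_product_def subst_diff_def coeff c_def[symmetric] T_def case_prod_unfold
        Sum_any_scaleC tensor_lift_scale_fun)
  also have "\<dots> = tensor_lift (\<lambda>h\<^sub>2 h\<^sub>3. Sum_any (\<lambda>x. Sum_any (T h\<^sub>2 h\<^sub>3 x))) (\<Delta> g)"
    by (rule tensor_lift_Sum_any[OF fin', symmetric])
  also have "(\<lambda>h\<^sub>2 h\<^sub>3. Sum_any (\<lambda>x. Sum_any (T h\<^sub>2 h\<^sub>3 x))) = (\<lambda>h\<^sub>2 h\<^sub>3. relation_term u v k a b h\<^sub>1 h\<^sub>2 h\<^sub>3)"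
  proof (intro ext)
    fix h\<^sub>2 h\<^sub>3
    \<comment> \<open>The new outer index i + m - j is the total x1 exponent of the
      \<open>V\<close>-component.\<close>
    have "Sum_any (\<lambda>x. Sum_any (T h\<^sub>2 h\<^sub>3 x)) = Sum_any (\<lambda>i. Sum_any (\<lambda>(m, j).
        (c m j *\<^sub>C W h\<^sub>2 m (i - m + int j) (b - int j)) \<otimes> (Y\<^sub>H h\<^sub>3 k $$ (a - i))))"
      by (rule Sum_any_nested_reindex[OF fin, of
            "\<lambda>(x, i). (i + fst x - int (snd x), x)" "\<lambda>(i, x). (x, i - fst x + int (snd x))"])
        (auto simp: T_def case_prod_unfold algebra_simps cbilinearD[OF cbilinear_tensor])
    also have "\<dots> = relation_term u v k a b h\<^sub>1 h\<^sub>2 h\<^sub>3"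
      unfolding relation_term_def
    proof (rule Sum_any.cong)
      fix i
      have \<phi>: "clinear (\<lambda>z. z \<otimes> (Y\<^sub>H h\<^sub>3 k $$ (a - i)))"
          by (rule cbilinear_clinear(2)[OF cbilinear_tensor])
      have "finite {x. (\<lambda>(m, j). c m j *\<^sub>C W h\<^sub>2 m (i - m + int j) (b - int j)) x \<noteq> 0}"
        using twisted_product_support[of c h\<^sub>1 u h\<^sub>2 v i b] by (simp only: W_def case_prod_unfold)
      from clinear_Sum_any[OF \<phi> this]
      show "Sum_any (\<lambda>(m, j). (c m j *\<^sub>C W h\<^sub>2 m (i - m + int j) (b - int j)) \<otimes> (Y\<^sub>H h\<^sub>3 k $$ (a - i))) =
          twisted_product Y\<^sub>V id Y\<^sub>M h\<^sub>1 u Y\<^sub>M h\<^sub>2 v i b \<otimes> (Y\<^sub>H h\<^sub>3 k $$ (a - i))"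
        by (simp add: twisted_product_def subst_diff_def c_def W_def case_prod_unfold)
    qed
    finally show "Sum_any (\<lambda>x. Sum_any (T h\<^sub>2 h\<^sub>3 x)) = relation_term u v k a b h\<^sub>1 h\<^sub>2 h\<^sub>3" .
  qed
  finally show ?thesis .
qed

text \<open>Additivity of \<open>subst_diff\<close> in w needs finite sums, hence a lower bound in
  x2 uniform in m and a. On decomposable tensors it comes from
  \<open>twisted_product_bounded\<close>; for sums the minimum is taken.\<close>

lemma smash_twisted_bounded:
  "\<exists>K. \<forall>m a b. b < K \<longrightarrow> smash ((Y\<^sub>M h u $$ m) \<otimes> vac\<^sub>H) (smash (vac\<^sub>V \<otimes> g) w $$ a) $$ b = 0"
proof (induction w rule: tensor_induct)
  case (tensor v k)
  have "\<exists>K. \<forall>z b. b < K \<longrightarrow> Sum_any (\<lambda>i. (Y\<^sub>V (Y\<^sub>M h u $$ fst z) (Y\<^sub>M h\<^sub>2 v $$ i) $$ b) \<otimes> (Y\<^sub>H h\<^sub>3 k $$ (snd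
      z - i))) = 0" for h\<^sub>2 h\<^sub>3
  proof -
    obtain N M K where "\<forall>m a b. m < N \<or> a < M \<or> b < K \<longrightarrow> Y\<^sub>V (Y\<^sub>M h u $$ m) (Y\<^sub>M h\<^sub>2 v $$ a) $$ b = 0"
      using twisted_product_bounded by blast
    then show ?thesis by (intro exI[of _ K]) (simp add: cbilinearD[OF cbilinear_tensor])
  qed
  from tensor_lift_bounded[where t = "\<Delta> g", OF this] obtain K where K: "\<forall>z b. b < K \<longrightarrow>
      tensor_lift (\<lambda>h\<^sub>2 h\<^sub>3. Sum_any (\<lambda>i. (Y\<^sub>V (Y\<^sub>M h u $$ fst z) (Y\<^sub>M h\<^sub>2 v $$ i) $$ b) \<otimes> (Y\<^sub>H h\<^sub>3 k $$
          (snd z - i)))) (\<Delta> g) = 0" ..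
  have "smash ((Y\<^sub>M h u $$ m) \<otimes> vac\<^sub>H) (smash (vac\<^sub>V \<otimes> g) (v \<otimes> k) $$ a) $$ b = 
      tensor_lift (\<lambda>h\<^sub>2 h\<^sub>3. Sum_any (\<lambda>i. (Y\<^sub>V (Y\<^sub>M h u $$ m) (Y\<^sub>M h\<^sub>2 v $$ i) $$ b) \<otimes> (Y\<^sub>H h\<^sub>3 k $$ (a -
          i)))) (\<Delta> g)" for m a b
  proof -
    have lin: "clinear (\<lambda>t. smash ((Y\<^sub>M h u $$ m) \<otimes> vac\<^sub>H) t $$ b)"
        by (rule cbilinear_clinear_nth(1)[OF cbilinear_smash])
    show ?thesis
      unfolding smash_left_H tensor_lift_linear[OF clinear_fls_nth] tensor_lift_linear[OF lin]
        fls_tensor_nth_Sum_any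
        clinear_Sum_any[OF lin fls_tensor_support]
      by (simp add: smash_left_V fls_tensor_const_nth)
  qed
  then show ?case using K by (intro exI[of _ K]) simp
next
  case (add w w')
  then obtain K K' where "\<forall>m a b. b < K \<longrightarrow> smash ((Y\<^sub>M h u $$ m) \<otimes> vac\<^sub>H) (smash (vac\<^sub>V \<otimes> g) w $$ a) $$
      b = 0"
    "\<forall>m a b. b < K' \<longrightarrow> smash ((Y\<^sub>M h u $$ m) \<otimes> vac\<^sub>H) (smash (vac\<^sub>V \<otimes> g) w' $$ a) $$ b = 0" by blast
  then show ?case by (intro exI[of _ "min K K'"]) (simp add: cbilinearD[OF cbilinear_smash])
qed

lemma smash_twisted_add:
  "twisted_product smash (\<lambda>u. u \<otimes> vac\<^sub>H) Y\<^sub>M h u smash (vac\<^sub>V \<otimes> g) (w + w') a b =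
    twisted_product smash (\<lambda>u. u \<otimes> vac\<^sub>H) Y\<^sub>M h u smash (vac\<^sub>V \<otimes> g) w a b +
    twisted_product smash (\<lambda>u. u \<otimes> vac\<^sub>H) Y\<^sub>M h u smash (vac\<^sub>V \<otimes> g) w' a b"
proof -
  note bl = cbilinearD[OF cbilinear_smash] cbilinearD[OF cbilinear_tensor]
  have fin: "finite {x. (case x of (m, j) \<Rightarrow> c m j *\<^sub>C (smash ((Y\<^sub>M h u $$ m) \<otimes> vac\<^sub>H)
      (smash (vac\<^sub>V \<otimes> g) w $$ (a - m + int j)) $$ (b - int j))) \<noteq> 0}" for c w
  proof -
    obtain K where K: "\<forall>m a b. b < K \<longrightarrow> smash ((Y\<^sub>M h u $$ m) \<otimes> vac\<^sub>H) (smash (vac\<^sub>V \<otimes> g) w $$ a) $$ b = 0"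
      using smash_twisted_bounded by blast
    have "smash ((Y\<^sub>M h u $$ m) \<otimes> vac\<^sub>H) (smash (vac\<^sub>V \<otimes> g) w $$ a) $$ b = 0"
      if "m < fls_subdegree (Y\<^sub>M h u) \<or> a < fls_subdegree (smash (vac\<^sub>V \<otimes> g) w) \<or> b < K" for m a b
      using that K by (auto simp: bl)
    from subst_diff_finite[where c = c and a = a and b = b, OF this] show ?thesis
        by (simp only: case_prod_unfold)
  qed
  show ?thesis
    unfolding twisted_product_def subst_diff_def
    by (subst Sum_any.distrib[OF fin fin, symmetric]) (simp add: case_prod_unfold bl scaleC_add_right)
qed

text \<open>For decomposable w the two sides sum \<open>relation_term\<close> over the two iterated
  coproducts of h, which agree by coassociativity; additivity in w gives the general case.\<close>

lemma smash_relation: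
  "vo_product smash (vac\<^sub>V \<otimes> h) smash (u \<otimes> vac\<^sub>H) w a b =
    tensor_lift (\<lambda>h\<^sub>1 h\<^sub>2. twisted_product smash (\<lambda>u. u \<otimes> vac\<^sub>H) Y\<^sub>M h\<^sub>1 u smash (vac\<^sub>V \<otimes> h\<^sub>2) w a b) (\<Delta> h)"
proof (induction w rule: tensor_induct)
  case (tensor v k)
  show ?case
    unfolding relation_product relation_twisted by (rule H.coassoc_lift[OF relation_term_trilinear])
next
  case (add w w')
  then show ?case by (simp add: smash_product_linear smash_twisted_add tensor_lift_add_fun)
qed

end

theorem theorem4p9:
  fixes Y\<^sub>H :: "'h::complex_vector \<Rightarrow> 'h \<Rightarrow> 'h fls" and vac\<^sub>H :: 'h
    and \<Delta> :: "'h \<Rightarrow> ('h, 'h) tensor" and \<epsilon> :: "'h \<Rightarrow> complex"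
    and Y\<^sub>V :: "'v::complex_vector \<Rightarrow> 'v \<Rightarrow> 'v fls" and vac\<^sub>V :: 'v
    and Y\<^sub>M :: "'h \<Rightarrow> 'v \<Rightarrow> 'v fls"
  assumes "vertex_bialgebra Y\<^sub>H vac\<^sub>H \<Delta> \<epsilon>"
    and "module_nonlocal_vertex_algebra Y\<^sub>H vac\<^sub>H \<Delta> \<epsilon> Y\<^sub>V vac\<^sub>V Y\<^sub>M"
  shows "let Ys = smash_Y Y\<^sub>H \<Delta> Y\<^sub>V Y\<^sub>M;
             vac = vac\<^sub>V \<otimes> vac\<^sub>H;
             \<iota>\<^sub>V = (\<lambda>u. u \<otimes> vac\<^sub>H);
             \<iota>\<^sub>H = (\<lambda>h. vac\<^sub>V \<otimes> h)
         in nonlocal_vertex_algebra Ys vac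
          \<and> nva_subalgebra Ys vac (range \<iota>\<^sub>V) \<and> nva_hom Y\<^sub>V vac\<^sub>V Ys vac \<iota>\<^sub>V \<and> inj \<iota>\<^sub>V
          \<and> nva_subalgebra Ys vac (range \<iota>\<^sub>H) \<and> nva_hom Y\<^sub>H vac\<^sub>H Ys vac \<iota>\<^sub>H
          \<and> ((UNIV :: 'v set) \<noteq> {0} \<longrightarrow> inj \<iota>\<^sub>H)
          \<and> (\<forall>h u w a b.
               vo_product Ys (\<iota>\<^sub>H h) Ys (\<iota>\<^sub>V u) w a b =
               tensor_lift (\<lambda>h\<^sub>1 h\<^sub>2. twisted_product Ys \<iota>\<^sub>V Y\<^sub>M h\<^sub>1 u Ys (\<iota>\<^sub>H h\<^sub>2) w a b) (\<Delta> h))"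
proof -
  interpret module_nonlocal_vertex_algebra Y\<^sub>H vac\<^sub>H \<Delta> \<epsilon> Y\<^sub>V vac\<^sub>V Y\<^sub>M by (rule assms(2))
  show ?thesis
    unfolding Let_def
    by (intro conjI allI impI nonlocal_vertex_algebra_smash nva_subalgebra_V nva_hom_V inj_V
        nva_subalgebra_H nva_hom_H inj_H smash_relation)
qed

end
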